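(* Let $n\ge 1$ and let $M=M_1^{(n)}$ be the $p(n)\times p(n)$ integer matrix of the linear map $T_1(v)=\frac{\partial}{\partial p_1}(p_1 v)$ on $\Lambda_{\mathbb{Q}}^n$ with respect to the basis of Schur functions $\{s_\lambda : \lambda\vdash n\}$ (arranged in lexicographic order). Let $\lambda(n)=(p(n)-p(n-1),\dotsc,p(2)-p(1),p(1))$, which is a partition of $p(n)$ with $n$ parts, let $t$ be its largest part (so $t=p(n)-p(n-1)$ for $n\ge 2$), and write its conjugate partition as $\lambda(n)'=(j_t,\dotsc,j_2,j_1)$, so that $j_1\le j_2\le\dotsb\le j_t=n$. Put $a_i(x)=i+x$ for $i=1,2,\dotsc,n-1$ and $a_n(x)=n+1+x$, and let $\alpha_k(x)=a_1(x)a_2(x)\dotsm a_k(x)$ for $1\le k\le n$. Then there exist matrices $P(x),Q(x)\in \mathrm{SL}(p(n),\mathbb{Z}[x])$ such that $$P(x)\,(M+xI_{p(n)})\,Q(x)=\mathrm{diag}\bigl(1,1,\dotsc,1,\alpha_{j_1}(x),\alpha_{j_2}(x),\dotsc,\alpha_{j_t}(x)\bigr),$$ where the number of diagonal entries listed as $1$ is $p(n)-t$.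
   Context: $p(n)$ is the number of partitions of $n$. $\Lambda$ is the ring of symmetric functions over $\mathbb{Z}$, $\Lambda_{\mathbb{Q}}=\Lambda\otimes_{\mathbb{Z}}\mathbb{Q}=\mathbb{Q}[p_1,p_2,\dotsc]$, where $p_i$ are the power sum symmetric functions, and $\Lambda_{\mathbb{Q}}^n$ is its homogeneous component of degree $n$ (with $\deg p_i=i$), which has the Schur functions $s_\lambda$, $\lambda\vdash n$, as a $\mathbb{Q}$-basis. Elements of $\Lambda_{\mathbb{Q}}$ are regarded as polynomials in the $p_j$, and $\frac{\partial}{\partial p_1}$ is the partial derivative with $p_2,p_3,\dotsc$ treated as constants. The matrix $M$ has integer entries. $I_m$ is the $m\times m$ identity matrix, and $\mathrm{SL}(m,R)$ is the group of $m\times m$ matrices of determinant $1$ over the commutative ring $R$. *)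

theory Defs
  imports
    "HOL-Library.Multiset"
    "HOL-Library.Poly_Mapping"
    "HOL-Library.List_Lexorder"
    "HOL-Computational_Algebra.Polynomial"
    "Jordan_Normal_Form.Matrix"
    "Jordan_Normal_Form.Determinant"
begin

section \<open>Partitions\<close>

definition partitions :: "nat \<Rightarrow> nat list set" where
  "partitions n = {\<nu>. sorted_wrt (\<ge>) \<nu> \<and> 0 \<notin> set \<nu> \<and> sum_list \<nu> = n}"

definition num_partitions :: "nat \<Rightarrow> nat" where
  "num_partitions n = card (partitions n)"

text \<open>
  The order on \<open>nat list\<close> is the lexicographic one of \<^theory>\<open>HOL-Library.List_Lexorder\<close>,
  so the enumeration (indexed from \<open>0\<close>) runs from \<open>(1,\<dots>,1)\<close> up to \<open>(n)\<close>.
\<close>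
definition nth_partition :: "nat \<Rightarrow> nat \<Rightarrow> nat list" where
  "nth_partition n i = sorted_list_of_set (partitions n) ! i"

definition largest_part :: "nat list \<Rightarrow> nat" where
  "largest_part \<nu> = Max (insert 0 (set \<nu>))"

definition conjugate_partition :: "nat list \<Rightarrow> nat list" where
  "conjugate_partition \<nu> = map (\<lambda>i. length (filter (\<lambda>a. i \<le> a) \<nu>)) [1..<Suc (largest_part \<nu>)]"

lemma finite_partitions: "finite (partitions n)"
proof (rule finite_subset)
  show "partitions n \<subseteq> {xs. set xs \<subseteq> {..n} \<and> length xs \<le> n}"
  proof
    fix xs assume xs: "xs \<in> partitions n"
    have "length ys \<le> sum_list ys" if "0 \<notin> set ys" for ys :: "nat list"
      using that by (induction ys) auto
    then show "xs \<in> {xs. set xs \<subseteq> {..n} \<and> length xs \<le> n}"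
      using xs by (auto simp: partitions_def intro: member_le_sum_list)
  qed
qed (simp add: finite_lists_length_le)

section \<open>Symmetric functions as polynomials in the power sums\<close>

text \<open>
  Multivariate polynomials over the rationals in variables indexed by the natural numbers: a monomial
  is the multiset of its variables, and multiplication is convolution over multiset union.
\<close>
type_synonym mpoly_rat = "(nat multiset, rat) poly_mapping"

abbreviation mpoly_const :: "rat \<Rightarrow> mpoly_rat" where
  "mpoly_const c \<equiv> Poly_Mapping.single {#} c"

abbreviation mpoly_var :: "nat \<Rightarrow> mpoly_rat" where
  "mpoly_var i \<equiv> Poly_Mapping.single {#i#} 1"

text \<open>
  \<open>\<Lambda>\<^sub>\<rat> = \<rat>[p\<^sub>1, p\<^sub>2, \<dots>]\<close>; here \<open>mpoly_var k\<close> with \<open>k \<ge> 1\<close> stands for \<open>p\<^sub>k\<close>, and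
  the variable with index \<open>0\<close> does not occur.
\<close>
definition Lambda_Q :: "mpoly_rat set" where
  "Lambda_Q = {f. \<forall>\<mu> \<in> Poly_Mapping.keys f. 0 \<notin># \<mu>}"

text \<open>
  A symmetric function is given by its restrictions to finitely many variables \<open>x\<^sub>0, \<dots>, x\<^bsub>N-1\<^esub>\<close>,
  for all \<open>N\<close>.  These restrictions also have type \<^typ>\<open>mpoly_rat\<close>, with \<open>mpoly_var i\<close> now standing
  for \<open>x\<^sub>i\<close>.
\<close>
definition power_sum :: "nat \<Rightarrow> nat \<Rightarrow> mpoly_rat" where
  "power_sum N k = (\<Sum>i<N. mpoly_var i ^ k)"

definition restrict_vars :: "nat \<Rightarrow> mpoly_rat \<Rightarrow> mpoly_rat" where
  "restrict_vars N f =
    (\<Sum>\<mu> \<in> Poly_Mapping.keys f.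
       mpoly_const (Poly_Mapping.lookup f \<mu>) * (\<Prod>k \<in># \<mu>. power_sum N k))"

text \<open>A tableau is the list of its rows (English notation).\<close>
definition semistandard_tableaux :: "nat \<Rightarrow> nat list \<Rightarrow> nat list list set" where
  "semistandard_tableaux N \<nu> =
    {T. map length T = \<nu> \<and> set (concat T) \<subseteq> {..<N} \<and> (\<forall>r \<in> set T. sorted r) \<and>
        (\<forall>i j. Suc i < length T \<and> j < length (T ! i) \<and> j < length (T ! Suc i)
           \<longrightarrow> T ! i ! j < T ! Suc i ! j)}"

lemma finite_semistandard_tableaux: "finite (semistandard_tableaux N \<nu>)"
proof (rule finite_subset)
  let ?R = "{r. set r \<subseteq> {..<N} \<and> length r \<le> sum_list \<nu>}"
  show "semistandard_tableaux N \<nu> \<subseteq> {T. set T \<subseteq> ?R \<and> length T \<le> length \<nu>}"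
    by (auto simp: semistandard_tableaux_def intro: member_le_sum_list)
  show "finite {T. set T \<subseteq> ?R \<and> length T \<le> length \<nu>}"
    by (intro finite_lists_length_le) simp
qed

definition schur_poly :: "nat \<Rightarrow> nat list \<Rightarrow> mpoly_rat" where
  "schur_poly N \<nu> =
    (\<Sum>T \<in> semistandard_tableaux N \<nu>. Poly_Mapping.single (mset (concat T)) 1)"

text \<open>The Schur function \<open>s\<^sub>\<nu>\<close>, written as a polynomial in the power sums.\<close>
definition schur :: "nat list \<Rightarrow> mpoly_rat" where
  "schur \<nu> = (THE f. f \<in> Lambda_Q \<and> (\<forall>N. restrict_vars N f = schur_poly N \<nu>))"

section \<open>The operator and its matrix\<close>

definition deriv_p1 :: "mpoly_rat \<Rightarrow> mpoly_rat" where
  "deriv_p1 f =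
    (\<Sum>\<mu> \<in> Poly_Mapping.keys f.
       Poly_Mapping.single (\<mu> - {#1#}) (of_nat (count \<mu> 1) * Poly_Mapping.lookup f \<mu>))"

definition T1 :: "mpoly_rat \<Rightarrow> mpoly_rat" where
  "T1 v = deriv_p1 (mpoly_var 1 * v)"

text \<open>Column \<open>j\<close> holds the coordinates of the image of the \<open>j\<close>-th basis vector.\<close>
definition is_int_matrix_of ::
    "(mpoly_rat \<Rightarrow> mpoly_rat) \<Rightarrow> nat \<Rightarrow> (nat \<Rightarrow> mpoly_rat) \<Rightarrow> int mat \<Rightarrow> bool" where
  "is_int_matrix_of F m b A \<longleftrightarrow>
    A \<in> carrier_mat m m \<and>
    (\<forall>j<m. F (b j) = (\<Sum>i<m. mpoly_const (of_int (A $$ (i, j))) * b i))"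

definition M1 :: "nat \<Rightarrow> int mat" where
  "M1 n =
    (THE A. is_int_matrix_of T1 (num_partitions n) (\<lambda>i. schur (nth_partition n i)) A)"

section \<open>The Smith normal form\<close>

definition SL :: "nat \<Rightarrow> 'a::comm_ring_1 mat set" where
  "SL m = {A \<in> carrier_mat m m. det A = 1}"

text \<open>\<open>(p(n) - p(n-1), \<dots>, p(2) - p(1), p(1))\<close>\<close>
definition diff_partition :: "nat \<Rightarrow> nat list" where
  "diff_partition n =
    map (\<lambda>k. num_partitions k - num_partitions (k - 1)) (rev [2..<Suc n]) @ [num_partitions 1]"

definition a_poly :: "nat \<Rightarrow> nat \<Rightarrow> int poly" where
  "a_poly n i = (if i = n then [:int n + 1, 1:] else [:int i, 1:])"

definition alpha :: "nat \<Rightarrow> nat \<Rightarrow> int poly" where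
  "alpha n k = (\<Prod>i = 1..k. a_poly n i)"

text \<open>
  The parts of the conjugate partition are listed in decreasing order as \<open>j\<^sub>t, \<dots>, j\<^sub>1\<close>,
  hence the reversal.
\<close>
definition smith_diagonal :: "nat \<Rightarrow> int poly list" where
  "smith_diagonal n =
    replicate (num_partitions n - largest_part (diff_partition n)) 1 @
    map (alpha n) (rev (conjugate_partition (diff_partition n)))"

end

theory Submission
  imports Defs "HOL-Library.Function_Algebras" "Jordan_Normal_Form.Char_Poly"
begin

text \<open>
  The Schur functions enter through two rules only: multiplication by \<open>p\<^sub>1\<close> sends \<open>s\<^sub>\<nu>\<close> to the
  sum of the \<open>s\<^sub>\<tau>\<close> with \<open>\<tau>\<close> obtained by adding a box to \<open>\<nu>\<close>, and \<open>\<partial>/\<partial>p\<^sub>1\<close> sends \<open>s\<^sub>\<tau>\<close> to the sum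
  of the \<open>s\<^sub>\<mu>\<close> with \<open>\<mu>\<close> obtained by removing one.  Together with the linear independence of the
  Schur functions they identify \<open>M\<close> (\<open>M1_eq\<close>): its entry at two shapes is the number of shapes
  that arise from both by adding a box.  In other words \<open>M\<close> is the matrix of \<open>D U\<close>, where \<open>U\<close> and
  \<open>D\<close> are the up and down operators of the Young lattice, and \<open>D U - U D = 1\<close>.

  Both rules are checked on coefficients.  The coefficient of a symmetric function at a monomial
  depends only on the multiset of exponents.  For a Schur function it is a Kostka number, the number
  of ways to peel off a shape by horizontal strips of prescribed sizes; it is symmetric in these
  sizes by an involution on the shapes between two given ones.  For a product of power sums the
  coefficients are triangular with respect to the number of exponents, so every symmetric family is
  the restriction of exactly one polynomial in the power sums; in particular \<open>schur\<close> is well defined.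
  Multiplication by \<open>p\<^sub>1\<close> lowers one exponent by one, \<open>\<partial>/\<partial>p\<^sub>1\<close> extracts the coefficient with an
  additional exponent one, and the Kostka numbers satisfy the corresponding recursions
  (\<open>sum_add_box_kostka\<close>, \<open>kostka_Cons_1\<close>).

  For the Smith form, call a shape a twin if its two largest parts agree.  The vectors \<open>U\<^sup>a \<mu>\<close> with
  \<open>\<mu>\<close> a twin and \<open>a + |\<mu>| = n\<close> span the space, because adding a box to the first row is, up to shapes
  with a shorter first row, the operator \<open>U\<close>.  The relation \<open>D U - U D = 1\<close> gives
  \<open>D U (U\<^sup>a \<mu>) = (a + 1) U\<^sup>a \<mu> + U\<^sup>a\<^sup>+\<^sup>1 D \<mu>\<close>, and \<open>D \<mu>\<close> is a combination of twins and of
  vectors \<open>U \<kappa>\<close> with \<open>\<kappa>\<close> a twin.  Thus \<open>D U + x\<close> is triangular with respect to the level \<open>a + 1\<close>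
  and has the scalar \<open>a + 1 + x\<close> on each diagonal block.  There is no twin of size one, so \<open>a = n - 1\<close>
  does not occur; giving \<open>a = n\<close> the level \<open>n\<close> makes the levels consecutive, and the scalar on
  level \<open>i\<close> becomes \<open>a\<^sub>i(x)\<close>.

  What makes the long products \<open>\<alpha>\<^sub>k\<close> appear is that consecutive levels are linked by units: a vector
  \<open>i\<close> of level at least two occurs with coefficient one in the image of the vector \<open>pivot i\<close> of the
  preceding level, obtained by adding a new last part of size one, and all other vectors of that level
  or above that occur in this image have more parts than \<open>i\<close>.  The elimination lemma
  \<open>smith_of_chained_levels\<close> turns such a system into bases with respect to which the operator is
  diagonal, with entry \<open>1\<close> at the pivots and \<open>\<alpha>\<^sub>k\<close> at the remaining vectors of level \<open>k\<close>.  The level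
  sizes are the parts of \<open>\<lambda>(n)\<close>, hence the levels of the remaining vectors are the parts of the
  conjugate partition.
\<close>

section \<open>Shapes, interlacing and Kostka numbers\<close>

text \<open>
  Partitions are treated as antitone functions of finite support rather than as lists: adding a
  box is then an update at one place, and interlacing is a condition at each place without
  boundary cases.
\<close>
definition shapes :: "(nat \<Rightarrow> nat) set" where
  "shapes = {f. antimono f \<and> finite {i. f i \<noteq> 0}}"

definition shape_size :: "(nat \<Rightarrow> nat) \<Rightarrow> nat" where
  "shape_size f = (\<Sum>i | f i \<noteq> 0. f i)"

definition shapes_of :: "nat \<Rightarrow> (nat \<Rightarrow> nat) set" where
  "shapes_of n = {f \<in> shapes. shape_size f = n}"

text \<open>
  The boxes of \<open>\<nu>\<close> outside \<open>\<mu>\<close> form a horizontal strip, at most one box in each column.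
\<close>
definition interlaces :: "(nat \<Rightarrow> nat) \<Rightarrow> (nat \<Rightarrow> nat) \<Rightarrow> bool" where
  "interlaces \<mu> \<nu> \<longleftrightarrow> (\<forall>i. \<mu> i \<le> \<nu> i \<and> \<nu> (Suc i) \<le> \<mu> i)"

definition add_box :: "(nat \<Rightarrow> nat) \<Rightarrow> (nat \<Rightarrow> nat) set" where
  "add_box \<mu> = {\<nu> \<in> shapes. \<exists>i. \<nu> = \<mu>(i := Suc (\<mu> i))}"

definition remove_box :: "(nat \<Rightarrow> nat) \<Rightarrow> (nat \<Rightarrow> nat) set" where
  "remove_box \<nu> = {\<mu> \<in> shapes. \<nu> \<in> add_box \<mu>}"

definition strips :: "nat \<Rightarrow> (nat \<Rightarrow> nat) \<Rightarrow> (nat \<Rightarrow> nat) set" where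
  "strips c \<nu> = {\<mu>. interlaces \<mu> \<nu> \<and> shape_size \<nu> = shape_size \<mu> + c}"

text \<open>
  The list gives the sizes of the horizontal strips, starting with the one removed first, which
  carries the largest letter of a tableau.
\<close>
fun kostka :: "nat list \<Rightarrow> (nat \<Rightarrow> nat) \<Rightarrow> nat" where
  "kostka [] \<nu> = (if \<nu> = (\<lambda>_. 0) then 1 else 0)"
| "kostka (c # cs) \<nu> = (\<Sum>\<mu> \<in> strips c \<nu>. kostka cs \<mu>)"

lemma shape_size_eq_sum:
  assumes "\<And>i. m \<le> i \<Longrightarrow> f i = 0"
  shows "shape_size f = sum f {..<m}"
  unfolding shape_size_def proof (rule sum.mono_neutral_left)
  show "{i. f i \<noteq> 0} \<subseteq> {..<m}" using assms by (metis (mono_tags) lessThan_iff mem_Collect_eq not_less subsetI)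
qed auto

lemma finite_support_bound:
  fixes f :: "nat \<Rightarrow> nat"
  assumes "finite {i. f i \<noteq> 0}"
  obtains m where "\<And>i. m \<le> i \<Longrightarrow> f i = 0"
proof
  fix i assume "Suc (Max {i. f i \<noteq> 0}) \<le> i"
  then show "f i = 0" using Max_ge[OF assms, of i] by fastforce
qed

lemma shapes_antimono: "f \<in> shapes \<Longrightarrow> i \<le> j \<Longrightarrow> f j \<le> f i"
  by (auto simp: shapes_def antimono_def)

lemma shapesI:
  assumes "\<And>i. f (Suc i) \<le> f i" "\<And>i. m \<le> i \<Longrightarrow> f i = 0"
  shows "f \<in> shapes"
proof -
  have "{i. f i \<noteq> 0} \<subseteq> {..<m}"
    using assms(2) by (metis (mono_tags) lessThan_iff mem_Collect_eq not_less subsetI)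
  then show ?thesis
    using assms(1) finite_subset[of _ "{..<m}"] by (simp add: shapes_def antimono_iff_le_Suc)
qed

lemma shapes_bound:
  assumes "f \<in> shapes"
  obtains m where "\<And>i. m \<le> i \<Longrightarrow> f i = 0"
  using assms finite_support_bound[of f] by (auto simp: shapes_def)

text \<open>
  If the part with index \<open>i\<close> is positive, so are the \<open>i\<close> parts before it.
\<close>
lemma shapes_of_zero_beyond:
  assumes "f \<in> shapes_of n" "n \<le> i"
  shows "f i = 0"
proof (rule ccontr)
  assume "f i \<noteq> 0"
  from assms have f: "f \<in> shapes" "shape_size f = n" by (auto simp: shapes_of_def)
  obtain m where m: "\<And>i. m \<le> i \<Longrightarrow> f i = 0" using shapes_bound[OF f(1)] by blast
  have "(\<Sum>j<Suc i. 1) \<le> sum f {..<Suc i}"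
  proof (rule sum_mono)
    fix j assume "j \<in> {..<Suc i}"
    then have "f i \<le> f j" using shapes_antimono[OF f(1), of j i] by simp
    with \<open>f i \<noteq> 0\<close> show "1 \<le> f j" by simp
  qed
  also have "\<dots> \<le> sum f {..<max m (Suc i)}" by (intro sum_mono2) auto
  also have "\<dots> = n" 
  proof -
    have "shape_size f = sum f {..<max m (Suc i)}" by (rule shape_size_eq_sum) (use m in auto)
    then show ?thesis using f(2) by simp
  qed
  finally show False using assms(2) by simp
qed

lemma le_shape_size: "f \<in> shapes \<Longrightarrow> f i \<le> shape_size f"
  by (cases "f i = 0") (auto simp: shape_size_def shapes_def intro!: member_le_sum)

lemma finite_shapes_of: "finite (shapes_of n)"
proof (rule finite_subset)
  show "shapes_of n \<subseteq> {f. \<forall>i. (i \<in> {..<n} \<longrightarrow> f i \<in> {..n}) \<and> (i \<notin> {..<n} \<longrightarrow> f i = 0)}"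
  proof
    fix f assume f: "f \<in> shapes_of n"
    have "f i \<le> n" for i using le_shape_size[of f i] f by (simp add: shapes_of_def)
    then show "f \<in> {f. \<forall>i. (i \<in> {..<n} \<longrightarrow> f i \<in> {..n}) \<and> (i \<notin> {..<n} \<longrightarrow> f i = 0)}"
      using shapes_of_zero_beyond[OF f] by (simp add: not_less)
  qed
qed (intro finite_set_of_finite_funs; simp)

lemma zero_in_shapes [simp]: "(\<lambda>_. 0) \<in> shapes" by (auto simp: shapes_def antimono_def)

lemma shape_size_zero [simp]: "shape_size (\<lambda>_. 0) = 0" by (simp add: shape_size_def)

lemma shape_size_eq_0_iff: "f \<in> shapes \<Longrightarrow> shape_size f = 0 \<longleftrightarrow> f = (\<lambda>_. 0)"
  by (auto simp: shape_size_def shapes_def)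

lemma shapes_of_0: "shapes_of 0 = {\<lambda>_. 0}"
  by (auto simp: shapes_of_def shape_size_eq_0_iff)

lemma interlaces_in_shapes: "interlaces \<mu> \<nu> \<Longrightarrow> \<nu> \<in> shapes \<Longrightarrow> \<mu> \<in> shapes"
proof (rule shapes_bound[of \<nu>], assumption)
  fix m assume *: "interlaces \<mu> \<nu>" "\<And>i. m \<le> i \<Longrightarrow> \<nu> i = 0"
  show "\<mu> \<in> shapes"
  proof (rule shapesI)
    show "\<mu> (Suc i) \<le> \<mu> i" for i using * unfolding interlaces_def by (meson le_trans)
    show "\<mu> i = 0" if "m \<le> i" for i using that * unfolding interlaces_def by (metis le_0_eq)
  qed
qed

lemma interlaces_in_shapes': "interlaces \<mu> \<nu> \<Longrightarrow> \<mu> \<in> shapes \<Longrightarrow> \<nu> \<in> shapes"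
proof (rule shapes_bound[of \<mu>], assumption)
  fix m assume *: "interlaces \<mu> \<nu>" "\<mu> \<in> shapes" "\<And>i. m \<le> i \<Longrightarrow> \<mu> i = 0"
  show "\<nu> \<in> shapes"
  proof (rule shapesI)
    show "\<nu> (Suc i) \<le> \<nu> i" for i using * unfolding interlaces_def by (meson le_trans)
    show "\<nu> i = 0" if "Suc m \<le> i" for i
    proof -
      have "i = Suc (i - 1)" "m \<le> i - 1" using that by auto
      then show ?thesis using * unfolding interlaces_def by (metis le_0_eq)
    qed
  qed
qed

lemma shape_size_mono:
  assumes "\<nu> \<in> shapes" "\<And>i. \<mu> i \<le> \<nu> i"
  shows "shape_size \<mu> \<le> shape_size \<nu>" and "shape_size \<mu> = shape_size \<nu> \<Longrightarrow> \<mu> = \<nu>"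
proof -
  obtain m where m: "\<And>i. m \<le> i \<Longrightarrow> \<nu> i = 0" using shapes_bound[OF assms(1)] by blast
  then have m': "\<And>i. m \<le> i \<Longrightarrow> \<mu> i = 0" using assms(2) by (metis le_0_eq)
  have eq: "shape_size \<mu> = sum \<mu> {..<m}" "shape_size \<nu> = sum \<nu> {..<m}"
    by (rule shape_size_eq_sum, erule m') (rule shape_size_eq_sum, erule m)
  show "shape_size \<mu> \<le> shape_size \<nu>" unfolding eq using assms(2) by (simp add: sum_mono)
  assume "shape_size \<mu> = shape_size \<nu>"
  then have "sum \<mu> {..<m} = sum \<nu> {..<m}" unfolding eq .
  then have *: "\<mu> i = \<nu> i" if "i < m" for i
    by (rule sum_mono_inv[of \<mu> "{..<m}" \<nu>]) (use that assms(2) in auto)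
  show "\<mu> = \<nu>"
  proof
    fix i show "\<mu> i = \<nu> i" using * m[of i] m'[of i] by (cases "i < m") simp_all
  qed
qed

lemma strips_in_shapes: "\<nu> \<in> shapes \<Longrightarrow> \<mu> \<in> strips c \<nu> \<Longrightarrow> \<mu> \<in> shapes"
  by (auto simp: strips_def intro: interlaces_in_shapes)

lemma finite_strips: "\<nu> \<in> shapes \<Longrightarrow> finite (strips c \<nu>)"
  by (rule finite_subset[OF _ finite_shapes_of[of "shape_size \<nu> - c"]])
     (auto simp: strips_def shapes_of_def intro: interlaces_in_shapes)

lemma interlaces_refl: "\<nu> \<in> shapes \<Longrightarrow> interlaces \<nu> \<nu>"
  by (auto simp: interlaces_def intro: shapes_antimono)

lemma strips_0: "\<nu> \<in> shapes \<Longrightarrow> strips 0 \<nu> = {\<nu>}"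
  using shape_size_mono(2)[of \<nu>] by (auto simp: strips_def interlaces_refl) (metis interlaces_def)

lemma shape_size_upd:
  assumes "\<mu> \<in> shapes" shows "shape_size (\<mu>(i := Suc (\<mu> i))) = Suc (shape_size \<mu>)"
proof -
  obtain m where m: "\<And>i. m \<le> i \<Longrightarrow> \<mu> i = 0" using shapes_bound[OF assms] by blast
  define M where "M = max m (Suc i)"
  have "shape_size (\<mu>(i := Suc (\<mu> i))) = sum (\<mu>(i := Suc (\<mu> i))) {..<M}"
    using m by (intro shape_size_eq_sum) (auto simp: M_def)
  also have "\<dots> = Suc (\<mu> i) + sum \<mu> ({..<M} - {i})"
    by (subst sum.remove[of _ i]) (auto simp: M_def)
  also have "\<dots> = Suc (sum \<mu> {..<M})"
    by (subst sum.remove[of _ i]) (auto simp: M_def)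
  also have "sum \<mu> {..<M} = shape_size \<mu>"
    using m by (intro shape_size_eq_sum[symmetric]) (auto simp: M_def)
  finally show ?thesis .
qed

lemma add_box_in_shapes: "\<nu> \<in> add_box \<mu> \<Longrightarrow> \<nu> \<in> shapes" by (simp add: add_box_def)

lemma add_box_iff_interlaces:
  assumes "\<mu> \<in> shapes" "\<nu> \<in> shapes"
  shows "\<nu> \<in> add_box \<mu> \<longleftrightarrow> interlaces \<mu> \<nu> \<and> shape_size \<nu> = Suc (shape_size \<mu>)"
proof safe
  assume "\<nu> \<in> add_box \<mu>"
  then obtain i where i: "\<nu> = \<mu>(i := Suc (\<mu> i))" by (auto simp: add_box_def)
  show "shape_size \<nu> = Suc (shape_size \<mu>)" unfolding i by (rule shape_size_upd[OF assms(1)])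
  have "\<nu> (Suc j) \<le> \<mu> j" for j
    using shapes_antimono[OF assms(2), of j "Suc j"] shapes_antimono[OF assms(1), of j "Suc j"]
    by (auto simp: i split: if_splits)
  then show "interlaces \<mu> \<nu>" by (auto simp: interlaces_def i)
next
  assume *: "interlaces \<mu> \<nu>" "shape_size \<nu> = Suc (shape_size \<mu>)"
  then obtain i where i: "\<mu> i < \<nu> i"
    by (metis interlaces_def n_not_Suc_n order_le_imp_less_or_eq ext)
  have "\<mu>(i := Suc (\<mu> i)) = \<nu>"
    using *(1) i shape_size_upd[OF assms(1)] *(2)
    by (intro shape_size_mono(2) assms) (auto simp: interlaces_def)
  then show "\<nu> \<in> add_box \<mu>" using assms by (auto simp: add_box_def)
qed

lemma strips_1: "\<nu> \<in> shapes \<Longrightarrow> strips 1 \<nu> = remove_box \<nu>"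
  using add_box_iff_interlaces by (auto simp: strips_def remove_box_def intro: interlaces_in_shapes)

lemma shape_size_add_box: "\<mu> \<in> shapes \<Longrightarrow> \<nu> \<in> add_box \<mu> \<Longrightarrow> shape_size \<nu> = Suc (shape_size \<mu>)"
  using add_box_iff_interlaces add_box_in_shapes by blast

lemma finite_add_box: "\<mu> \<in> shapes \<Longrightarrow> finite (add_box \<mu>)"
  by (rule finite_subset[OF _ finite_shapes_of[of "Suc (shape_size \<mu>)"]]) (auto simp: shapes_of_def shape_size_add_box add_box_in_shapes)

lemma finite_remove_box: "\<nu> \<in> shapes \<Longrightarrow> finite (remove_box \<nu>)"
  using finite_strips[of \<nu> 1] strips_1[of \<nu>] by simp

text \<open>
  The local rule behind the Pieri formula.  If \<open>\<rho>\<close> interlaces \<open>\<nu>\<close>, a box may be removed from row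
  \<open>i\<close> of \<open>\<rho>\<close> exactly if one may be added to row \<open>i + 1\<close> of \<open>\<nu>\<close>, and a box may always be added to row
  \<open>0\<close>.  Otherwise both changes must take place in the only row of \<open>\<rho>\<close> that is too long.
\<close>
lemma card_interlaces_exchange:
  assumes "\<rho> \<in> shapes" "\<nu> \<in> shapes"
  shows "card {\<kappa> \<in> remove_box \<rho>. interlaces \<kappa> \<nu>} + (if interlaces \<rho> \<nu> then 1 else 0) =
    card {\<tau> \<in> add_box \<nu>. interlaces \<rho> \<tau>}"
proof -
  define S where "S = {i. 0 < \<rho> i \<and> interlaces (\<rho>(i := \<rho> i - 1)) \<nu>}"
  define S' where "S' = {i. interlaces \<rho> (\<nu>(i := Suc (\<nu> i)))}"
  have "{\<kappa> \<in> remove_box \<rho>. interlaces \<kappa> \<nu>} = (\<lambda>i. \<rho>(i := \<rho> i - 1)) ` S"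
  proof (safe, goal_cases)
    case (1 \<kappa>)
    then obtain i where "\<rho> = \<kappa>(i := Suc (\<kappa> i))" by (auto simp: remove_box_def add_box_def)
    moreover from this have "\<kappa> = \<rho>(i := \<rho> i - 1)" by (auto simp: fun_eq_iff)
    moreover have "0 < \<rho> i" using calculation(1) by (metis fun_upd_same zero_less_Suc)
    ultimately show ?case using 1 unfolding S_def by (auto intro!: image_eqI[of _ _ i])
  next
    case (2 _ i)
    then have "\<rho> \<in> add_box (\<rho>(i := \<rho> i - 1))" using assms by (auto simp: add_box_def S_def fun_eq_iff)
    then show ?case using 2 interlaces_in_shapes[OF _ assms(2)] by (auto simp: remove_box_def S_def)
  qed (auto simp: S_def)
  moreover have "inj_on (\<lambda>i. \<rho>(i := \<rho> i - 1)) S"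
  proof (rule inj_onI, rule ccontr)
    fix i j assume ij: "i \<in> S" "j \<in> S" "\<rho>(i := \<rho> i - 1) = \<rho>(j := \<rho> j - 1)" "i \<noteq> j"
    have "\<rho> i - 1 = \<rho> i" using fun_cong[OF ij(3), of i] ij(4) by simp
    moreover have "0 < \<rho> i" using ij(1) by (simp add: S_def)
    ultimately show False by linarith
  qed
  ultimately have 1: "card {\<kappa> \<in> remove_box \<rho>. interlaces \<kappa> \<nu>} = card S" by (simp add: card_image)
  have "{\<tau> \<in> add_box \<nu>. interlaces \<rho> \<tau>} = (\<lambda>i. \<nu>(i := Suc (\<nu> i))) ` S'"
    using interlaces_in_shapes'[OF _ assms(1)] by (auto simp: S'_def add_box_def)
  moreover have "inj_on (\<lambda>i. \<nu>(i := Suc (\<nu> i))) S'"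
  proof (rule inj_onI, rule ccontr)
    fix i j assume ij: "\<nu>(i := Suc (\<nu> i)) = \<nu>(j := Suc (\<nu> j))" "i \<noteq> j"
    have "Suc (\<nu> i) = \<nu> i" using fun_cong[OF ij(1), of i] ij(2) by simp
    then show False by simp
  qed
  ultimately have 2: "card {\<tau> \<in> add_box \<nu>. interlaces \<rho> \<tau>} = card S'" by (simp add: card_image)
  show ?thesis
  proof (cases "interlaces \<rho> \<nu>")
    case True
    have "S = {i. \<nu> (Suc i) < \<rho> i}"
    proof (safe, goal_cases)
      case (1 i)
      then show ?case by (auto simp: S_def interlaces_def dest!: spec[of _ i])
    next
      case (2 i)
      then show ?case using True unfolding S_def interlaces_def
        by (auto simp: less_eq_Suc_le) (meson diff_le_self le_trans)
    qed
    moreover have "S' = {i. i = 0 \<or> \<nu> i < \<rho> (i - 1)}"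
    proof (safe, goal_cases)
      case (1 i)
      then show ?case by (cases i) (auto simp: S'_def interlaces_def split: if_splits dest!: spec[of _ "i - 1"])
    qed (use True in \<open>auto simp: S'_def interlaces_def intro: le_SucI\<close>)
    moreover have "i = 0 \<or> \<nu> i < \<rho> (i - 1) \<longleftrightarrow> i \<in> insert 0 (Suc ` {i. \<nu> (Suc i) < \<rho> i})" for i
      by (cases i) auto
    ultimately have "S' = insert 0 (Suc ` S)" by auto
    moreover obtain m where "\<And>i. m \<le> i \<Longrightarrow> \<rho> i = 0" using shapes_bound[OF assms(1)] by blast
    then have "i < m" if "i \<in> S" for i using that by (cases "i < m") (simp_all add: S_def)
    then have "S \<subseteq> {..<m}" by blast
    then have "finite S" by (rule finite_subset) simp
    ultimately show ?thesis using True 1 2 by (simp add: card_image)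
  next
    case False
    have "i \<in> S \<longleftrightarrow> i \<in> S'" for i
    proof
      assume i: "i \<in> S"
      then have *: "0 < \<rho> i" "\<And>j. j \<noteq> i \<Longrightarrow> \<rho> j \<le> \<nu> j \<and> \<nu> (Suc j) \<le> \<rho> j" "\<rho> i - 1 \<le> \<nu> i" "\<nu> (Suc i) \<le> \<rho> i - 1"
        by (auto simp: S_def interlaces_def split: if_splits)
      have "\<not> \<rho> i \<le> \<nu> i"
      proof
        assume "\<rho> i \<le> \<nu> i"
        then have "\<rho> j \<le> \<nu> j \<and> \<nu> (Suc j) \<le> \<rho> j" for j
          using * by (cases "j = i") (auto intro: le_trans)
        then show False using False by (simp add: interlaces_def)
      qed
      then have "\<rho> i = Suc (\<nu> i)" using * by auto
      moreover have "\<nu> (Suc j) \<le> \<rho> j" "Suc j = i \<Longrightarrow> Suc (\<nu> i) \<le> \<rho> j" for j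
        using * shapes_antimono[OF assms(1), of j "Suc j"] \<open>\<rho> i = Suc (\<nu> i)\<close> by (cases "j = i", auto)+
      ultimately show "i \<in> S'" using * by (auto simp: S'_def interlaces_def)
    next
      assume i: "i \<in> S'"
      then have *: "\<And>j. j \<noteq> i \<Longrightarrow> \<rho> j \<le> \<nu> j" "\<And>j. \<nu> (Suc j) \<le> \<rho> j" "\<rho> i \<le> Suc (\<nu> i)"
      proof -
        have 1: "\<rho> j \<le> (\<nu>(i := Suc (\<nu> i))) j" and 2: "(\<nu>(i := Suc (\<nu> i))) (Suc j) \<le> \<rho> j" for j
          using i by (auto simp: S'_def interlaces_def)
        show "\<rho> j \<le> \<nu> j" if "j \<noteq> i" for j using 1[of j] that by simp
        show "\<nu> (Suc j) \<le> \<rho> j" for j using 2[of j] by (cases "Suc j = i") simp_all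
        show "\<rho> i \<le> Suc (\<nu> i)" using 1[of i] by simp
      qed
      have "\<not> \<rho> i \<le> \<nu> i"
      proof
        assume "\<rho> i \<le> \<nu> i"
        then have "\<rho> j \<le> \<nu> j \<and> \<nu> (Suc j) \<le> \<rho> j" for j
          using * by (cases "j = i") (auto intro: le_trans)
        then show False using False by (simp add: interlaces_def)
      qed
      then have "\<rho> i = Suc (\<nu> i)" using * by auto
      then show "i \<in> S" using * shapes_antimono[OF assms(2), of i "Suc i"] by (auto simp: S_def interlaces_def)
    qed
    then have "S = S'" by blast
    then show ?thesis using False 1 2 by simp
  qed
qed

text \<open>
  The relation \<open>D U - U D = 1\<close> in the Young lattice, read off at a pair of shapes: for shapes that
  differ by one box, interlacing means that one covers the other.
\<close>
lemma card_add_box_remove_box_exchange: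
  assumes "\<rho> \<in> shapes" "\<nu> \<in> shapes" "shape_size \<rho> = shape_size \<nu>"
  shows "card (remove_box \<rho> \<inter> remove_box \<nu>) + (if \<rho> = \<nu> then 1 else 0) = card (add_box \<rho> \<inter> add_box \<nu>)"
proof -
  have "\<kappa> \<in> remove_box \<nu> \<longleftrightarrow> interlaces \<kappa> \<nu>" if "\<kappa> \<in> remove_box \<rho>" for \<kappa>
  proof -
    have "\<kappa> \<in> shapes" "shape_size \<nu> = Suc (shape_size \<kappa>)"
      using that assms shape_size_add_box[of \<kappa> \<rho>] by (auto simp: remove_box_def)
    then show ?thesis using add_box_iff_interlaces[OF _ assms(2)] by (simp add: remove_box_def)
  qed
  then have "{\<kappa> \<in> remove_box \<rho>. interlaces \<kappa> \<nu>} = remove_box \<rho> \<inter> remove_box \<nu>" by blast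
  moreover have "\<tau> \<in> add_box \<rho> \<longleftrightarrow> interlaces \<rho> \<tau>" if "\<tau> \<in> add_box \<nu>" for \<tau>
    using add_box_iff_interlaces[OF assms(1) add_box_in_shapes[OF that]] shape_size_add_box[OF assms(2) that] assms(3) by simp
  then have "{\<tau> \<in> add_box \<nu>. interlaces \<rho> \<tau>} = add_box \<rho> \<inter> add_box \<nu>" by blast
  moreover have "interlaces \<rho> \<nu> \<longleftrightarrow> \<rho> = \<nu>"
    using shape_size_mono(2)[OF assms(2), of \<rho>] assms(3) interlaces_refl[OF assms(2)]
    unfolding interlaces_def by blast
  ultimately show ?thesis using card_interlaces_exchange[OF assms(1,2)] by simp
qed

lemma kostka_Cons_0: "\<nu> \<in> shapes \<Longrightarrow> kostka (0 # cs) \<nu> = kostka cs \<nu>"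
  by (simp add: strips_0)

lemma kostka_Cons_1: "\<nu> \<in> shapes \<Longrightarrow> kostka (1 # cs) \<nu> = (\<Sum>\<mu> \<in> remove_box \<nu>. kostka cs \<mu>)"
  using strips_1 by simp

text \<open>
  The Pieri rule for \<open>p\<^sub>1\<close>, in terms of coefficients: multiplying by \<open>p\<^sub>1\<close> and taking a coefficient
  lowers one of the exponents.  The induction removes one strip; the strip and the new box are
  interchanged by \<open>card_interlaces_exchange\<close>.
\<close>
lemma sum_add_box_kostka:
  assumes "\<nu> \<in> shapes"
  shows "(\<Sum>\<tau> \<in> add_box \<nu>. kostka cs \<tau>) =
    (\<Sum>i | i < length cs \<and> 0 < cs ! i. kostka (cs[i := cs ! i - 1]) \<nu>)"
  using assms
proof (induction cs arbitrary: \<nu>)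
  case Nil
  have "\<nu>(i := Suc (\<nu> i)) \<noteq> (\<lambda>_. 0)" for i by (metis fun_upd_same nat.distinct(1))
  then show ?case by (auto simp: add_box_def intro!: sum.neutral)
next
  case (Cons c cs)
  note \<nu> = Cons.prems
  \<comment> \<open>The shapes left after both the new box and a strip of size \<open>c\<close> have been dealt with; the case
    distinction avoids truncated subtraction.\<close>
  define X where "X = (if c \<le> Suc (shape_size \<nu>) then shapes_of (Suc (shape_size \<nu>) - c) else {})"
  have finX: "finite X" by (simp add: X_def finite_shapes_of)
  have X_iff: "\<rho> \<in> X \<longleftrightarrow> \<rho> \<in> shapes \<and> Suc (shape_size \<nu>) = shape_size \<rho> + c" for \<rho>
    by (auto simp: X_def shapes_of_def)
  have "(\<Sum>\<tau> \<in> add_box \<nu>. kostka (c # cs) \<tau>) = (\<Sum>\<tau> \<in> add_box \<nu>. \<Sum>\<rho>\<in>X. if interlaces \<rho> \<tau> then kostka cs \<rho> else 0)"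
  proof (rule sum.cong, simp)
    fix \<tau> assume \<tau>: "\<tau> \<in> add_box \<nu>"
    have "strips c \<tau> = {\<rho>\<in>X. interlaces \<rho> \<tau>}"
      using \<tau> add_box_in_shapes \<nu> by (auto simp: X_iff strips_def shape_size_add_box intro: interlaces_in_shapes)
    then show "kostka (c # cs) \<tau> = (\<Sum>\<rho>\<in>X. if interlaces \<rho> \<tau> then kostka cs \<rho> else 0)"
      using finX by (simp add: sum.inter_filter)
  qed
  also have "\<dots> = (\<Sum>\<rho>\<in>X. card {\<tau> \<in> add_box \<nu>. interlaces \<rho> \<tau>} * kostka cs \<rho>)"
    by (subst sum.swap, intro sum.cong) (use finite_add_box[OF \<nu>] in \<open>auto simp: sum.inter_filter[symmetric]\<close>)
  also have "\<dots> = (\<Sum>\<rho>\<in>X. card {\<kappa> \<in> remove_box \<rho>. interlaces \<kappa> \<nu>} * kostka cs \<rho>) +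
      (\<Sum>\<rho>\<in>X. if interlaces \<rho> \<nu> then kostka cs \<rho> else 0)"
    unfolding sum.distrib[symmetric]
    by (intro sum.cong) (auto simp: X_iff card_interlaces_exchange[OF _ \<nu>, symmetric] algebra_simps)
  also have "(\<Sum>\<rho>\<in>X. if interlaces \<rho> \<nu> then kostka cs \<rho> else 0) =
      (if 0 < c then kostka ((c - 1) # cs) \<nu> else 0)"
  proof (cases "0 < c")
    case True
    then have "strips (c - 1) \<nu> = {\<rho>\<in>X. interlaces \<rho> \<nu>}"
      using \<nu> by (auto simp: X_iff strips_def intro: interlaces_in_shapes)
    then show ?thesis using True finX by (simp add: sum.inter_filter)
  next
    case False
    have "\<not> interlaces \<rho> \<nu>" if "\<rho> \<in> X" for \<rho>
      using shape_size_mono(1)[OF \<nu>, of \<rho>] that False by (auto simp: X_iff interlaces_def)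
    then show ?thesis using False by simp
  qed
  also have strip_add_box: "(\<Sum>\<rho>\<in>X. card {\<kappa> \<in> remove_box \<rho>. interlaces \<kappa> \<nu>} * kostka cs \<rho>) =
      (\<Sum>\<mu> \<in> strips c \<nu>. \<Sum>\<rho> \<in> add_box \<mu>. kostka cs \<rho>)"
  proof -
    have "(\<Sum>\<mu> \<in> strips c \<nu>. \<Sum>\<rho> \<in> add_box \<mu>. kostka cs \<rho>) =
        (\<Sum>\<mu> \<in> strips c \<nu>. \<Sum>\<rho> \<in> X. if \<rho> \<in> add_box \<mu> then kostka cs \<rho> else 0)"
    proof (rule sum.cong[OF refl])
      fix \<mu> assume \<mu>: "\<mu> \<in> strips c \<nu>"
      then have "\<rho> \<in> X" if "\<rho> \<in> add_box \<mu>" for \<rho>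
        using shape_size_add_box[OF strips_in_shapes[OF \<nu> \<mu>] that] add_box_in_shapes[OF that] by (simp add: X_iff strips_def)
      then have "add_box \<mu> = {\<rho> \<in> X. \<rho> \<in> add_box \<mu>}" by blast
      then show "(\<Sum>\<rho> \<in> add_box \<mu>. kostka cs \<rho>) = (\<Sum>\<rho> \<in> X. if \<rho> \<in> add_box \<mu> then kostka cs \<rho> else 0)"
        using finX by (simp add: sum.inter_filter[symmetric])
    qed
    also have "\<dots> = (\<Sum>\<rho> \<in> X. card {\<mu> \<in> strips c \<nu>. \<rho> \<in> add_box \<mu>} * kostka cs \<rho>)"
      by (subst sum.swap, intro sum.cong) (use finite_strips[OF \<nu>] in \<open>auto simp: sum.inter_filter[symmetric]\<close>)
    also have "\<dots> = (\<Sum>\<rho>\<in>X. card {\<kappa> \<in> remove_box \<rho>. interlaces \<kappa> \<nu>} * kostka cs \<rho>)"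
    proof (rule sum.cong[OF refl])
      fix \<rho> assume "\<rho> \<in> X"
      then have "{\<mu> \<in> strips c \<nu>. \<rho> \<in> add_box \<mu>} = {\<kappa> \<in> remove_box \<rho>. interlaces \<kappa> \<nu>}"
        using shape_size_add_box by (auto simp: X_iff remove_box_def strips_def intro: interlaces_in_shapes[OF _ \<nu>])
      then show "card {\<mu> \<in> strips c \<nu>. \<rho> \<in> add_box \<mu>} * kostka cs \<rho> =
        card {\<kappa> \<in> remove_box \<rho>. interlaces \<kappa> \<nu>} * kostka cs \<rho>" by simp
    qed
    finally show ?thesis by simp
  qed
  also have "(\<Sum>\<mu> \<in> strips c \<nu>. \<Sum>\<rho> \<in> add_box \<mu>. kostka cs \<rho>) =
      (\<Sum>i | i < length cs \<and> 0 < cs ! i. kostka (c # cs[i := cs ! i - 1]) \<nu>)"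
    using strips_in_shapes[OF \<nu>] by (simp add: Cons.IH, subst sum.swap, simp)
  also have "\<dots> + (if 0 < c then kostka ((c - 1) # cs) \<nu> else 0) =
      (\<Sum>i | i < length (c # cs) \<and> 0 < (c # cs) ! i. kostka ((c # cs)[i := (c # cs) ! i - 1]) \<nu>)"
  proof -
    have "i < length (c # cs) \<and> 0 < (c # cs) ! i \<longleftrightarrow>
        i \<in> (if 0 < c then {0} else {}) \<union> Suc ` {i. i < length cs \<and> 0 < cs ! i}" for i
      by (cases i) auto
    then have "{i. i < length (c # cs) \<and> 0 < (c # cs) ! i} =
        (if 0 < c then {0} else {}) \<union> Suc ` {i. i < length cs \<and> 0 < cs ! i}"
      by blast
    then show ?thesis
      by (simp only:, subst sum.union_disjoint) (auto simp: sum.reindex)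
  qed
  finally show ?case .
qed

text \<open>
  The largest horizontal strip consists of the last box of each column; removing it deletes the
  first row.
\<close>
lemma strips_first_row:
  assumes "\<nu> \<in> shapes"
  shows "strips (\<nu> 0) \<nu> = {\<lambda>i. \<nu> (Suc i)}" and "\<nu> 0 < c \<Longrightarrow> strips c \<nu> = {}"
proof -
  obtain m where m: "\<And>i. m \<le> i \<Longrightarrow> \<nu> i = 0" using shapes_bound[OF assms] by blast
  let ?t = "\<lambda>i. \<nu> (Suc i)"
  have size: "shape_size \<nu> = shape_size ?t + \<nu> 0"

  proof -
    have "shape_size \<nu> = sum \<nu> {..<Suc m}" "shape_size ?t = sum ?t {..<m}"
      by (rule shape_size_eq_sum, simp add: m, rule shape_size_eq_sum, simp add: m)
    then show ?thesis by (simp add: sum.lessThan_Suc_shift del: sum.lessThan_Suc)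
  qed
  have t: "interlaces ?t \<nu>" using shapes_antimono[OF assms] by (auto simp: interlaces_def)
  have le: "shape_size ?t \<le> shape_size \<mu>" "shape_size ?t = shape_size \<mu> \<Longrightarrow> ?t = \<mu>" if "interlaces \<mu> \<nu>" for \<mu>
    using shape_size_mono[of \<mu> ?t] interlaces_in_shapes[OF that assms] that by (auto simp: interlaces_def)
  show "strips (\<nu> 0) \<nu> = {?t}" using t le size by (auto simp: strips_def)
  show "\<nu> 0 < c \<Longrightarrow> strips c \<nu> = {}" using le size by (fastforce simp: strips_def)
qed

text \<open>
  Among the shapes with nonzero coefficient look at those with the longest first row, of length
  \<open>k\<close>.  Removing a strip of size \<open>k\<close> kills the shapes with a shorter first row and deletes
  the first row of the others, which leaves a relation between smaller shapes.
\<close>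
lemma kostka_linear_independent:
  fixes c :: "(nat \<Rightarrow> nat) \<Rightarrow> rat"
  assumes "\<And>cs. (\<Sum>\<nu> \<in> shapes_of n. c \<nu> * of_nat (kostka cs \<nu>)) = 0" "\<nu> \<in> shapes_of n"
  shows "c \<nu> = 0"
  using assms
proof (induction n arbitrary: c \<nu> rule: less_induct)
  case (less n)
  show ?case
  proof (cases "n = 0")
    case True
    then show ?thesis using less.prems(1)[of "[]"] less.prems(2) by (simp add: shapes_of_0)
  next
    case False
    show ?thesis
    proof (rule ccontr)
      assume "c \<nu> \<noteq> 0"
      define S where "S = {\<nu> \<in> shapes_of n. c \<nu> \<noteq> 0}"
      define k where "k = Max ((\<lambda>\<nu>. \<nu> 0) ` S)"
      have finS: "finite S" by (simp add: S_def finite_shapes_of)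
      have "\<nu> \<in> S" using \<open>c \<nu> \<noteq> 0\<close> less.prems by (simp add: S_def)
      then have "k \<in> (\<lambda>\<nu>. \<nu> 0) ` S" unfolding k_def using finS by (intro Max_in) auto
      then obtain \<xi> where \<xi>: "\<xi> \<in> shapes_of n" "c \<xi> \<noteq> 0" "\<xi> 0 = k" by (auto simp: S_def)
      have k_max: "\<tau> 0 \<le> k" if "\<tau> \<in> shapes_of n" "c \<tau> \<noteq> 0" for \<tau>
        unfolding k_def using that finS by (intro Max_ge) (auto simp: S_def)
      have "0 < k"
      proof (rule ccontr)
        assume "\<not> 0 < k"
        then have "\<xi> i = 0" for i using shapes_antimono[of \<xi> 0 i] \<xi> by (auto simp: shapes_of_def)
        then have "\<xi> = (\<lambda>_. 0)" by auto
        then show False using \<xi> False by (auto simp: shapes_of_def)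
      qed
      let ?t = "\<lambda>\<nu> i. \<nu> (Suc i)"
      \<comment> \<open>The coefficients of the shapes with first row \<open>k\<close>, indexed by the remaining rows.\<close>
      define c' where "c' \<mu> = (if \<mu> 0 \<le> k then c (case_nat k \<mu>) else 0)" for \<mu>
      have size: "shape_size \<tau> = shape_size (?t \<tau>) + \<tau> 0" if "\<tau> \<in> shapes" for \<tau>
        using strips_first_row(1)[OF that] by (auto simp: strips_def)
      have t_par: "?t \<tau> \<in> shapes" if "\<tau> \<in> shapes" for \<tau>
        using strips_first_row(1)[OF that] strips_in_shapes[OF that] by blast
      have case_par: "case_nat k \<mu> \<in> shapes" if \<mu>: "\<mu> \<in> shapes" "\<mu> 0 \<le> k" for \<mu>
      proof -
        obtain m where m: "\<And>i. m \<le> i \<Longrightarrow> \<mu> i = 0" using shapes_bound[OF \<mu>(1)] by blast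
        show ?thesis
          by (rule shapesI[of _ "Suc m"]) (use \<mu> m shapes_antimono[OF \<mu>(1)] in \<open>auto split: nat.splits\<close>)
      qed
      have c'_0: "c' \<mu> = 0" if \<mu>: "\<mu> \<in> shapes_of (n - k)" for \<mu>
      proof (rule less.IH[of "n - k" c' \<mu>])
        show "n - k < n" using False \<open>0 < k\<close> by simp
        show "\<mu> \<in> shapes_of (n - k)" by (rule \<mu>)
        fix cs
        have "0 = (\<Sum>\<nu> \<in> shapes_of n. c \<nu> * of_nat (kostka (k # cs) \<nu>))"
          using less.prems(1)[of "k # cs"] by simp
        also have "\<dots> = (\<Sum>\<nu> \<in> {\<nu> \<in> shapes_of n. \<nu> 0 = k}. c \<nu> * of_nat (kostka cs (?t \<nu>)))"
        proof (rule sum.mono_neutral_cong_right)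
          show "\<forall>\<nu> \<in> shapes_of n - {\<nu> \<in> shapes_of n. \<nu> 0 = k}. c \<nu> * of_nat (kostka (k # cs) \<nu>) = 0"
          proof
            fix \<tau> assume \<tau>: "\<tau> \<in> shapes_of n - {\<nu> \<in> shapes_of n. \<nu> 0 = k}"
            have "kostka (k # cs) \<tau> = 0" if "c \<tau> \<noteq> 0"
              using that \<tau> k_max[of \<tau>] strips_first_row(2)[of \<tau> k] by (auto simp: shapes_of_def)
            then show "c \<tau> * of_nat (kostka (k # cs) \<tau>) = 0" by (cases "c \<tau> = 0") auto
          qed
          show "c \<nu> * of_nat (kostka (k # cs) \<nu>) = c \<nu> * of_nat (kostka cs (?t \<nu>))"
            if "\<nu> \<in> {\<nu> \<in> shapes_of n. \<nu> 0 = k}" for \<nu>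
            using that strips_first_row(1)[of \<nu>] by (auto simp: shapes_of_def)
        qed (auto simp: finite_shapes_of)
        also have "\<dots> = (\<Sum>\<mu> \<in> {\<mu> \<in> shapes_of (n - k). \<mu> 0 \<le> k}. c (case_nat k \<mu>) * of_nat (kostka cs \<mu>))"
        proof (rule sum.reindex_bij_witness[of _ "case_nat k" ?t], goal_cases)
          case (1 \<tau>) then show ?case by (auto split: nat.splits)
        next
          case (2 \<tau>)
          then show ?case using size[of \<tau>] t_par[of \<tau>] shapes_antimono[of \<tau> 0 1] by (auto simp: shapes_of_def)
        next
          case (4 \<mu>)
          then show ?case using case_par[of \<mu>] size[of "case_nat k \<mu>"] le_shape_size[of \<xi> 0] \<xi>
            by (auto simp: shapes_of_def)
        next
          case (5 \<tau>)
          then have "case_nat k (?t \<tau>) = \<tau>" by (auto simp: fun_eq_iff split: nat.splits)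
          then show ?case by simp
        qed auto
        also have "\<dots> = (\<Sum>\<mu> \<in> shapes_of (n - k). c' \<mu> * of_nat (kostka cs \<mu>))"
          by (rule sum.mono_neutral_cong_left) (auto simp: finite_shapes_of c'_def)
        finally show "(\<Sum>\<mu> \<in> shapes_of (n - k). c' \<mu> * of_nat (kostka cs \<mu>)) = 0" by simp
      qed
      have "?t \<xi> \<in> shapes_of (n - k)" using \<xi> size[of \<xi>] t_par[of \<xi>] by (auto simp: shapes_of_def)
      moreover have "c' (?t \<xi>) = c \<xi>"
      proof -
        have "case_nat k (?t \<xi>) = \<xi>" using \<xi> by (auto simp: fun_eq_iff split: nat.splits)
        then show ?thesis using shapes_antimono[of \<xi> 0 1] \<xi> by (auto simp: c'_def shapes_of_def)
      qed
      ultimately show False using c'_0 \<xi>(2) by simp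
    qed
  qed
qed

section \<open>Symmetry of Kostka numbers and tableaux\<close>

text \<open>
  The shapes \<open>\<mu>\<close> with \<open>\<rho>\<close>, \<open>\<mu>\<close>, \<open>\<nu>\<close> interlacing form a product of intervals; this is the reflection
  of each interval about its midpoint.
\<close>
definition toggle :: "(nat \<Rightarrow> nat) \<Rightarrow> (nat \<Rightarrow> nat) \<Rightarrow> (nat \<Rightarrow> nat) \<Rightarrow> nat \<Rightarrow> nat" where
  "toggle \<nu> \<rho> \<mu> i =
    max (\<rho> i) (\<nu> (Suc i)) + (case i of 0 \<Rightarrow> \<nu> 0 | Suc j \<Rightarrow> min (\<nu> i) (\<rho> j)) - \<mu> i"

lemma toggle:
  assumes "interlaces \<rho> \<mu>" "interlaces \<mu> \<nu>" "\<nu> \<in> shapes"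
  shows "interlaces \<rho> (toggle \<nu> \<rho> \<mu>)" "interlaces (toggle \<nu> \<rho> \<mu>) \<nu>"
    "toggle \<nu> \<rho> (toggle \<nu> \<rho> \<mu>) = \<mu>"
    "shape_size (toggle \<nu> \<rho> \<mu>) + shape_size \<mu> = shape_size \<nu> + shape_size \<rho>"
proof -
  \<comment> \<open>\<open>\<mu>\<close> interlaces on both sides exactly if \<open>lo i \<le> \<mu> i \<le> hi i\<close> for all \<open>i\<close>.\<close>
  define lo where "lo i = max (\<rho> i) (\<nu> (Suc i))" for i
  define hi where "hi i = (case i of 0 \<Rightarrow> \<nu> 0 | Suc j \<Rightarrow> min (\<nu> i) (\<rho> j))" for i
  define M where "M = toggle \<nu> \<rho> \<mu>"
  have M: "M i = lo i + hi i - \<mu> i" for i by (simp add: M_def toggle_def lo_def hi_def)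
  have lo: "lo i \<le> \<mu> i" for i using assms(1,2) by (simp add: lo_def interlaces_def)
  have hi: "\<mu> i \<le> hi i" for i using assms(1,2) by (cases i) (simp_all add: hi_def interlaces_def)
  have lo_M: "lo i \<le> M i" and M_hi: "M i \<le> hi i" for i
    using lo[of i] hi[of i] by (simp_all add: M)
  have hi_Suc: "hi (Suc i) \<le> \<rho> i" and hi_le: "hi i \<le> \<nu> i" for i
    by (simp_all add: hi_def split: nat.split)
  show "interlaces \<rho> (toggle \<nu> \<rho> \<mu>)"
    unfolding interlaces_def M_def[symmetric]
  proof (intro allI conjI)
    fix i
    show "\<rho> i \<le> M i" using lo_M[of i] by (simp add: lo_def)
    show "M (Suc i) \<le> \<rho> i" using M_hi[of "Suc i"] hi_Suc[of i] by simp
  qed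
  show "interlaces (toggle \<nu> \<rho> \<mu>) \<nu>"
    unfolding interlaces_def M_def[symmetric]
  proof (intro allI conjI)
    fix i
    show "M i \<le> \<nu> i" using M_hi[of i] hi_le[of i] by simp
    show "\<nu> (Suc i) \<le> M i" using lo_M[of i] by (simp add: lo_def)
  qed
  show "toggle \<nu> \<rho> (toggle \<nu> \<rho> \<mu>) = \<mu>"
  proof
    fix i
    have "toggle \<nu> \<rho> M i = lo i + hi i - M i" by (simp add: toggle_def lo_def hi_def)
    then show "toggle \<nu> \<rho> (toggle \<nu> \<rho> \<mu>) i = \<mu> i"
      using lo[of i] hi[of i] by (simp add: M M_def[symmetric])
  qed
  obtain m where m: "\<And>i. m \<le> i \<Longrightarrow> \<nu> i = 0" using shapes_bound[OF assms(3)] by blast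
  have \<mu>0: "\<mu> i = 0" if "m \<le> i" for i
    using assms(2) m[OF that] unfolding interlaces_def by (metis le_0_eq)
  have \<rho>0: "\<rho> i = 0" if "m \<le> i" for i
    using assms(1) \<mu>0[OF that] unfolding interlaces_def by (metis le_0_eq)
  have M0: "M i = 0" if "m \<le> i" for i
    using M_hi[of i] hi_le[of i] m[OF that] by simp
  have "shape_size M + shape_size \<mu> = sum M {..<Suc m} + sum \<mu> {..<Suc m}"
    by (simp add: shape_size_eq_sum[of "Suc m"] M0 \<mu>0)
  also have "\<dots> = (\<Sum>i<Suc m. lo i + hi i)"
    unfolding sum.distrib[symmetric] using trans_le_add2[OF hi] by (simp add: M)
  also have "\<dots> = sum lo {..<Suc m} + (hi 0 + (\<Sum>i<m. hi (Suc i)))"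
    unfolding sum.distrib sum.lessThan_Suc_shift[of hi] by simp
  also have "sum lo {..<Suc m} = sum lo {..<m}" using m \<rho>0 by (simp add: lo_def)
  also have "\<dots> + (hi 0 + (\<Sum>i<m. hi (Suc i))) = hi 0 + (\<Sum>i<m. lo i + hi (Suc i))"
    by (simp add: sum.distrib)
  \<comment> \<open>The maximum in \<open>lo i\<close> and the minimum in \<open>hi (Suc i)\<close> are of the same two numbers.\<close>
  also have "(\<Sum>i<m. lo i + hi (Suc i)) = (\<Sum>i<m. \<nu> (Suc i) + \<rho> i)"
    by (intro sum.cong) (auto simp: lo_def hi_def)
  also have "hi 0 + \<dots> = sum \<nu> {..<Suc m} + sum \<rho> {..<m}"
    unfolding sum.lessThan_Suc_shift[of \<nu>] by (simp add: sum.distrib hi_def)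
  also have "\<dots> = shape_size \<nu> + shape_size \<rho>"
    by (simp add: shape_size_eq_sum[of "Suc m" \<nu>] shape_size_eq_sum[of m \<rho>] m \<rho>0)
  finally show "shape_size (toggle \<nu> \<rho> \<mu>) + shape_size \<mu> = shape_size \<nu> + shape_size \<rho>" by (simp add: M_def)
qed

text \<open>
  The reflection \<open>toggle\<close> of the intermediate shape interchanges the sizes of two successive strips.
\<close>
lemma kostka_swap:
  assumes "\<nu> \<in> shapes"
  shows "kostka (c # d # cs) \<nu> = kostka (d # c # cs) \<nu>"
proof -
  have *: "kostka (c # d # cs) \<nu> =
      (\<Sum>(\<mu>, \<rho>) \<in> Sigma (strips c \<nu>) (strips d). kostka cs \<rho>)" for c d
    using finite_strips[OF assms] finite_strips[OF strips_in_shapes[OF assms]]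
    by (simp add: sum.Sigma)
  have closed: "(toggle \<nu> \<rho> \<mu>, \<rho>) \<in> Sigma (strips d \<nu>) (strips c)"
    if "\<mu> \<in> strips c \<nu>" "\<rho> \<in> strips d \<mu>" for \<mu> \<rho> c d
    using that toggle[of \<rho> \<mu> \<nu>] assms by (auto simp: strips_def)
  have inv: "toggle \<nu> \<rho> (toggle \<nu> \<rho> \<mu>) = \<mu>"
    if "\<mu> \<in> strips c \<nu>" "\<rho> \<in> strips d \<mu>" for \<mu> \<rho> c d
    using that toggle(3)[of \<rho> \<mu> \<nu>] assms by (auto simp: strips_def)
  show ?thesis
    unfolding *
    by (rule sum.reindex_bij_witness[of _ "\<lambda>(\<mu>, \<rho>). (toggle \<nu> \<rho> \<mu>, \<rho>)" "\<lambda>(\<mu>, \<rho>). (toggle \<nu> \<rho> \<mu>, \<rho>)"])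
      (use closed inv in \<open>simp_all add: split_beta mem_Times_iff Sigma_def\<close>, auto)
qed

lemma kostka_Cons_cong:
  assumes "\<nu> \<in> shapes" "\<And>\<mu>. \<mu> \<in> shapes \<Longrightarrow> kostka cs \<mu> = kostka ds \<mu>"
  shows "kostka (c # cs) \<nu> = kostka (c # ds) \<nu>"
  using assms strips_in_shapes[OF assms(1)] by (auto intro!: sum.cong)

lemma kostka_move:
  "\<nu> \<in> shapes \<Longrightarrow> kostka (xs @ c # ys) \<nu> = kostka (c # xs @ ys) \<nu>"
proof (induction xs arbitrary: \<nu>)
  case (Cons x xs)
  have "kostka (x # xs @ c # ys) \<nu> = kostka (x # c # xs @ ys) \<nu>"
    by (intro kostka_Cons_cong Cons)
  then show ?case using kostka_swap[OF Cons.prems] by simp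
qed simp

lemma kostka_mset_cong:
  "mset cs = mset ds \<Longrightarrow> \<nu> \<in> shapes \<Longrightarrow> kostka cs \<nu> = kostka ds \<nu>"
proof (induction cs arbitrary: ds \<nu>)
  case (Cons c cs)
  then have "c \<in> set ds" by (metis list.set_intros(1) set_mset_mset)
  then obtain xs ys where ds: "ds = xs @ c # ys" by (meson split_list)
  then have "mset cs = mset (xs @ ys)" using Cons.prems by simp
  then have "kostka (c # cs) \<nu> = kostka (c # xs @ ys) \<nu>"
    by (intro kostka_Cons_cong Cons)
  then show ?case using kostka_move[OF Cons.prems(2)] ds by simp
qed simp

lemma kostka_filter:
  "\<nu> \<in> shapes \<Longrightarrow> kostka (filter (\<lambda>c. c \<noteq> 0) cs) \<nu> = kostka cs \<nu>"
proof (induction cs arbitrary: \<nu>)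
  case (Cons c cs)
  show ?case
  proof (cases "c = 0")
    case True
    then show ?thesis using Cons kostka_Cons_0[OF Cons.prems] by simp
  next
    case False
    then show ?thesis using kostka_Cons_cong[OF Cons.prems Cons.IH] by simp
  qed
qed simp

definition kostka_number :: "nat multiset \<Rightarrow> (nat \<Rightarrow> nat) \<Rightarrow> nat" where
  "kostka_number e \<nu> = kostka (sorted_list_of_multiset e) \<nu>"

lemma kostka_number_mset:
  "\<nu> \<in> shapes \<Longrightarrow> kostka_number (mset cs) \<nu> = kostka cs \<nu>"
  unfolding kostka_number_def by (rule kostka_mset_cong) simp_all

text \<open>
  The nonzero exponents of a monomial, forgetting which variable carries which.
\<close>
definition exponents :: "nat multiset \<Rightarrow> nat multiset" where
  "exponents A = image_mset (count A) (mset_set (set_mset A))"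

lemma mset_counts:
  assumes "set_mset A \<subseteq> {..<N}"
  shows "mset (filter (\<lambda>c. c \<noteq> 0) (map (count A) [0..<N])) = exponents A"
proof -
  have "mset (filter (\<lambda>c. c \<noteq> 0) (map (count A) [0..<N])) =
      image_mset (count A) (mset (filter (\<lambda>i. count A i \<noteq> 0) [0..<N]))"
    by (simp add: filter_map o_def)
  also have "mset (filter (\<lambda>i. count A i \<noteq> 0) [0..<N]) = mset_set {i. i < N \<and> count A i \<noteq> 0}"
    by (subst mset_set_set[symmetric]) (auto intro: arg_cong[where f = mset_set])
  also have "{i. i < N \<and> count A i \<noteq> 0} = set_mset A"
    using assms by (auto simp: count_eq_zero_iff)
  finally show ?thesis by (simp add: exponents_def)
qed

definition shape_fun :: "nat list \<Rightarrow> nat \<Rightarrow> nat" where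
  "shape_fun \<nu> i = (if i < length \<nu> then \<nu> ! i else 0)"

lemma shape_fun_in_shapes:
  assumes "sorted_wrt (\<ge>) \<nu>" shows "shape_fun \<nu> \<in> shapes"
  by (rule shapesI[of _ "length \<nu>"]) (use assms in \<open>auto simp: shape_fun_def sorted_wrt_iff_nth_less\<close>)

lemma shape_size_shape_fun: "shape_size (shape_fun \<nu>) = sum_list \<nu>"
  by (subst shape_size_eq_sum[of "length \<nu>"])
     (auto simp: shape_fun_def sum_list_sum_nth atLeast0LessThan)

lemma bij_betw_shape_fun: "bij_betw shape_fun (partitions n) (shapes_of n)"
proof (rule bij_betw_imageI)
  show "inj_on shape_fun (partitions n)"
  proof (rule inj_onI)
    fix \<mu> \<nu> assume *: "\<mu> \<in> partitions n" "\<nu> \<in> partitions n" "shape_fun \<mu> = shape_fun \<nu>"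
    have nz: "shape_fun \<kappa> i = 0 \<longleftrightarrow> length \<kappa> \<le> i" if "\<kappa> \<in> partitions n" for \<kappa> i
    proof (cases "i < length \<kappa>")
      case True
      then have "\<kappa> ! i \<noteq> 0" using that nth_mem[OF True] unfolding partitions_def by (metis (mono_tags, lifting) mem_Collect_eq)
      then show ?thesis using True by (simp add: shape_fun_def)
    qed (simp add: shape_fun_def)
    have "length \<mu> \<le> i \<longleftrightarrow> length \<nu> \<le> i" for i
      using nz[OF *(1), of i] nz[OF *(2), of i] *(3) by simp
    then have len: "length \<mu> = length \<nu>" by (meson le_antisym le_refl)
    show "\<mu> = \<nu>"
    proof (rule nth_equalityI[OF len])
      fix i assume "i < length \<mu>"
      then show "\<mu> ! i = \<nu> ! i" using fun_cong[OF *(3), of i] len by (simp add: shape_fun_def)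
    qed
  qed
  show "shape_fun ` partitions n = shapes_of n"
  proof (intro equalityI subsetI)
    fix f assume f: "f \<in> shapes_of n"
    then have "f \<in> shapes" by (simp add: shapes_of_def)
    define m where "m = (LEAST i. f i = 0)"
    have "f n = 0" using shapes_of_zero_beyond[OF f] by simp
    then have "f m = 0" unfolding m_def by (rule LeastI)
    then have ge: "f i = 0" if "m \<le> i" for i using shapes_antimono[OF \<open>f \<in> shapes\<close> that] by simp
    have lt: "f i \<noteq> 0" if "i < m" for i using not_less_Least[of i "\<lambda>i. f i = 0"] that by (simp add: m_def)
    have eq: "shape_fun (map f [0..<m]) = f" using ge by (auto simp: shape_fun_def fun_eq_iff)
    have "sorted_wrt (\<ge>) (map f [0..<m])"
      by (auto simp: sorted_wrt_iff_nth_less intro: shapes_antimono[OF \<open>f \<in> shapes\<close>])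
    moreover have "sum_list (map f [0..<m]) = n"
      using shape_size_shape_fun[of "map f [0..<m]"] f by (simp add: eq shapes_of_def)
    moreover have "0 \<notin> set (map f [0..<m])" using lt by (auto simp del: neq0_conv)
    ultimately have "map f [0..<m] \<in> partitions n" by (simp add: partitions_def)
    then show "f \<in> shape_fun ` partitions n" using eq by (metis imageI)
  qed (auto simp: shapes_of_def partitions_def shape_size_shape_fun shape_fun_in_shapes)
qed

text \<open>
  The largest letter fills the end of each row of a tableau.
\<close>
lemma sorted_row_split:
  fixes r :: "nat list"
  assumes "sorted r" "set r \<subseteq> {..<Suc N}"
  shows "r = filter (\<lambda>x. x < N) r @ replicate (length r - length (filter (\<lambda>x. x < N) r)) N"
  using assms
proof (induction r)
  case (Cons x r)
  show ?case
  proof (cases "x < N")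
    case True then show ?thesis using Cons by simp
  next
    case False
    then have "\<forall>y\<in>set (x # r). y = N" using Cons.prems by fastforce
    then have "x # r = replicate (length (x # r)) N" by (simp only: replicate_eqI)
    moreover have "filter (\<lambda>x. x < N) (x # r) = []" using \<open>\<forall>y\<in>set (x # r). y = N\<close> by (auto simp: filter_empty_conv)
    ultimately show ?thesis by simp
  qed
qed simp

definition tableaux_of_content :: "nat \<Rightarrow> nat list \<Rightarrow> nat multiset \<Rightarrow> nat list list set" where
  "tableaux_of_content N \<nu> A = {T \<in> semistandard_tableaux N \<nu>. mset (concat T) = A}"

text \<open>
  Lists of a fixed length, so that rows which become empty are kept; this is why tableaux whose
  shape has trailing zeros appear below.
\<close>
definition substrips :: "nat \<Rightarrow> nat list \<Rightarrow> nat list set" where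
  "substrips c \<nu> = {\<mu>. length \<mu> = length \<nu> \<and> shape_fun \<mu> \<in> strips c (shape_fun \<nu>)}"

lemma interlaces_shape_fun:
  assumes "length \<mu> = length \<nu>"
  shows "interlaces (shape_fun \<mu>) (shape_fun \<nu>) \<longleftrightarrow>
    (\<forall>i<length \<nu>. \<mu> ! i \<le> \<nu> ! i \<and> (Suc i < length \<nu> \<longrightarrow> \<nu> ! Suc i \<le> \<mu> ! i))"
  using assms by (auto simp: interlaces_def shape_fun_def)

lemma multiset_eq_of_top_letter:
  fixes A B :: "nat multiset"
  assumes "set_mset A \<subseteq> {..<Suc N}" "set_mset B \<subseteq> {..<Suc N}"
    "filter_mset (\<lambda>x. x < N) A = filter_mset (\<lambda>x. x < N) B" "size A = size B"
  shows "A = B"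
proof -
  have split: "C = filter_mset (\<lambda>x. x < N) C + replicate_mset (count C N) N" if "set_mset C \<subseteq> {..<Suc N}" for C
  proof (rule multiset_eqI)
    fix x
    have "count C x = 0" if "N < x" using \<open>set_mset C \<subseteq> _\<close> that by (intro not_in_iff[THEN iffD1]) auto
    then show "count C x = count (filter_mset (\<lambda>x. x < N) C + replicate_mset (count C N) N) x"
      by (cases x N rule: linorder_cases) auto
  qed
  have "size A = size (filter_mset (\<lambda>x. x < N) A) + count A N"
    "size B = size (filter_mset (\<lambda>x. x < N) B) + count B N"
    using arg_cong[OF split[OF assms(1)], of size] arg_cong[OF split[OF assms(2)], of size] by simp_all
  then have "count A N = count B N" using assms(3,4) by simp
  then show ?thesis using split[OF assms(1)] split[OF assms(2)] assms(3) by simp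
qed

text \<open>
  Deleting the entries \<open>N\<close> from a tableau with entries at most \<open>N\<close> leaves a tableau on an interlacing
  shape: an entry \<open>N\<close> above another one would violate strictness in its column.  Conversely the
  deleted entries are determined by the two shapes.
\<close>
lemma card_tableaux_Suc:
  assumes \<nu>: "sorted_wrt (\<ge>) \<nu>" and A: "set_mset A \<subseteq> {..<Suc N}"
  shows "card (tableaux_of_content (Suc N) \<nu> A) =
    (\<Sum>\<mu> \<in> substrips (count A N) \<nu>. card (tableaux_of_content N \<mu> (filter_mset (\<lambda>x. x < N) A)))"
proof -
  define A' where "A' = filter_mset (\<lambda>x. x < N) A"
  define strip where "strip T = map (filter (\<lambda>x. x < N)) T" for T
  let ?U = "\<Union>\<mu> \<in> substrips (count A N) \<nu>. tableaux_of_content N \<mu> A'"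
  have size_A: "size A = size A' + count A N"
  proof -
    have "filter_mset (\<lambda>x. \<not> x < N) A = replicate_mset (count A N) N"
      using A by (intro multiset_eqI) (auto simp: not_in_iff[symmetric])
    then show ?thesis unfolding A'_def by (metis multiset_partition size_replicate_mset size_union)
  qed
  have \<nu>_le: "\<nu> ! Suc i \<le> \<nu> ! i" if "Suc i < length \<nu>" for i
    using \<nu> that by (simp add: sorted_wrt_iff_nth_less)
  have "bij_betw strip (tableaux_of_content (Suc N) \<nu> A) ?U"
  proof (rule bij_betw_imageI)
    have fill: "T = map2 (\<lambda>r k. r @ replicate (k - length r) N) (strip T) \<nu>"
      if T: "T \<in> tableaux_of_content (Suc N) \<nu> A" for T
    proof (rule nth_equalityI)
      from T have len: "map length T = \<nu>" by (simp add: tableaux_of_content_def semistandard_tableaux_def)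
      then have len': "length T = length \<nu>" by (metis length_map)
      then show "length T = length (map2 (\<lambda>r k. r @ replicate (k - length r) N) (strip T) \<nu>)"
        by (simp add: strip_def)
      fix i assume i: "i < length T"
      have "T ! i = filter (\<lambda>x. x < N) (T ! i) @
          replicate (length (T ! i) - length (filter (\<lambda>x. x < N) (T ! i))) N"
        using T i by (intro sorted_row_split)
          (auto simp: tableaux_of_content_def semistandard_tableaux_def, (meson nth_mem subsetD lessThan_iff UN_I)+)
      moreover have "\<nu> ! i = length (T ! i)" using len i by auto
      ultimately show "T ! i = map2 (\<lambda>r k. r @ replicate (k - length r) N) (strip T) \<nu> ! i"
        using i len' by (simp add: strip_def)
    qed
    show "inj_on strip (tableaux_of_content (Suc N) \<nu> A)"
    proof (rule inj_onI)
      fix S T assume "S \<in> tableaux_of_content (Suc N) \<nu> A" "T \<in> tableaux_of_content (Suc N) \<nu> A"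
        and eq: "strip S = strip T"
      note fills = fill[OF this(1)] fill[OF this(2)]
      have "S = map2 (\<lambda>r k. r @ replicate (k - length r) N) (strip S) \<nu>" by (rule fills)
      also have "\<dots> = map2 (\<lambda>r k. r @ replicate (k - length r) N) (strip T) \<nu>" unfolding eq ..
      also have "\<dots> = T" by (rule fills(2)[symmetric])
      finally show "S = T" .
    qed
    show "strip ` tableaux_of_content (Suc N) \<nu> A = ?U"
    proof (intro equalityI subsetI)
      fix T' assume "T' \<in> strip ` tableaux_of_content (Suc N) \<nu> A"
      then obtain T where T': "T' = strip T" and T: "T \<in> tableaux_of_content (Suc N) \<nu> A" by blast
      from T have len: "map length T = \<nu>" and sorted: "\<And>r. r \<in> set T \<Longrightarrow> sorted r"
        and entries: "set (concat T) \<subseteq> {..<Suc N}" and content: "mset (concat T) = A"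
        and column: "\<And>i j. Suc i < length T \<Longrightarrow> j < length (T ! i) \<Longrightarrow> j < length (T ! Suc i) \<Longrightarrow>
          T ! i ! j < T ! Suc i ! j"
        by (auto simp: tableaux_of_content_def semistandard_tableaux_def)
      have len': "length T = length \<nu>" using len by (metis length_map)
      have len_i: "length (T ! i) = \<nu> ! i" if "i < length \<nu>" for i using len that len' by (metis nth_map)
      define \<mu> where "\<mu> = map length T'"
      have len_\<mu>: "length \<mu> = length \<nu>" by (simp add: \<mu>_def T' strip_def len')
      have row: "\<mu> ! i \<le> \<nu> ! i" "j < \<mu> ! i \<Longrightarrow> T ! i ! j = T' ! i ! j"
        "\<mu> ! i \<le> j \<Longrightarrow> j < \<nu> ! i \<Longrightarrow> T ! i ! j = N"
        if i: "i < length \<nu>" for i j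
      proof -
        have T'_i: "T' ! i = filter (\<lambda>x. x < N) (T ! i)" using i by (simp add: T' strip_def len')
        have \<mu>_i: "\<mu> ! i = length (T' ! i)" using i len' by (simp add: \<mu>_def T' strip_def)
        show "\<mu> ! i \<le> \<nu> ! i" using len_i[OF i] length_filter_le[of _ "T ! i"] by (metis \<mu>_i T'_i)
        have ti: "T ! i \<in> set T" using i len' by simp
        then have "set (T ! i) \<subseteq> {..<Suc N}" using entries by auto
        then have split: "T ! i = T' ! i @ replicate (\<nu> ! i - \<mu> ! i) N"
          using sorted_row_split[OF sorted[OF ti]] len_i[OF i] by (simp add: T'_i \<mu>_i)
        show "j < \<mu> ! i \<Longrightarrow> T ! i ! j = T' ! i ! j" by (subst split) (simp add: nth_append \<mu>_i)
        show "\<mu> ! i \<le> j \<Longrightarrow> j < \<nu> ! i \<Longrightarrow> T ! i ! j = N" by (subst split) (simp add: nth_append \<mu>_i)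
      qed
      have "\<nu> ! Suc i \<le> \<mu> ! i" if i: "Suc i < length \<nu>" for i
      proof (rule ccontr)
        assume "\<not> \<nu> ! Suc i \<le> \<mu> ! i"
        then have lt: "\<mu> ! i < \<nu> ! Suc i" by simp
        then have "T ! i ! (\<mu> ! i) = N" using row(3)[of i "\<mu> ! i"] \<nu>_le[OF i] i by simp
        moreover have "T ! i ! (\<mu> ! i) < T ! Suc i ! (\<mu> ! i)"
          using lt \<nu>_le[OF i] i by (intro column) (simp_all add: len' len_i)
        moreover have "T ! Suc i ! (\<mu> ! i) \<in> set (concat T)"
          using lt i len' len_i by (auto intro!: bexI[of _ "T ! Suc i"])
        ultimately show False using entries by auto
      qed
      then have "interlaces (shape_fun \<mu>) (shape_fun \<nu>)" using len_\<mu> row(1) by (simp add: interlaces_shape_fun)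
      moreover have content': "mset (concat T') = A'"
        unfolding T' strip_def A'_def content[symmetric] by (simp add: filter_concat[symmetric])
      moreover have "sum_list \<nu> = sum_list \<mu> + count A N"
        using size_A unfolding \<mu>_def content'[symmetric] content[symmetric] len[symmetric]
        by (simp add: length_concat)
      ultimately have "\<mu> \<in> substrips (count A N) \<nu>"
        using len_\<mu> by (simp add: substrips_def strips_def shape_size_shape_fun)
      moreover have "T' \<in> semistandard_tableaux N \<mu>"
        unfolding semistandard_tableaux_def
      proof (intro CollectI conjI allI impI)
        show "map length T' = \<mu>" by (simp add: \<mu>_def)
        show "set (concat T') \<subseteq> {..<N}" by (auto simp: T' strip_def)
        show "\<forall>r\<in>set T'. sorted r" using sorted by (auto simp: T' strip_def sorted_wrt_filter)
        fix i j assume "Suc i < length T' \<and> j < length (T' ! i) \<and> j < length (T' ! Suc i)"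
        then have i: "Suc i < length \<nu>" and j: "j < \<mu> ! i" "j < \<mu> ! Suc i"
          by (auto simp: \<mu>_def T' strip_def len')
        then have "T ! i ! j < T ! Suc i ! j"
          using row(1)[of i] row(1)[of "Suc i"] by (intro column) (auto simp: len' len_i intro: less_le_trans)
        then show "T' ! i ! j < T' ! Suc i ! j" using i j row(2) by simp
      qed
      ultimately show "T' \<in> ?U" using content' by (auto simp: tableaux_of_content_def)
    next
      fix T' assume "T' \<in> ?U"
      then obtain \<mu> where \<mu>: "\<mu> \<in> substrips (count A N) \<nu>" and T': "T' \<in> semistandard_tableaux N \<mu>"
        and content': "mset (concat T') = A'" by (auto simp: tableaux_of_content_def)
      have len_\<mu>: "length \<mu> = length \<nu>" using \<mu> by (simp add: substrips_def)
      from \<mu> have \<mu>_le: "\<And>i. i < length \<nu> \<Longrightarrow> \<mu> ! i \<le> \<nu> ! i"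
        and \<nu>_\<mu>: "\<And>i. Suc i < length \<nu> \<Longrightarrow> \<nu> ! Suc i \<le> \<mu> ! i"
        by (auto simp: substrips_def strips_def interlaces_shape_fun[OF len_\<mu>])
      from T' have len: "map length T' = \<mu>" and sorted: "\<And>r. r \<in> set T' \<Longrightarrow> sorted r"
        and entries: "set (concat T') \<subseteq> {..<N}"
        and column: "\<And>i j. Suc i < length T' \<Longrightarrow> j < length (T' ! i) \<Longrightarrow> j < length (T' ! Suc i) \<Longrightarrow>
          T' ! i ! j < T' ! Suc i ! j"
        by (auto simp: semistandard_tableaux_def)
      have len': "length T' = length \<nu>" using len len_\<mu> by (metis length_map)
      have len_i: "length (T' ! i) = \<mu> ! i" if "i < length \<nu>" for i using len that len' by (metis nth_map)
      define T where "T = map (\<lambda>i. T' ! i @ replicate (\<nu> ! i - \<mu> ! i) N) [0..<length \<nu>]"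
      have len_T: "length T = length \<nu>" by (simp add: T_def)
      have T_i: "T ! i = T' ! i @ replicate (\<nu> ! i - \<mu> ! i) N" if "i < length \<nu>" for i
        using that by (simp add: T_def)
      have len_T_i: "length (T ! i) = \<nu> ! i" if "i < length \<nu>" for i
        using that \<mu>_le[OF that] by (simp add: T_i len_i)
      have T'_lt: "x < N" if "i < length \<nu>" "x \<in> set (T' ! i)" for i x
      proof -
        have "T' ! i \<in> set T'" using that len' by simp
        then have "x \<in> set (concat T')" using that(2) by auto
        then show ?thesis using entries by auto
      qed
      have strip_T: "strip T = T'"
      proof (rule nth_equalityI)
        fix i assume "i < length (strip T)"
        then have i: "i < length \<nu>" by (simp add: strip_def len_T)
        then have "filter (\<lambda>x. x < N) (T' ! i) = T' ! i" using T'_lt by (simp add: filter_id_conv)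
        then show "strip T ! i = T' ! i" using i by (simp add: strip_def len_T T_i)
      qed (simp add: strip_def len_T len')
      have entries_T: "set (concat T) \<subseteq> {..<Suc N}"
        using T'_lt by (auto simp: T_def less_Suc_eq)
      have "T \<in> semistandard_tableaux (Suc N) \<nu>"
        unfolding semistandard_tableaux_def
      proof (intro CollectI conjI allI impI entries_T)
        show map_len: "map length T = \<nu>" by (rule nth_equalityI) (simp_all add: len_T len_T_i)
        show "\<forall>r\<in>set T. sorted r"
        proof
          fix r assume "r \<in> set T"
          then obtain i where i: "i < length \<nu>" "r = T' ! i @ replicate (\<nu> ! i - \<mu> ! i) N"
            by (auto simp: T_def)
          then show "sorted r" using sorted[of "T' ! i"] T'_lt[OF i(1)] len'
            by (auto simp: sorted_append intro: less_imp_le)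
        qed
        fix i j assume "Suc i < length T \<and> j < length (T ! i) \<and> j < length (T ! Suc i)"
        then have i: "Suc i < length \<nu>" and j: "j < \<nu> ! Suc i" by (auto simp: len_T len_T_i)
        then have j': "j < \<mu> ! i" using \<nu>_\<mu>[OF i] by simp
        then have Tij: "T ! i ! j = T' ! i ! j" using i by (simp add: T_i nth_append len_i)
        show "T ! i ! j < T ! Suc i ! j"
        proof (cases "j < \<mu> ! Suc i")
          case True
          then have "T ! Suc i ! j = T' ! Suc i ! j" using i by (simp add: T_i nth_append len_i)
          then show ?thesis using column[of i j] i j' True by (simp add: Tij len' len_i)
        next
          case False
          then have "T ! Suc i ! j = N" using i j by (simp add: T_i nth_append len_i)
          then show ?thesis using T'_lt[of i "T' ! i ! j"] i j' by (simp add: Tij len_i)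
        qed
      qed
      moreover from this have "map length T = \<nu>" by (simp add: semistandard_tableaux_def)
      moreover have "mset (concat T) = A"
      proof (rule multiset_eq_of_top_letter)
        show "filter_mset (\<lambda>x. x < N) (mset (concat T)) = filter_mset (\<lambda>x. x < N) A"
          using content' strip_T unfolding A'_def strip_def
          by (metis filter_concat mset_filter)
        have "sum_list \<nu> = sum_list \<mu> + count A N"
          using \<mu> by (simp add: substrips_def strips_def shape_size_shape_fun)
        then show "size (mset (concat T)) = size A"
          using \<open>map length T = \<nu>\<close> len size_A content'
          by (metis length_concat size_mset)
      qed (use entries_T A in auto)
      ultimately have "T \<in> tableaux_of_content (Suc N) \<nu> A" by (simp add: tableaux_of_content_def)
      then show "T' \<in> strip ` tableaux_of_content (Suc N) \<nu> A" using strip_T by blast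
    qed
  qed
  then have "card (tableaux_of_content (Suc N) \<nu> A) = card ?U" by (rule bij_betw_same_card)
  also have "\<dots> = (\<Sum>\<mu> \<in> substrips (count A N) \<nu>. card (tableaux_of_content N \<mu> A'))"
  proof (rule card_UN_disjoint)
    have "substrips (count A N) \<nu> \<subseteq> {xs. set xs \<subseteq> {..sum_list \<nu>} \<and> length xs = length \<nu>}"
    proof safe
      fix \<mu> x assume "\<mu> \<in> substrips (count A N) \<nu>" "x \<in> set \<mu>"
      then show "x \<le> sum_list \<nu>"
        using member_le_sum_list[of x \<mu>] by (simp add: substrips_def strips_def shape_size_shape_fun)
    qed (simp add: substrips_def)
    then show "finite (substrips (count A N) \<nu>)"
      by (rule finite_subset) (simp add: finite_lists_length_eq)
    show "\<forall>\<mu>\<in>substrips (count A N) \<nu>. finite (tableaux_of_content N \<mu> A')"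
      by (simp add: tableaux_of_content_def finite_semistandard_tableaux)
  qed (auto simp: tableaux_of_content_def semistandard_tableaux_def)
  finally show ?thesis by (simp add: A'_def)
qed

lemma card_tableaux_of_content:
  assumes "sorted_wrt (\<ge>) \<nu>" "set_mset A \<subseteq> {..<N}"
  shows "card (tableaux_of_content N \<nu> A) = kostka (rev (map (count A) [0..<N])) (shape_fun \<nu>)"
  using assms
proof (induction N arbitrary: \<nu> A)
  case 0
  then have A: "A = {#}" by simp
  have *: "T \<in> tableaux_of_content 0 \<nu> A \<longleftrightarrow> T = map (\<lambda>_. []) \<nu> \<and> shape_fun \<nu> = (\<lambda>_. 0)" for T
  proof
    assume "T \<in> tableaux_of_content 0 \<nu> A"
    then have T: "map length T = \<nu>" "\<forall>r\<in>set T. r = []"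
      by (auto simp: tableaux_of_content_def semistandard_tableaux_def)
    have len: "length T = length \<nu>" using T(1) by (metis length_map)
    have T_i: "T ! i = []" if "i < length \<nu>" for i using T(2) that len by simp
    have "\<nu> ! i = 0" if "i < length \<nu>" for i using T_i[OF that] T(1) that len by (metis list.size(3) nth_map)
    then have "shape_fun \<nu> = (\<lambda>_. 0)" by (auto simp: shape_fun_def)
    moreover have "T = map (\<lambda>_. []) \<nu>" by (rule nth_equalityI) (simp_all add: len T_i)
    ultimately show "T = map (\<lambda>_. []) \<nu> \<and> shape_fun \<nu> = (\<lambda>_. 0)" by simp
  next
    assume *: "T = map (\<lambda>_. []) \<nu> \<and> shape_fun \<nu> = (\<lambda>_. 0)"
    have "\<nu> ! i = 0" if "i < length \<nu>" for i using fun_cong[OF conjunct2[OF *], of i] that by (simp add: shape_fun_def)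
    then have "map length T = \<nu>" using * by (intro nth_equalityI) auto
    then show "T \<in> tableaux_of_content 0 \<nu> A"
      using * by (auto simp: tableaux_of_content_def semistandard_tableaux_def A)
  qed
  have "tableaux_of_content 0 \<nu> A = (if shape_fun \<nu> = (\<lambda>_. 0) then {map (\<lambda>_. []) \<nu>} else {})"
    using * by auto
  then show ?case by simp
next
  case (Suc N)
  let ?A = "filter_mset (\<lambda>x. x < N) A" and ?c = "count A N"
  have shapes: "shape_fun \<nu> \<in> shapes" using Suc.prems(1) by (rule shape_fun_in_shapes)
  have "card (tableaux_of_content (Suc N) \<nu> A) =
      (\<Sum>\<mu> \<in> substrips ?c \<nu>. card (tableaux_of_content N \<mu> ?A))"
    using Suc.prems by (rule card_tableaux_Suc)
  also have "\<dots> = (\<Sum>\<mu> \<in> substrips ?c \<nu>. kostka (rev (map (count A) [0..<N])) (shape_fun \<mu>))"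
  proof (rule sum.cong[OF refl])
    fix \<mu> assume \<mu>: "\<mu> \<in> substrips ?c \<nu>"
    have "shape_fun \<mu> \<in> shapes" using \<mu> strips_in_shapes[OF shapes] unfolding substrips_def by blast
    then have "\<mu> ! j \<le> \<mu> ! i" if "i < j" "j < length \<mu>" for i j
      using shapes_antimono[of "shape_fun \<mu>" i j] that by (simp add: shape_fun_def)
    then have "sorted_wrt (\<ge>) \<mu>" by (simp add: sorted_wrt_iff_nth_less)
    then have "card (tableaux_of_content N \<mu> ?A) = kostka (rev (map (count ?A) [0..<N])) (shape_fun \<mu>)"
      by (rule Suc.IH) auto
    also have "map (count ?A) [0..<N] = map (count A) [0..<N]" by simp
    finally show "card (tableaux_of_content N \<mu> ?A) = kostka (rev (map (count A) [0..<N])) (shape_fun \<mu>)" .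
  qed
  also have "\<dots> = (\<Sum>f \<in> strips ?c (shape_fun \<nu>). kostka (rev (map (count A) [0..<N])) f)"
  proof (rule sum.reindex_bij_witness[of _ "\<lambda>f. map f [0..<length \<nu>]" shape_fun], goal_cases)
    case (1 \<mu>)
    then show ?case by (intro nth_equalityI) (auto simp: substrips_def shape_fun_def)
  next
    case (4 f)
    have "f i = 0" if "length \<nu> \<le> i" for i
    proof -
      have "f i \<le> shape_fun \<nu> i" using 4 by (auto simp: strips_def interlaces_def)
      then show ?thesis using that by (simp add: shape_fun_def)
    qed
    then have "shape_fun (map f [0..<length \<nu>]) = f" by (auto simp: shape_fun_def fun_eq_iff)
    then show ?case using 4 by (simp add: substrips_def)
  next
    case (3 f)
    have "f i = 0" if "length \<nu> \<le> i" for i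
    proof -
      have "f i \<le> shape_fun \<nu> i" using 3 by (auto simp: strips_def interlaces_def)
      then show ?thesis using that by (simp add: shape_fun_def)
    qed
    then show ?case by (auto simp: shape_fun_def fun_eq_iff)
  qed (auto simp: substrips_def)
  finally show ?case by simp
qed

lemma lookup_schur_poly:
  assumes "sorted_wrt (\<ge>) \<nu>"
  shows "Poly_Mapping.lookup (schur_poly N \<nu>) A =
    (if set_mset A \<subseteq> {..<N} then of_nat (kostka_number (exponents A) (shape_fun \<nu>)) else 0)"
proof -
  have "Poly_Mapping.lookup (schur_poly N \<nu>) A =
      (\<Sum>T \<in> semistandard_tableaux N \<nu>. if mset (concat T) = A then 1 else 0)"
    by (simp add: schur_poly_def lookup_sum lookup_single when_def)
  also have "\<dots> = of_nat (card (tableaux_of_content N \<nu> A))"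
    by (simp add: finite_semistandard_tableaux tableaux_of_content_def sum.inter_filter[symmetric])
  finally have *: "Poly_Mapping.lookup (schur_poly N \<nu>) A = of_nat (card (tableaux_of_content N \<nu> A))" .
  show ?thesis
  proof (cases "set_mset A \<subseteq> {..<N}")
    case True
    have "kostka (rev (map (count A) [0..<N])) (shape_fun \<nu>) =
        kostka (filter (\<lambda>c. c \<noteq> 0) (map (count A) [0..<N])) (shape_fun \<nu>)"
      by (subst kostka_filter) (auto intro!: kostka_mset_cong shape_fun_in_shapes assms)
    also have "\<dots> = kostka_number (exponents A) (shape_fun \<nu>)"
      unfolding mset_counts[OF True, symmetric]
      by (rule kostka_number_mset[symmetric]) (rule shape_fun_in_shapes[OF assms])
    finally show ?thesis using True by (simp add: * card_tableaux_of_content[OF assms])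
  next
    case False
    have "set_mset A \<subseteq> {..<N}" if "T \<in> tableaux_of_content N \<nu> A" for T
      using that by (metis (mono_tags, lifting) mem_Collect_eq semistandard_tableaux_def set_mset_mset tableaux_of_content_def)
    then have "tableaux_of_content N \<nu> A = {}" using False by blast
    then show ?thesis using False by (simp add: *)
  qed
qed

section \<open>Symmetric families and power sums\<close>

text \<open>
  Symmetric polynomials in growing numbers of variables that are compatible with setting variables
  to zero: one coefficient function on multisets of exponents describes all of them.
\<close>
definition symm_family :: "(nat multiset \<Rightarrow> rat) \<Rightarrow> (nat \<Rightarrow> mpoly_rat) \<Rightarrow> bool" where
  "symm_family \<phi> F \<longleftrightarrow> (\<forall>N A. Poly_Mapping.lookup (F N) A =
    (if set_mset A \<subseteq> {..<N} then \<phi> (exponents A) else 0))"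

definition lower_part :: "nat \<Rightarrow> nat \<Rightarrow> nat multiset \<Rightarrow> nat multiset" where
  "lower_part k j e = e - {#j#} + (if j = k then {#} else {#j - k#})"

text \<open>
  The effect on coefficients of multiplying by the power sum of degree \<open>k\<close>.
\<close>
definition power_sum_step :: "nat \<Rightarrow> (nat multiset \<Rightarrow> rat) \<Rightarrow> nat multiset \<Rightarrow> rat" where
  "power_sum_step k \<phi> e = (\<Sum>j\<in>#e. if k \<le> j then \<phi> (lower_part k j e) else 0)"

lemma exponents_remove:
  "exponents A = (if count A i = 0 then {#} else {#count A i#}) +
    image_mset (count A) (mset_set (set_mset A - {i}))"
proof (cases "i \<in># A")
  case True
  then have "mset_set (set_mset A) = add_mset i (mset_set (set_mset A - {i}))"
    by (simp add: mset_set.remove)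
  then show ?thesis using True by (simp add: exponents_def)
next
  case False
  then show ?thesis by (simp add: exponents_def not_in_iff[symmetric])
qed

lemma exponents_diff_replicate:
  assumes "1 \<le> k" "k \<le> count A i"
  shows "exponents (A - replicate_mset k i) = lower_part k (count A i) (exponents A)"
proof -
  define B where "B = A - replicate_mset k i"
  have count_i: "count B i = count A i - k" by (simp add: B_def)
  have other: "count B j = count A j" if "j \<noteq> i" for j using that by (simp add: B_def)
  have "x \<in># B \<longleftrightarrow> x \<in># A" if "x \<noteq> i" for x
    using other[OF that] by (metis count_eq_zero_iff)
  then have "set_mset B - {i} = set_mset A - {i}" by blast
  moreover have "image_mset (count B) (mset_set (set_mset A - {i})) =
      image_mset (count A) (mset_set (set_mset A - {i}))"
    using other by (intro image_mset_cong) auto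
  ultimately show ?thesis
    using exponents_remove[of A i] exponents_remove[of B i] assms
    by (simp add: lower_part_def count_i B_def[symmetric] le_Suc_eq)
qed

lemma zero_notin_exponents: "0 \<notin># exponents A"
  by (auto simp: exponents_def count_eq_zero_iff)

lemma sum_exponents: "(\<Sum>j\<in>#exponents A. g j) = (\<Sum>i\<in>set_mset A. g (count A i))"
  by (simp add: exponents_def sum_unfold_sum_mset image_mset.compositionality o_def)

text \<open>
  Every multiset of positive exponents is realised by a monomial, so equations between coefficient
  functions can be derived from equations between polynomials.
\<close>
lemma obtain_exponents:
  assumes "0 \<notin># e"
  obtains A N where "set_mset A \<subseteq> {..<N}" "exponents A = e"
proof -
  have "\<exists>A N. set_mset A \<subseteq> {..<N} \<and> exponents A = e" using assms
  proof (induction e)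
    case empty
    show ?case by (intro exI[of _ "{#}"]) (simp add: exponents_def)
  next
    case (add c e)
    then obtain A N where A: "set_mset A \<subseteq> {..<N}" "exponents A = e" by auto
    define B where "B = A + replicate_mset c N"
    have "N \<notin># A" using A by auto
    then have "count A N = 0" by (simp add: not_in_iff)
    then have "exponents (B - replicate_mset c N) = lower_part c c (exponents B)"
      using add.prems exponents_diff_replicate[of c B N] by (simp add: B_def)
    then have "e = exponents B - {#c#}" using A by (simp add: B_def lower_part_def)
    moreover have "c \<in># exponents B"
      using add.prems \<open>count A N = 0\<close> by (auto simp: exponents_def B_def intro!: image_eqI[of _ _ N])
    ultimately have "exponents B = add_mset c e" by simp
    moreover have "set_mset B \<subseteq> {..<Suc N}" using A by (auto simp: B_def split: if_splits)
    ultimately show ?case by blast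
  qed
  then show ?thesis using that by blast
qed

lemma symm_family_unique:
  assumes "symm_family \<phi> F" "symm_family \<psi> F" "0 \<notin># e"
  shows "\<phi> e = \<psi> e"
proof -
  obtain A N where "set_mset A \<subseteq> {..<N}" "exponents A = e" using obtain_exponents[OF assms(3)] .
  then show ?thesis using assms(1,2) unfolding symm_family_def by metis
qed

lemma lookup_single_mult:
  fixes F :: mpoly_rat
  shows "Poly_Mapping.lookup (Poly_Mapping.single m c * F) A =
    (if m \<subseteq># A then c * Poly_Mapping.lookup F (A - m) else 0)"
proof -
  have "Poly_Mapping.lookup (Poly_Mapping.single m c * F) A =
      (\<Sum>l. (c when m = l) * (\<Sum>q. Poly_Mapping.lookup F q when A = l + q))"
    by (simp add: lookup_mult lookup_single)
  also have "\<dots> = (\<Sum>l. (c * (\<Sum>q. Poly_Mapping.lookup F q when A = l + q)) when m = l)"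
    by (simp add: when_mult)
  also have "\<dots> = c * (\<Sum>q. Poly_Mapping.lookup F q when A = m + q)" by simp
  also have "(\<Sum>q. Poly_Mapping.lookup F q when A = m + q) =
      (if m \<subseteq># A then Poly_Mapping.lookup F (A - m) else 0)"
  proof (cases "m \<subseteq># A")
    case True
    then have "A = m + q \<longleftrightarrow> q = A - m" for q by (auto simp: subset_mset.add_diff_inverse)
    then show ?thesis using True by simp
  next
    case False
    then have "A \<noteq> m + q" for q by auto
    then show ?thesis using False by simp
  qed
  finally show ?thesis by simp
qed

lemma mpoly_var_power: "mpoly_var i ^ k = Poly_Mapping.single (replicate_mset k i) 1"
  by (induction k) (simp_all add: mult_single single_one[symmetric] del: single_one)

lemma symm_family_power_sum:
  assumes F: "symm_family \<phi> F" and k: "1 \<le> k"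
  shows "symm_family (power_sum_step k \<phi>) (\<lambda>N. power_sum N k * F N)"
  unfolding symm_family_def
proof (intro allI)
  fix N :: nat and A :: "nat multiset"
  have sub: "replicate_mset k i \<subseteq># A \<longleftrightarrow> k \<le> count A i" for i
    by (simp add: count_le_replicate_mset_subset_eq)
  have "Poly_Mapping.lookup (power_sum N k * F N) A =
      (\<Sum>i<N. if k \<le> count A i then Poly_Mapping.lookup (F N) (A - replicate_mset k i) else 0)"
    by (simp add: power_sum_def mpoly_var_power sum_distrib_right lookup_sum lookup_single_mult sub cong: if_cong)
  also have "\<dots> = (if set_mset A \<subseteq> {..<N} then power_sum_step k \<phi> (exponents A) else 0)"
  proof (cases "set_mset A \<subseteq> {..<N}")
    case True
    have "(\<Sum>i<N. if k \<le> count A i then Poly_Mapping.lookup (F N) (A - replicate_mset k i) else 0) =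
        (\<Sum>i\<in>set_mset A. if k \<le> count A i then \<phi> (lower_part k (count A i) (exponents A)) else 0)"
    proof (rule sum.mono_neutral_cong_right)
      show "set_mset A \<subseteq> {..<N}" by fact
      show "\<forall>i\<in>{..<N} - set_mset A. (if k \<le> count A i then
          Poly_Mapping.lookup (F N) (A - replicate_mset k i) else 0) = 0"
        using k by (auto simp: not_in_iff)
      fix i
      have "set_mset (A - replicate_mset k i) \<subseteq> {..<N}" using True by (meson in_diffD subset_iff)
      then show "(if k \<le> count A i then Poly_Mapping.lookup (F N) (A - replicate_mset k i) else 0) =
          (if k \<le> count A i then \<phi> (lower_part k (count A i) (exponents A)) else 0)"
        using F k by (simp add: symm_family_def exponents_diff_replicate)
    qed simp
    then show ?thesis using True by (simp add: power_sum_step_def sum_exponents)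
  next
    case False
    then obtain x where x: "x \<in># A" "\<not> x < N" by auto
    have "Poly_Mapping.lookup (F N) (A - replicate_mset k i) = 0" if "i < N" for i
    proof -
      have "x \<in># A - replicate_mset k i" using x that by (simp add: in_diff_count)
      then have "\<not> set_mset (A - replicate_mset k i) \<subseteq> {..<N}" using x by auto
      then show ?thesis using F by (simp add: symm_family_def)
    qed
    then show ?thesis using False by (auto intro!: sum.neutral)
  qed
  finally show "Poly_Mapping.lookup (power_sum N k * F N) A =
      (if set_mset A \<subseteq> {..<N} then power_sum_step k \<phi> (exponents A) else 0)" .
qed

fun power_coeff_list :: "nat list \<Rightarrow> nat multiset \<Rightarrow> rat" where
  "power_coeff_list [] = (\<lambda>e. if e = {#} then 1 else 0)"
| "power_coeff_list (k # ks) = power_sum_step k (power_coeff_list ks)"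

text \<open>
  The coefficients of a product of power sums in the monomial symmetric functions.  The factors are
  taken in sorted order only to have a definite list; \<open>power_coeff_add_mset\<close> shows that the order is
  irrelevant.
\<close>
definition power_coeff :: "nat multiset \<Rightarrow> nat multiset \<Rightarrow> rat" where
  "power_coeff \<mu> = power_coeff_list (sorted_list_of_multiset \<mu>)"

lemma symm_family_power_coeff_list:
  "0 \<notin> set ks \<Longrightarrow> symm_family (power_coeff_list ks) (\<lambda>N. \<Prod>k\<leftarrow>ks. power_sum N k)"
proof (induction ks)
  case Nil
  have "exponents A = {#} \<longleftrightarrow> A = {#}" for A
    by (simp add: exponents_def mset_set_empty_iff)
  then show ?case by (auto simp: symm_family_def lookup_one when_def)
next
  case (Cons k ks)
  then show ?case using symm_family_power_sum[of "power_coeff_list ks" "\<lambda>N. \<Prod>k\<leftarrow>ks. power_sum N k" k] by auto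
qed

lemma symm_family_power_coeff:
  assumes "0 \<notin># \<mu>"
  shows "symm_family (power_coeff \<mu>) (\<lambda>N. \<Prod>k\<in>#\<mu>. power_sum N k)"
proof -
  have "(\<Prod>k\<in>#\<mu>. power_sum N k) = (\<Prod>k\<leftarrow>sorted_list_of_multiset \<mu>. power_sum N k)" for N
    by (metis mset_map mset_sorted_list_of_multiset prod_mset_prod_list)
  then show ?thesis
    using symm_family_power_coeff_list[of "sorted_list_of_multiset \<mu>"] assms by (simp add: power_coeff_def)
qed

lemma power_coeff_add_mset:
  assumes "0 \<notin># add_mset k \<mu>" "0 \<notin># e"
  shows "power_coeff (add_mset k \<mu>) e = power_sum_step k (power_coeff \<mu>) e"
proof (rule symm_family_unique[OF _ _ assms(2)])
  show "symm_family (power_coeff (add_mset k \<mu>)) (\<lambda>N. \<Prod>k\<in>#add_mset k \<mu>. power_sum N k)"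
    by (rule symm_family_power_coeff[OF assms(1)])
  show "symm_family (power_sum_step k (power_coeff \<mu>)) (\<lambda>N. \<Prod>k\<in>#add_mset k \<mu>. power_sum N k)"
    using symm_family_power_sum[OF symm_family_power_coeff[of \<mu>], of k] assms(1) by auto
qed

text \<open>
  Multiplication by a power sum adds its degree to an existing exponent or creates a new one.  The
  number of exponents is largest if every factor creates a new one.
\<close>
lemma power_coeff_list_triangular:
  "power_coeff_list ks e \<noteq> 0 \<Longrightarrow>
    size e \<le> length ks \<and> (size e = length ks \<longrightarrow> e = mset ks) \<and> sum_mset e = sum_list ks"
proof (induction ks arbitrary: e)
  case Nil
  then show ?case by (simp split: if_splits)
next
  case (Cons k ks)
  then obtain j where j: "j \<in># e" "k \<le> j" "power_coeff_list ks (lower_part k j e) \<noteq> 0"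
    by (fastforce simp: power_sum_step_def intro: ccontr sum_mset.neutral)
  then obtain e' where e: "e = add_mset j e'" by (blast dest: multi_member_split)
  show ?case using Cons.IH[OF j(3)] j(2)
    by (cases "j = k") (auto simp: e lower_part_def)
qed

lemma power_coeff_triangular:
  assumes "power_coeff \<mu> e \<noteq> 0"
  shows "size e \<le> size \<mu>" "size e = size \<mu> \<Longrightarrow> e = \<mu>" "sum_mset e = sum_mset \<mu>"
proof -
  have "length (sorted_list_of_multiset \<mu>) = size \<mu>" "sum_list (sorted_list_of_multiset \<mu>) = sum_mset \<mu>"
    by (metis mset_sorted_list_of_multiset size_mset) (metis mset_sorted_list_of_multiset sum_mset_sum_list)
  then show "size e \<le> size \<mu>" "size e = size \<mu> \<Longrightarrow> e = \<mu>" "sum_mset e = sum_mset \<mu>"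
    using power_coeff_list_triangular[of "sorted_list_of_multiset \<mu>" e] assms by (auto simp: power_coeff_def)
qed

lemma sum_mset_nonneg:
  fixes f :: "'a \<Rightarrow> rat"
  assumes "\<And>x. 0 \<le> f x"
  shows "0 \<le> (\<Sum>x\<in>#M. f x)"
  by (induction M) (simp_all add: assms)

lemma power_coeff_list_nonneg: "0 \<le> power_coeff_list ks e"
  by (induction ks arbitrary: e) (auto simp: power_sum_step_def intro!: sum_mset_nonneg)

lemma power_coeff_list_diagonal: "0 < power_coeff_list ks (mset ks)"
proof (induction ks)
  case (Cons k ks)
  have "power_coeff_list ks (mset ks) \<le> power_coeff_list (k # ks) (mset (k # ks))"
    by (simp add: power_sum_step_def lower_part_def power_coeff_list_nonneg sum_mset_nonneg)
  then show ?case using Cons by simp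
qed simp

lemma power_coeff_diagonal: "power_coeff \<mu> \<mu> \<noteq> 0"
  using power_coeff_list_diagonal[of "sorted_list_of_multiset \<mu>"] by (simp add: power_coeff_def)

lemma power_sum_step_linear:
  "power_sum_step k (\<lambda>e. c * \<phi> e + \<psi> e) e = c * power_sum_step k \<phi> e + power_sum_step k \<psi> e"
proof -
  have "power_sum_step k (\<lambda>e. c * \<phi> e + \<psi> e) e =
      (\<Sum>j\<in>#e. c * (if k \<le> j then \<phi> (lower_part k j e) else 0) + (if k \<le> j then \<psi> (lower_part k j e) else 0))"
    unfolding power_sum_step_def by (intro arg_cong[where f = sum_mset] image_mset_cong) simp
  then show ?thesis unfolding power_sum_step_def by (simp only: sum_mset.distrib sum_mset_distrib_left)
qed

lemma power_sum_step_sum: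
  "finite S \<Longrightarrow> power_sum_step k (\<lambda>e. \<Sum>i\<in>S. c i * \<phi> i e) e = (\<Sum>i\<in>S. c i * power_sum_step k (\<phi> i) e)"
proof (induction S rule: finite_induct)
  case empty
  then show ?case by (simp add: power_sum_step_def)
qed (simp add: power_sum_step_linear)

definition monomial_coeff :: "mpoly_rat \<Rightarrow> nat multiset \<Rightarrow> rat" where
  "monomial_coeff f e = (\<Sum>\<mu>\<in>Poly_Mapping.keys f. Poly_Mapping.lookup f \<mu> * power_coeff \<mu> e)"

lemma monomial_coeff_superset:
  assumes "finite S" "Poly_Mapping.keys f \<subseteq> S"
  shows "monomial_coeff f e = (\<Sum>\<mu>\<in>S. Poly_Mapping.lookup f \<mu> * power_coeff \<mu> e)"
  unfolding monomial_coeff_def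
  by (rule sum.mono_neutral_left) (use assms in \<open>auto simp: in_keys_iff\<close>)

lemma monomial_coeff_single: "monomial_coeff (Poly_Mapping.single \<mu> c) e = c * power_coeff \<mu> e"
  by (subst monomial_coeff_superset[of "{\<mu>}"]) auto

lemma monomial_coeff_add: "monomial_coeff (f + g) e = monomial_coeff f e + monomial_coeff g e"
  using monomial_coeff_superset[of "Poly_Mapping.keys f \<union> Poly_Mapping.keys g" f e]
    monomial_coeff_superset[of "Poly_Mapping.keys f \<union> Poly_Mapping.keys g" g e]
    monomial_coeff_superset[of "Poly_Mapping.keys f \<union> Poly_Mapping.keys g" "f + g" e] keys_add[of f g]
  by (simp add: lookup_add algebra_simps sum.distrib)

lemma monomial_coeff_zero [simp]: "monomial_coeff 0 e = 0"
  by (simp add: monomial_coeff_def)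

lemma monomial_coeff_sum: "monomial_coeff (\<Sum>i\<in>S. f i) e = (\<Sum>i\<in>S. monomial_coeff (f i) e)"
  by (induction S rule: infinite_finite_induct) (simp_all add: monomial_coeff_add)

lemma lookup_const_mult: "Poly_Mapping.lookup (mpoly_const c * f) A = c * Poly_Mapping.lookup f A"
  by (simp add: lookup_single_mult)

lemma monomial_coeff_const_mult: "monomial_coeff (mpoly_const c * f) e = c * monomial_coeff f e"
proof -
  have "Poly_Mapping.keys (mpoly_const c * f) \<subseteq> Poly_Mapping.keys f"
    by (auto simp: in_keys_iff lookup_const_mult)
  then have "monomial_coeff (mpoly_const c * f) e =
      (\<Sum>\<mu>\<in>Poly_Mapping.keys f. Poly_Mapping.lookup (mpoly_const c * f) \<mu> * power_coeff \<mu> e)"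
    by (intro monomial_coeff_superset) simp_all
  then show ?thesis by (simp add: lookup_const_mult monomial_coeff_def sum_distrib_left mult.assoc)
qed

lemma monomial_coeff_diff: "monomial_coeff (f - g) e = monomial_coeff f e - monomial_coeff g e"
  using monomial_coeff_add[of "f - g" g e] by simp

lemma symm_family_restrict_vars:
  assumes "f \<in> Lambda_Q"
  shows "symm_family (monomial_coeff f) (\<lambda>N. restrict_vars N f)"
  unfolding symm_family_def
proof (intro allI)
  fix N :: nat and A :: "nat multiset"
  have "Poly_Mapping.lookup (restrict_vars N f) A = (\<Sum>\<mu>\<in>Poly_Mapping.keys f.
      Poly_Mapping.lookup f \<mu> * Poly_Mapping.lookup (\<Prod>k\<in>#\<mu>. power_sum N k) A)"
    by (simp add: restrict_vars_def lookup_sum lookup_const_mult)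
  also have "\<dots> = (\<Sum>\<mu>\<in>Poly_Mapping.keys f. Poly_Mapping.lookup f \<mu> *
      (if set_mset A \<subseteq> {..<N} then power_coeff \<mu> (exponents A) else 0))"
  proof (rule sum.cong[OF refl])
    fix \<mu> assume "\<mu> \<in> Poly_Mapping.keys f"
    then have "0 \<notin># \<mu>" using assms by (simp add: Lambda_Q_def)
    from symm_family_power_coeff[OF this]
    have "Poly_Mapping.lookup (\<Prod>k\<in>#\<mu>. power_sum N k) A =
        (if set_mset A \<subseteq> {..<N} then power_coeff \<mu> (exponents A) else 0)"
      unfolding symm_family_def by blast
    then show "Poly_Mapping.lookup f \<mu> * Poly_Mapping.lookup (\<Prod>k\<in>#\<mu>. power_sum N k) A =
        Poly_Mapping.lookup f \<mu> * (if set_mset A \<subseteq> {..<N} then power_coeff \<mu> (exponents A) else 0)"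
      by simp
  qed
  finally show "Poly_Mapping.lookup (restrict_vars N f) A =
      (if set_mset A \<subseteq> {..<N} then monomial_coeff f (exponents A) else 0)"
    by (simp add: monomial_coeff_def)
qed

lemma Lambda_Q_zero: "0 \<in> Lambda_Q" by (simp add: Lambda_Q_def)

lemma Lambda_Q_add: "f \<in> Lambda_Q \<Longrightarrow> g \<in> Lambda_Q \<Longrightarrow> f + g \<in> Lambda_Q"
  using keys_add[of f g] by (auto simp: Lambda_Q_def)

lemma Lambda_Q_sum: "(\<And>i. i \<in> S \<Longrightarrow> f i \<in> Lambda_Q) \<Longrightarrow> (\<Sum>i\<in>S. f i) \<in> Lambda_Q"
  by (induction S rule: infinite_finite_induct) (auto simp: Lambda_Q_zero intro: Lambda_Q_add)

lemma Lambda_Q_single: "0 \<notin># \<mu> \<Longrightarrow> Poly_Mapping.single \<mu> c \<in> Lambda_Q"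
  by (simp add: Lambda_Q_def)

lemma Lambda_Q_single_mult: "0 \<notin># \<mu> \<Longrightarrow> f \<in> Lambda_Q \<Longrightarrow> Poly_Mapping.single \<mu> c * f \<in> Lambda_Q"
  using keys_mult[of "Poly_Mapping.single \<mu> c" f] by (fastforce simp: Lambda_Q_def split: if_splits)

lemma Lambda_Q_diff: "f \<in> Lambda_Q \<Longrightarrow> g \<in> Lambda_Q \<Longrightarrow> f - g \<in> Lambda_Q"
proof -
  assume "f \<in> Lambda_Q" "g \<in> Lambda_Q"
  moreover have "Poly_Mapping.keys (f - g) \<subseteq> Poly_Mapping.keys f \<union> Poly_Mapping.keys g"
    by (auto simp: in_keys_iff lookup_minus)
  ultimately show "f - g \<in> Lambda_Q" by (auto simp: Lambda_Q_def)
qed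

text \<open>
  Algebraic independence of the power sums: at a product of power sums with the largest possible number
  of factors, the coefficient of the difference can come from this product alone, by triangularity.
\<close>
lemma monomial_coeff_inj:
  assumes "f \<in> Lambda_Q" "g \<in> Lambda_Q" "\<And>e. 0 \<notin># e \<Longrightarrow> monomial_coeff f e = monomial_coeff g e"
  shows "f = g"
proof (rule ccontr)
  assume "f \<noteq> g"
  define h where "h = f - g"
  have h: "h \<in> Lambda_Q" unfolding h_def by (rule Lambda_Q_diff[OF assms(1,2)])
  have "h \<noteq> 0" using \<open>f \<noteq> g\<close> by (simp add: h_def)
  then have "Poly_Mapping.keys h \<noteq> {}" by simp
  define s where "s = Max (size ` Poly_Mapping.keys h)"
  have "s \<in> size ` Poly_Mapping.keys h" unfolding s_def using \<open>Poly_Mapping.keys h \<noteq> {}\<close> by (intro Max_in) auto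
  then obtain \<mu> where \<mu>: "\<mu> \<in> Poly_Mapping.keys h" "size \<mu> = s" by auto
  have s_max: "size \<kappa> \<le> s" if "\<kappa> \<in> Poly_Mapping.keys h" for \<kappa>
    unfolding s_def using that by (intro Max_ge) auto
  have "0 \<notin># \<mu>" using h \<mu> by (simp add: Lambda_Q_def)
  have "power_coeff \<kappa> \<mu> = 0" if "\<kappa> \<in> Poly_Mapping.keys h - {\<mu>}" for \<kappa>
    using power_coeff_triangular[of \<kappa> \<mu>] s_max[of \<kappa>] that \<mu> by fastforce
  then have "monomial_coeff h \<mu> = (\<Sum>\<kappa>\<in>{\<mu>}. Poly_Mapping.lookup h \<kappa> * power_coeff \<kappa> \<mu>)"
    unfolding monomial_coeff_def using \<mu> by (intro sum.mono_neutral_right) auto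
  then have "monomial_coeff h \<mu> \<noteq> 0"
    using \<mu> power_coeff_diagonal[of \<mu>] by (simp add: in_keys_iff)
  then show False using assms(3)[OF \<open>0 \<notin># \<mu>\<close>] by (simp add: h_def monomial_coeff_diff)
qed

lemma finite_exponents_of_sum: "finite {e. 0 \<notin># e \<and> sum_mset e = (n::nat)}"
proof (rule finite_subset)
  show "{e. 0 \<notin># e \<and> sum_mset e = n} \<subseteq> mset ` {xs. set xs \<subseteq> {..n} \<and> length xs \<le> n}"
  proof
    fix e assume e: "e \<in> {e. 0 \<notin># e \<and> sum_mset e = n}"
    obtain xs where xs: "e = mset xs" by (metis ex_mset)
    have "length ys \<le> sum_list ys" if "0 \<notin> set ys" for ys :: "nat list"
      using that by (induction ys) auto
    then have "length xs \<le> n" "set xs \<subseteq> {..n}"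
      using e by (auto simp: xs sum_mset_sum_list intro: member_le_sum_list)
    then show "e \<in> mset ` {xs. set xs \<subseteq> {..n} \<and> length xs \<le> n}" using xs by blast
  qed
qed (simp add: finite_lists_length_le)

text \<open>
  Existence of the monomial symmetric functions in \<open>\<Lambda>\<^sub>\<rat>\<close>: subtract from a product of power sums the
  terms with fewer exponents, which are available by induction, and divide by the diagonal coefficient.
\<close>
lemma monomial_symmetric_exists:
  assumes "0 \<notin># d"
  shows "\<exists>f\<in>Lambda_Q. \<forall>e. 0 \<notin># e \<longrightarrow> monomial_coeff f e = (if e = d then 1 else 0)"
  using assms
proof (induction "size d" arbitrary: d rule: less_induct)
  case less
  define S where "S = {e. 0 \<notin># e \<and> power_coeff d e \<noteq> 0 \<and> e \<noteq> d}"
  have finS: "finite S"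
    by (rule finite_subset[OF _ finite_exponents_of_sum[of "sum_mset d"]])
       (auto simp: S_def power_coeff_triangular(3))
  have "\<exists>f\<in>Lambda_Q. \<forall>e. 0 \<notin># e \<longrightarrow> monomial_coeff f e = (if e = d' then 1 else 0)" if "d' \<in> S" for d'
  proof (rule less.hyps)
    show "size d' < size d" using that power_coeff_triangular(1,2)[of d d'] by (fastforce simp: S_def)
    show "0 \<notin># d'" using that by (simp add: S_def)
  qed
  then obtain m where m: "\<And>d'. d' \<in> S \<Longrightarrow> m d' \<in> Lambda_Q"
    "\<And>d' e. d' \<in> S \<Longrightarrow> 0 \<notin># e \<Longrightarrow> monomial_coeff (m d') e = (if e = d' then 1 else 0)"
    by metis
  let ?g = "Poly_Mapping.single d 1 - (\<Sum>d'\<in>S. mpoly_const (power_coeff d d') * m d')"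
  let ?f = "mpoly_const (inverse (power_coeff d d)) * ?g"
  have "?f \<in> Lambda_Q"
    using less.prems m(1) by (intro Lambda_Q_single_mult Lambda_Q_diff Lambda_Q_sum Lambda_Q_single) auto
  moreover have "monomial_coeff ?f e = (if e = d then 1 else 0)" if e: "0 \<notin># e" for e
  proof -
    have "monomial_coeff ?g e = power_coeff d e - (\<Sum>d'\<in>S. if e = d' then power_coeff d d' else 0)"
      using m(2)[OF _ e] by (simp add: monomial_coeff_diff monomial_coeff_sum monomial_coeff_single
          monomial_coeff_const_mult if_distrib[of "\<lambda>x. _ * x"] cong: if_cong sum.cong)
    also have "(\<Sum>d'\<in>S. if e = d' then power_coeff d d' else 0) = (if e \<in> S then power_coeff d e else 0)"
      using finS by simp
    finally have "monomial_coeff ?g e = (if e = d then power_coeff d d else 0)"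
      using e by (auto simp: S_def)
    then show ?thesis using power_coeff_diagonal[of d] by (simp add: monomial_coeff_const_mult)
  qed
  ultimately show ?case by blast
qed

text \<open>
  The counterpart of \<open>monomial_coeff_inj\<close>: \<open>\<Lambda>\<^sub>\<rat>\<close> contains all symmetric functions.
\<close>
lemma symmetric_function_exists:
  assumes "finite {e. 0 \<notin># e \<and> \<phi> e \<noteq> 0}"
  shows "\<exists>f\<in>Lambda_Q. \<forall>e. 0 \<notin># e \<longrightarrow> monomial_coeff f e = \<phi> e"
proof -
  define S where "S = {e. 0 \<notin># e \<and> \<phi> e \<noteq> 0}"
  obtain m where m: "\<And>d. 0 \<notin># d \<Longrightarrow> m d \<in> Lambda_Q"
    "\<And>d e. 0 \<notin># d \<Longrightarrow> 0 \<notin># e \<Longrightarrow> monomial_coeff (m d) e = (if e = d then 1 else 0)"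
    using monomial_symmetric_exists by metis
  let ?f = "\<Sum>d\<in>S. mpoly_const (\<phi> d) * m d"
  have "?f \<in> Lambda_Q" using m(1) by (intro Lambda_Q_sum Lambda_Q_single_mult) (auto simp: S_def)
  moreover have "monomial_coeff ?f e = \<phi> e" if e: "0 \<notin># e" for e
  proof -
    have "monomial_coeff ?f e = (\<Sum>d\<in>S. if e = d then \<phi> d else 0)"
      unfolding monomial_coeff_sum using m(2)[OF _ e]
      by (intro sum.cong) (auto simp: monomial_coeff_const_mult S_def)
    then show ?thesis using e assms by (simp add: S_def)
  qed
  ultimately show ?thesis by blast
qed

section \<open>Schur functions and the matrix of the operator\<close>

lemma kostka_nonzero_size: "\<nu> \<in> shapes \<Longrightarrow> kostka cs \<nu> \<noteq> 0 \<Longrightarrow> sum_list cs = shape_size \<nu>"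
proof (induction cs arbitrary: \<nu>)
  case Nil
  then show ?case by (simp split: if_splits)
next
  case (Cons c cs)
  then obtain \<mu> where \<mu>: "\<mu> \<in> strips c \<nu>" "kostka cs \<mu> \<noteq> 0"
    by (metis kostka.simps(2) sum.neutral)
  then show ?case using Cons.IH[of \<mu>] strips_in_shapes[OF Cons.prems(1)] by (auto simp: strips_def)
qed

text \<open>
  The Kostka numbers give a coefficient function of finite support, hence an element of \<open>\<Lambda>\<^sub>\<rat>\<close>;
  it has the right restrictions, and it is the only element that has.
\<close>
lemma schur:
  assumes "sorted_wrt (\<ge>) \<nu>"
  shows "schur \<nu> \<in> Lambda_Q"
    and "0 \<notin># e \<Longrightarrow> monomial_coeff (schur \<nu>) e = of_nat (kostka_number e (shape_fun \<nu>))"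
proof -
  let ?\<phi> = "\<lambda>e. of_nat (kostka_number e (shape_fun \<nu>)) :: rat"
  have "{e. 0 \<notin># e \<and> ?\<phi> e \<noteq> 0} \<subseteq> {e. 0 \<notin># e \<and> sum_mset e = sum_list \<nu>}"
  proof safe
    fix e assume "?\<phi> e \<noteq> 0"
    then have "sum_list (sorted_list_of_multiset e) = sum_list \<nu>"
      using kostka_nonzero_size[OF shape_fun_in_shapes[OF assms]]
      by (simp add: kostka_number_def shape_size_shape_fun)
    then show "sum_mset e = sum_list \<nu>" by (metis mset_sorted_list_of_multiset sum_mset_sum_list)
  qed
  then have "finite {e. 0 \<notin># e \<and> ?\<phi> e \<noteq> 0}"
    by (rule finite_subset) (rule finite_exponents_of_sum)
  then obtain f where f: "f \<in> Lambda_Q" "\<And>e. 0 \<notin># e \<Longrightarrow> monomial_coeff f e = ?\<phi> e"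
    using symmetric_function_exists[of ?\<phi>] by blast
  have family: "symm_family ?\<phi> (\<lambda>N. schur_poly N \<nu>)"
    by (simp add: symm_family_def lookup_schur_poly[OF assms])
  have "schur \<nu> = f"
    unfolding schur_def
  proof (rule the_equality)
    have "restrict_vars N f = schur_poly N \<nu>" for N
    proof (rule poly_mapping_eqI)
      fix A
      show "Poly_Mapping.lookup (restrict_vars N f) A = Poly_Mapping.lookup (schur_poly N \<nu>) A"
        using symm_family_restrict_vars[OF f(1)] f(2)[OF zero_notin_exponents]
        by (simp add: symm_family_def lookup_schur_poly[OF assms])
    qed
    then show "f \<in> Lambda_Q \<and> (\<forall>N. restrict_vars N f = schur_poly N \<nu>)" using f(1) by blast
    fix g assume g: "g \<in> Lambda_Q \<and> (\<forall>N. restrict_vars N g = schur_poly N \<nu>)"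
    then have "symm_family (monomial_coeff g) (\<lambda>N. schur_poly N \<nu>)"
      using symm_family_restrict_vars[of g] by simp
    then show "g = f"
      using g f symm_family_unique[OF _ family] by (intro monomial_coeff_inj) auto
  qed
  then show "schur \<nu> \<in> Lambda_Q"
    "0 \<notin># e \<Longrightarrow> monomial_coeff (schur \<nu>) e = of_nat (kostka_number e (shape_fun \<nu>))"
    using f by auto
qed

lemma monomial_coeff_p1_mult:
  assumes "f \<in> Lambda_Q" "0 \<notin># e"
  shows "monomial_coeff (mpoly_var 1 * f) e = power_sum_step 1 (monomial_coeff f) e"
proof -
  let ?K = "Poly_Mapping.keys f"
  have "Poly_Mapping.keys (mpoly_var 1 * f) \<subseteq> add_mset 1 ` ?K"
    using keys_mult[of "mpoly_var 1" f] by auto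
  then have "monomial_coeff (mpoly_var 1 * f) e =
      (\<Sum>\<mu>\<in>add_mset 1 ` ?K. Poly_Mapping.lookup (mpoly_var 1 * f) \<mu> * power_coeff \<mu> e)"
    by (intro monomial_coeff_superset) auto
  also have "\<dots> = (\<Sum>\<mu>\<in>?K. Poly_Mapping.lookup f \<mu> * power_coeff (add_mset 1 \<mu>) e)"
    by (subst sum.reindex) (auto simp: inj_on_def lookup_single_mult)
  also have "\<dots> = (\<Sum>\<mu>\<in>?K. Poly_Mapping.lookup f \<mu> * power_sum_step 1 (power_coeff \<mu>) e)"
    using assms by (intro sum.cong) (auto simp: power_coeff_add_mset Lambda_Q_def)
  also have "\<dots> = power_sum_step 1 (monomial_coeff f) e"
    unfolding monomial_coeff_def[abs_def] by (rule power_sum_step_sum[symmetric]) simp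
  finally show ?thesis .
qed

text \<open>
  \<open>\<partial>/\<partial>p\<^sub>1\<close> is the extraction of the coefficient of \<open>z\<close> after a variable \<open>z\<close> has been adjoined, since
  this turns each \<open>p\<^sub>k\<close> into \<open>p\<^sub>k + z\<^sup>k\<close>.
\<close>
lemma power_coeff_add_one:
  assumes "0 \<notin># \<mu>" "0 \<notin># e"
  shows "power_coeff \<mu> (add_mset 1 e) = of_nat (count \<mu> 1) * power_coeff (\<mu> - {#1#}) e"
  using assms
proof (induction \<mu> arbitrary: e)
  case empty
  then show ?case by (simp add: power_coeff_def)
next
  case (add k \<mu>)
  then have k: "1 \<le> k" "0 \<notin># \<mu>" by auto
  let ?c = "of_nat (count \<mu> 1) :: rat"
  have "power_coeff (add_mset k \<mu>) (add_mset 1 e) = power_sum_step k (power_coeff \<mu>) (add_mset 1 e)"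
    using add.prems by (intro power_coeff_add_mset) auto
  also have "\<dots> = (if k = 1 then power_coeff \<mu> e else 0) +
      (\<Sum>j\<in>#e. if k \<le> j then power_coeff \<mu> (lower_part k j (add_mset 1 e)) else 0)"
    using k by (simp add: power_sum_step_def lower_part_def cong: if_cong)
  also have "(\<Sum>j\<in>#e. if k \<le> j then power_coeff \<mu> (lower_part k j (add_mset 1 e)) else 0) =
      (\<Sum>j\<in>#e. ?c * (if k \<le> j then power_coeff (\<mu> - {#1#}) (lower_part k j e) else 0))"
  proof (intro arg_cong[where f = sum_mset] image_mset_cong)
    fix j assume j: "j \<in># e"
    then have "lower_part k j (add_mset 1 e) = add_mset 1 (lower_part k j e)"
      by (auto simp: lower_part_def dest: multi_member_split)
    moreover have "0 \<notin># lower_part k j e" if "k \<le> j"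
      using add.prems that by (auto simp: lower_part_def dest: in_diffD)
    ultimately show "(if k \<le> j then power_coeff \<mu> (lower_part k j (add_mset 1 e)) else 0) =
        ?c * (if k \<le> j then power_coeff (\<mu> - {#1#}) (lower_part k j e) else 0)"
      using add.IH[OF k(2)] by simp
  qed
  also have "\<dots> = ?c * power_sum_step k (power_coeff (\<mu> - {#1#})) e"
    unfolding power_sum_step_def by (simp only: sum_mset_distrib_left)
  also have "\<dots> = ?c * power_coeff (add_mset k (\<mu> - {#1#})) e"
    using add.prems k by (subst power_coeff_add_mset) (auto dest: in_diffD)
  finally have *: "power_coeff (add_mset k \<mu>) (add_mset 1 e) = (if k = 1 then power_coeff \<mu> e else 0) +
    ?c * power_coeff (add_mset k (\<mu> - {#1#})) e" .
  show ?case
  proof (cases "1 \<in># \<mu>")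
    case True
    then show ?thesis unfolding * by (cases "k = 1") (auto simp: algebra_simps)
  next
    case False
    then have "count \<mu> 1 = 0" by (simp add: not_in_iff)
    then show ?thesis unfolding * by simp
  qed
qed

lemma monomial_coeff_deriv_p1:
  assumes "f \<in> Lambda_Q" "0 \<notin># e"
  shows "monomial_coeff (deriv_p1 f) e = monomial_coeff f (add_mset 1 e)"
proof -
  have "monomial_coeff (deriv_p1 f) e = (\<Sum>\<mu>\<in>Poly_Mapping.keys f.
      of_nat (count \<mu> 1) * Poly_Mapping.lookup f \<mu> * power_coeff (\<mu> - {#1#}) e)"
    by (simp add: deriv_p1_def monomial_coeff_sum monomial_coeff_single)
  also have "\<dots> = monomial_coeff f (add_mset 1 e)"
    unfolding monomial_coeff_def
    using assms by (intro sum.cong) (auto simp: power_coeff_add_one[unfolded One_nat_def] Lambda_Q_def)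
  finally show ?thesis .
qed

lemma T1_Lambda_Q: "f \<in> Lambda_Q \<Longrightarrow> T1 f \<in> Lambda_Q"
proof -
  assume "f \<in> Lambda_Q"
  then have *: "mpoly_var 1 * f \<in> Lambda_Q" by (intro Lambda_Q_single_mult) auto
  then show "T1 f \<in> Lambda_Q"
    unfolding T1_def deriv_p1_def
    by (intro Lambda_Q_sum Lambda_Q_single) (auto simp: Lambda_Q_def dest: in_diffD)
qed

text \<open>
  The Pieri rule \<open>sum_add_box_kostka\<close>, transferred from lists to multisets of positive exponents.
\<close>
lemma power_sum_step_kostka:
  assumes "\<nu> \<in> shapes" "0 \<notin># e"
  shows "power_sum_step 1 (\<lambda>e. of_nat (kostka_number e \<nu>)) e = of_nat (\<Sum>\<tau>\<in>add_box \<nu>. kostka_number e \<tau>)"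
proof -
  obtain cs where cs: "e = mset cs" by (metis ex_mset)
  have "power_sum_step 1 (\<lambda>e. of_nat (kostka_number e \<nu>)) e =
      (\<Sum>i<length cs. if 1 \<le> cs ! i then of_nat (kostka_number (lower_part 1 (cs ! i) e) \<nu>) else 0)"
    by (simp add: power_sum_step_def cs sum_mset_sum_list mset_map[symmetric] sum_list_sum_nth
        atLeast0LessThan cong: if_cong del: mset_map)
  also have "\<dots> = (\<Sum>i | i < length cs \<and> 0 < cs ! i. of_nat (kostka (cs[i := cs ! i - 1]) \<nu>))"
  proof (rule sum.mono_neutral_cong_right)
    fix i assume i: "i \<in> {i. i < length cs \<and> 0 < cs ! i}"
    let ?x = "cs ! i - 1"
    have "mset (filter (\<lambda>c. c \<noteq> 0) (cs[i := ?x])) = filter_mset (\<lambda>c. c \<noteq> 0) (add_mset ?x (e - {#cs ! i#}))"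
      using i by (simp add: mset_update cs)
    also have "\<dots> = lower_part 1 (cs ! i) e"
    proof -
      have "filter_mset (\<lambda>c. c \<noteq> 0) (e - {#cs ! i#}) = e - {#cs ! i#}"
        using assms(2) by (intro multiset_eqI) (auto simp: not_in_iff)
      then show ?thesis using i by (auto simp: lower_part_def)
    qed
    finally have "kostka_number (lower_part 1 (cs ! i) e) \<nu> = kostka (filter (\<lambda>c. c \<noteq> 0) (cs[i := ?x])) \<nu>"
      using kostka_number_mset[OF assms(1)] by metis
    then have "kostka_number (lower_part 1 (cs ! i) e) \<nu> = kostka (cs[i := ?x]) \<nu>"
      by (simp only: kostka_filter[OF assms(1)])
    then show "(if 1 \<le> cs ! i then of_nat (kostka_number (lower_part 1 (cs ! i) e) \<nu>) else 0) =
        (of_nat (kostka (cs[i := ?x]) \<nu>) :: rat)" using i by simp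
  qed auto
  also have "\<dots> = of_nat (\<Sum>\<tau>\<in>add_box \<nu>. kostka cs \<tau>)"
    by (simp add: sum_add_box_kostka[OF assms(1)])
  also have "(\<Sum>\<tau>\<in>add_box \<nu>. kostka cs \<tau>) = (\<Sum>\<tau>\<in>add_box \<nu>. kostka_number e \<tau>)"
    by (intro sum.cong) (simp_all add: cs kostka_number_mset add_box_in_shapes)
  finally show ?thesis .
qed

text \<open>
  A horizontal strip of size one is a single box.
\<close>
lemma kostka_number_add_one:
  assumes "\<tau> \<in> shapes"
  shows "kostka_number (add_mset 1 e) \<tau> = (\<Sum>\<mu>\<in>remove_box \<tau>. kostka_number e \<mu>)"
proof -
  obtain cs where cs: "e = mset cs" by (metis ex_mset)
  have "kostka_number (add_mset 1 e) \<tau> = kostka (1 # cs) \<tau>"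
    using kostka_number_mset[OF assms, of "1 # cs"] by (simp add: cs)
  also have "\<dots> = (\<Sum>\<mu>\<in>remove_box \<tau>. kostka cs \<mu>)" by (rule kostka_Cons_1[OF assms])
  also have "\<dots> = (\<Sum>\<mu>\<in>remove_box \<tau>. kostka_number e \<mu>)"
    by (intro sum.cong) (auto simp: cs kostka_number_mset remove_box_def)
  finally show ?thesis .
qed

lemma monomial_coeff_T1_schur:
  assumes \<nu>: "\<nu> \<in> partitions n" and e: "0 \<notin># e"
  shows "monomial_coeff (T1 (schur \<nu>)) e =
    (\<Sum>\<mu>\<in>shapes_of n. of_nat (card (add_box \<mu> \<inter> add_box (shape_fun \<nu>))) * of_nat (kostka_number e \<mu>))"
proof -
  let ?f = "shape_fun \<nu>"
  have sorted: "sorted_wrt (\<ge>) \<nu>" using \<nu> by (simp add: partitions_def)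
  have f: "?f \<in> shapes_of n" using bij_betw_shape_fun[of n] \<nu> by (auto simp: bij_betw_def)
  then have f_par: "?f \<in> shapes" by (simp add: shapes_of_def)
  have "monomial_coeff (T1 (schur \<nu>)) e = monomial_coeff (mpoly_var 1 * schur \<nu>) (add_mset 1 e)"
    unfolding T1_def using schur(1)[OF sorted] e
    by (intro monomial_coeff_deriv_p1 Lambda_Q_single_mult) auto
  also have "\<dots> = power_sum_step 1 (monomial_coeff (schur \<nu>)) (add_mset 1 e)"
    using schur(1)[OF sorted] e by (intro monomial_coeff_p1_mult) auto
  also have "\<dots> = power_sum_step 1 (\<lambda>e. of_nat (kostka_number e ?f)) (add_mset 1 e)"
    unfolding power_sum_step_def
  proof (intro arg_cong[where f = sum_mset] image_mset_cong)
    fix j assume "j \<in># add_mset 1 e"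
    have "0 \<notin># lower_part 1 j (add_mset 1 e)" if "1 \<le> j"
      using e that by (auto simp: lower_part_def dest: in_diffD split: if_splits)
    then show "(if 1 \<le> j then monomial_coeff (schur \<nu>) (lower_part 1 j (add_mset 1 e)) else 0) =
        (if 1 \<le> j then of_nat (kostka_number (lower_part 1 j (add_mset 1 e)) ?f) else 0)"
      using schur(2)[OF sorted] by simp
  qed
  also have "\<dots> = of_nat (\<Sum>\<tau>\<in>add_box ?f. kostka_number (add_mset 1 e) \<tau>)"
    using e by (intro power_sum_step_kostka f_par) auto
  also have "(\<Sum>\<tau>\<in>add_box ?f. kostka_number (add_mset 1 e) \<tau>) = (\<Sum>\<tau>\<in>add_box ?f. \<Sum>\<mu>\<in>remove_box \<tau>. kostka_number e \<mu>)"
    by (intro sum.cong refl kostka_number_add_one add_box_in_shapes)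
  also have "\<dots> = (\<Sum>\<tau>\<in>add_box ?f. \<Sum>\<mu>\<in>shapes_of n. if \<tau> \<in> add_box \<mu> then kostka_number e \<mu> else 0)"
  proof (rule sum.cong[OF refl])
    fix \<tau> assume \<tau>: "\<tau> \<in> add_box ?f"
    have "remove_box \<tau> = {\<mu> \<in> shapes_of n. \<tau> \<in> add_box \<mu>}"
      using shape_size_add_box[OF f_par \<tau>] shape_size_add_box f by (auto simp: remove_box_def shapes_of_def)
    then show "(\<Sum>\<mu>\<in>remove_box \<tau>. kostka_number e \<mu>) = (\<Sum>\<mu>\<in>shapes_of n. if \<tau> \<in> add_box \<mu> then kostka_number e \<mu> else 0)"
      by (simp add: sum.inter_filter finite_shapes_of)
  qed
  also have "\<dots> = (\<Sum>\<mu>\<in>shapes_of n. card (add_box \<mu> \<inter> add_box ?f) * kostka_number e \<mu>)"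
    by (subst sum.swap, intro sum.cong)
       (auto simp: finite_add_box[OF f_par] sum.inter_filter[symmetric] Int_def conj_commute)
  finally show ?thesis by simp
qed

definition part_fun :: "nat \<Rightarrow> nat \<Rightarrow> nat \<Rightarrow> nat" where
  "part_fun n i = shape_fun (nth_partition n i)"

lemma bij_betw_nth_partition: "bij_betw (nth_partition n) {..<num_partitions n} (partitions n)"
  unfolding nth_partition_def num_partitions_def
  using bij_betw_nth[of "sorted_list_of_set (partitions n)" "{..<card (partitions n)}" "partitions n"]
  by (simp add: finite_partitions)

lemma bij_betw_part_fun: "bij_betw (part_fun n) {..<num_partitions n} (shapes_of n)"
  using bij_betw_trans[OF bij_betw_nth_partition bij_betw_shape_fun[of n]]
  by (simp add: part_fun_def[abs_def] o_def)

lemma monomial_coeff_schur_combination: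
  assumes "0 \<notin># e"
  shows "monomial_coeff (\<Sum>i<num_partitions n. mpoly_const (c i) * schur (nth_partition n i)) e =
    (\<Sum>i<num_partitions n. c i * of_nat (kostka_number e (part_fun n i)))"
proof -
  have "sorted_wrt (\<ge>) (nth_partition n i)" if "i < num_partitions n" for i
    using bij_betwE[OF bij_betw_nth_partition[of n]] that by (auto simp: partitions_def)
  then show ?thesis
    using assms by (simp add: monomial_coeff_sum monomial_coeff_const_mult schur(2) part_fun_def)
qed

text \<open>
  The two box rules compute \<open>T1\<close> on Schur functions, and linear independence makes the matrix unique.
\<close>
lemma M1_eq:
  "M1 n = mat (num_partitions n) (num_partitions n)
    (\<lambda>(i, j). int (card (add_box (part_fun n i) \<inter> add_box (part_fun n j))))"
    (is "_ = ?A")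
  unfolding M1_def
proof (rule the_equality)
  let ?p = "num_partitions n"
  have part: "nth_partition n i \<in> partitions n" if "i < ?p" for i
    using bij_betwE[OF bij_betw_nth_partition[of n]] that by auto
  then have sorted: "sorted_wrt (\<ge>) (nth_partition n i)" if "i < ?p" for i
    using that by (simp add: partitions_def)
  have comb_Lambda: "(\<Sum>i<?p. mpoly_const (c i) * schur (nth_partition n i)) \<in> Lambda_Q" for c
    using schur(1)[OF sorted] by (intro Lambda_Q_sum Lambda_Q_single_mult) auto
  show A: "is_int_matrix_of T1 ?p (\<lambda>i. schur (nth_partition n i)) ?A"
    unfolding is_int_matrix_of_def
  proof (intro conjI allI impI)
    fix j assume j: "j < ?p"
    show "T1 (schur (nth_partition n j)) =
        (\<Sum>i<?p. mpoly_const (of_int (?A $$ (i, j))) * schur (nth_partition n i))"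
    proof (rule monomial_coeff_inj)
      show "T1 (schur (nth_partition n j)) \<in> Lambda_Q" by (intro T1_Lambda_Q schur sorted j)
      fix e :: "nat multiset" assume e: "0 \<notin># e"
      have "monomial_coeff (T1 (schur (nth_partition n j))) e =
          (\<Sum>\<mu>\<in>shapes_of n. of_nat (card (add_box \<mu> \<inter> add_box (part_fun n j))) * of_nat (kostka_number e \<mu>))"
        using monomial_coeff_T1_schur[OF part[OF j] e] by (simp add: part_fun_def)
      also have "\<dots> = (\<Sum>i<?p. of_nat (card (add_box (part_fun n i) \<inter> add_box (part_fun n j))) *
          of_nat (kostka_number e (part_fun n i)))"
        by (rule sum.reindex_bij_betw[OF bij_betw_part_fun, symmetric])
      also have "\<dots> = monomial_coeff (\<Sum>i<?p. mpoly_const (of_int (?A $$ (i, j))) * schur (nth_partition n i)) e"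
        unfolding monomial_coeff_schur_combination[OF e] using j by (intro sum.cong) auto
      finally show "monomial_coeff (T1 (schur (nth_partition n j))) e =
        monomial_coeff (\<Sum>i<?p. mpoly_const (of_int (?A $$ (i, j))) * schur (nth_partition n i)) e" .
    qed (rule comb_Lambda)
  qed simp
  fix B assume B: "is_int_matrix_of T1 ?p (\<lambda>i. schur (nth_partition n i)) B"
  show "B = ?A"
  proof (rule eq_matI)
    fix i j assume "i < dim_row ?A" "j < dim_col ?A"
    then have ij: "i < ?p" "j < ?p" by auto
    define d where "d i = (of_int (B $$ (i, j)) - of_int (?A $$ (i, j)) :: rat)" for i
    have comb: "(\<Sum>i<?p. of_int (B $$ (i, j)) * of_nat (kostka_number e (part_fun n i))) =
        (\<Sum>i<?p. of_int (?A $$ (i, j)) * (of_nat (kostka_number e (part_fun n i)) :: rat))"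
      if "0 \<notin># e" for e
    proof -
      have "(\<Sum>i<?p. mpoly_const (of_int (B $$ (i, j))) * schur (nth_partition n i)) =
          (\<Sum>i<?p. mpoly_const (of_int (?A $$ (i, j))) * schur (nth_partition n i))"
        using A B ij(2) unfolding is_int_matrix_of_def by simp
      from arg_cong[OF this, of "\<lambda>f. monomial_coeff f e"] show ?thesis
        unfolding monomial_coeff_schur_combination[OF that] .
    qed
    let ?g = "inv_into {..<?p} (part_fun n)"
    have "d (?g (part_fun n i)) = 0"
    proof (rule kostka_linear_independent[where c = "\<lambda>\<nu>. d (?g \<nu>)" and n = n])
      show "part_fun n i \<in> shapes_of n" using bij_betwE[OF bij_betw_part_fun[of n]] ij by auto
      fix cs :: "nat list"
      let ?e = "mset (filter (\<lambda>c. c \<noteq> 0) cs)"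
      have shapes_i: "part_fun n i \<in> shapes" if "i < ?p" for i
        using bij_betwE[OF bij_betw_part_fun[of n]] that by (auto simp: shapes_of_def)
      have number: "kostka_number ?e (part_fun n i) = kostka cs (part_fun n i)" if "i < ?p" for i
        using shapes_i[OF that] by (simp only: kostka_number_mset kostka_filter)
      have "(\<Sum>\<nu>\<in>shapes_of n. d (?g \<nu>) * of_nat (kostka cs \<nu>)) =
          (\<Sum>i<?p. d (?g (part_fun n i)) * of_nat (kostka cs (part_fun n i)))"
        by (rule sum.reindex_bij_betw[OF bij_betw_part_fun, symmetric])
      also have "\<dots> = (\<Sum>i<?p. d i * of_nat (kostka_number ?e (part_fun n i)))"
        using bij_betw_inv_into_left[OF bij_betw_part_fun[of n]] number
        by (intro sum.cong) (auto simp del: mset_filter)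
      also have "\<dots> = 0"
        using comb[of ?e] by (simp add: d_def left_diff_distrib sum_subtractf del: index_mat)
      finally show "(\<Sum>\<nu>\<in>shapes_of n. d (?g \<nu>) * of_nat (kostka cs \<nu>)) = 0" .
    qed
    then have "d i = 0" using bij_betw_inv_into_left[OF bij_betw_part_fun[of n]] ij by simp
    then show "B $$ (i, j) = ?A $$ (i, j)" by (simp add: d_def del: index_mat)
  qed (use B in \<open>auto simp: is_int_matrix_of_def\<close>)
qed

section \<open>Smith normal form from chained levels\<close>

context Modules.module begin

text \<open>
  Elimination for a triangular system whose consecutive levels are linked by unit coefficients.  Write
  \<open>\<alpha>\<^sub>k\<close> for the product of the first \<open>k\<close> scalars.
  
  Modulo the images \<open>L (b (\<phi> \<nu>))\<close>, the relation given by \<open>\<phi> \<nu>\<close> expresses \<open>b \<nu>\<close> by vectors of larger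
  rank, so finally everything is expressed by the vectors of level one.  In doing so each step down by a
  level contributes the scalar of the lower level: a vector \<open>b \<nu>\<close> of level \<open>k\<close> becomes \<open>\<alpha>\<^sub>k\<^sub>-\<^sub>1\<close> times a
  vector \<open>z \<nu>\<close>.  The image \<open>L (b \<mu>)\<close> of a vector of level \<open>k\<close> therefore becomes \<open>\<alpha>\<^sub>k\<close> times a vector
  whose leading term is \<open>z \<mu>\<close>, with other terms of higher level.  Descending through the levels,
  one sees that these vectors, which are zero for \<open>\<mu> = \<phi> \<nu>\<close>, generate all the \<open>z \<mu>\<close>.  So the diagonal
  entries are \<open>\<alpha>\<^sub>k\<close> for the \<open>\<mu>\<close> outside the range of \<open>\<phi>\<close> and \<open>1\<close> for the others.
\<close>
theorem smith_of_chained_levels: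
  fixes J :: "'j set" and lev rank :: "'j \<Rightarrow> nat" and a :: "nat \<Rightarrow> 'a" and c :: "'j \<Rightarrow> 'j \<Rightarrow> 'a"
    and b :: "'j \<Rightarrow> 'b" and \<phi> :: "'j \<Rightarrow> 'j" and L :: "'b \<Rightarrow> 'b"
  defines "A \<equiv> {\<nu>\<in>J. 2 \<le> lev \<nu>}"
  assumes hom: "Modules.module_hom scale scale L"
    and fin: "finite J"
    and L_b: "\<And>\<mu>. \<mu> \<in> J \<Longrightarrow>
      L (b \<mu>) = a (lev \<mu>) *s b \<mu> + (\<Sum>\<kappa> | \<kappa> \<in> J \<and> lev \<mu> < lev \<kappa>. c \<kappa> \<mu> *s b \<kappa>)"
    and lev_pos: "\<And>\<mu>. \<mu> \<in> J \<Longrightarrow> 1 \<le> lev \<mu>"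
    and \<phi>_in: "\<And>\<nu>. \<nu> \<in> A \<Longrightarrow> \<phi> \<nu> \<in> J"
    and lev_\<phi>: "\<And>\<nu>. \<nu> \<in> A \<Longrightarrow> Suc (lev (\<phi> \<nu>)) = lev \<nu>"
    and rank_\<phi>: "\<And>\<nu>. \<nu> \<in> A \<Longrightarrow> rank \<nu> < rank (\<phi> \<nu>)"
    and pivot: "\<And>\<nu>. \<nu> \<in> A \<Longrightarrow> c \<nu> (\<phi> \<nu>) = 1"
    and above_pivot: "\<And>\<nu> \<kappa>. \<nu> \<in> A \<Longrightarrow> \<kappa> \<in> J \<Longrightarrow> lev \<nu> \<le> lev \<kappa> \<Longrightarrow> \<kappa> \<noteq> \<nu> \<Longrightarrow>
      c \<kappa> (\<phi> \<nu>) \<noteq> 0 \<Longrightarrow> rank \<nu> < rank \<kappa>"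
  obtains p q where
    "\<And>\<mu>. \<mu> \<in> J \<Longrightarrow> L (q \<mu>) = (if \<mu> \<in> \<phi> ` A then 1 else \<Prod>i = 1..lev \<mu>. a i) *s p \<mu>"
    "b ` J \<subseteq> span (p ` J)" "b ` J \<subseteq> span (q ` J)"
proof -
  interpret L: Modules.module_hom scale scale L by (fact hom)
  define \<alpha> where "\<alpha> k = (\<Prod>i = 1..k. a i)" for k
  define w where "w \<kappa> \<mu> = (\<Prod>i \<in> {lev \<mu><..<lev \<kappa>}. a i)" for \<kappa> \<mu>
  have \<alpha>_split: "\<alpha> (lev \<kappa> - 1) = \<alpha> (lev \<mu>) * w \<kappa> \<mu>" if "lev \<mu> < lev \<kappa>" for \<kappa> \<mu>
  proof -
    have "{1..lev \<kappa> - 1} = {1..lev \<mu>} \<union> {lev \<mu><..<lev \<kappa>}"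
      using that by auto
    then show ?thesis
      unfolding \<alpha>_def w_def by (subst prod.union_disjoint[symmetric]) auto
  qed
  have \<alpha>_lev: "\<alpha> (lev \<mu>) = \<alpha> (lev \<mu> - 1) * a (lev \<mu>)" if "\<mu> \<in> J" for \<mu>
    using lev_pos[OF that] unfolding \<alpha>_def by (cases "lev \<mu>") auto
  \<comment> \<open>Recursion from larger to smaller rank; the bound makes the relation well-founded.\<close>
  define R where "R = inv_image {(m, n). n < m \<and> m \<le> Max (rank ` J)} rank"
  have "{(m::nat, n). n < m \<and> m \<le> N} \<subseteq> measure (\<lambda>m. N - m)" for N
    by auto
  then have wf: "wf R" unfolding R_def by (meson wf_inv_image wf_measure wf_subset)
  have R_I: "(\<kappa>, \<nu>) \<in> R" if "\<kappa> \<in> J" "rank \<nu> < rank \<kappa>" for \<kappa> \<nu>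
    using that fin unfolding R_def by simp
  \<comment> \<open>The requirement that \<open>L (b (\<phi> \<nu>))\<close> becomes zero, divided by \<open>\<alpha> (lev (\<phi> \<nu>))\<close> and solved for \<open>z \<nu>\<close>.
    The test for a vanishing coefficient keeps the recursive calls to larger rank.\<close>
  define z where "z = wfrec R (\<lambda>z \<nu>. if \<nu> \<in> A then
      - (z (\<phi> \<nu>) + (\<Sum>\<kappa> | \<kappa> \<in> J \<and> lev \<nu> \<le> lev \<kappa> \<and> \<kappa> \<noteq> \<nu>.
           (if c \<kappa> (\<phi> \<nu>) = 0 then 0 else (c \<kappa> (\<phi> \<nu>) * w \<kappa> (\<phi> \<nu>)) *s z \<kappa>))) else b \<nu>)"
  have z_A: "z \<nu> = - (z (\<phi> \<nu>) + (\<Sum>\<kappa> | \<kappa> \<in> J \<and> lev \<nu> \<le> lev \<kappa> \<and> \<kappa> \<noteq> \<nu>.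
      (c \<kappa> (\<phi> \<nu>) * w \<kappa> (\<phi> \<nu>)) *s z \<kappa>))" if "\<nu> \<in> A" for \<nu>
  proof -
    have "cut z R \<nu> (\<phi> \<nu>) = z (\<phi> \<nu>)"
      by (intro cut_apply R_I) (use that \<phi>_in rank_\<phi> in auto)
    moreover have "(if c \<kappa> (\<phi> \<nu>) = 0 then 0 else (c \<kappa> (\<phi> \<nu>) * w \<kappa> (\<phi> \<nu>)) *s cut z R \<nu> \<kappa>)
        = (c \<kappa> (\<phi> \<nu>) * w \<kappa> (\<phi> \<nu>)) *s z \<kappa>" if "\<kappa> \<in> J" "lev \<nu> \<le> lev \<kappa>" "\<kappa> \<noteq> \<nu>" for \<kappa>
      using above_pivot[OF \<open>\<nu> \<in> A\<close> that] R_I[OF that(1)] by (auto simp: cut_apply)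
    ultimately show ?thesis
      unfolding z_def by (subst wfrec[OF wf]) (simp add: that z_def[symmetric])
  qed
  have z_B: "z \<nu> = b \<nu>" if "\<nu> \<notin> A" for \<nu>
    unfolding z_def by (subst wfrec[OF wf]) (simp add: that)
  define W where "W = span (b ` \<phi> ` A)"
  define p where "p \<mu> = (if \<mu> \<in> \<phi> ` A then L (b \<mu>) else
    z \<mu> + (\<Sum>\<kappa> | \<kappa> \<in> J \<and> lev \<mu> < lev \<kappa>. (c \<kappa> \<mu> * w \<kappa> \<mu>) *s z \<kappa>))" for \<mu>
  have LW: "L ` W = span (L ` b ` \<phi> ` A)"
    unfolding W_def by (simp add: L.span_image)
  \<comment> \<open>\<open>b \<nu>\<close> and \<open>\<alpha> (lev \<nu> - 1) *s z \<nu>\<close> agree modulo the images of the pivots.\<close>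
  have b_z: "b \<nu> - \<alpha> (lev \<nu> - 1) *s z \<nu> \<in> L ` W" if "\<nu> \<in> J" for \<nu>
    using wf that
  proof (induction \<nu> rule: wf_induct_rule)
    case (less \<nu>)
    show ?case
    proof (cases "\<nu> \<in> A")
      case False
      then have "lev \<nu> = 1" using less.prems lev_pos[of \<nu>] by (auto simp: A_def)
      then show ?thesis using False by (auto simp: z_B \<alpha>_def LW span_zero)
    next
      case True
      let ?\<mu> = "\<phi> \<nu>" and ?K = "{\<kappa> \<in> J. lev \<nu> \<le> lev \<kappa> \<and> \<kappa> \<noteq> \<nu>}"
      have lev: "lev \<nu> - 1 = lev ?\<mu>" using lev_\<phi>[OF True] by simp
      have \<mu>J: "?\<mu> \<in> J" using True by (rule \<phi>_in)
      define d where "d \<kappa> = b \<kappa> - \<alpha> (lev \<kappa> - 1) *s z \<kappa>" for \<kappa>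
      have K: "{\<kappa> \<in> J. lev ?\<mu> < lev \<kappa>} = insert \<nu> ?K"
        using less.prems lev_\<phi>[OF True] by auto
      have "L (b ?\<mu>) = a (lev ?\<mu>) *s b ?\<mu> + b \<nu> + (\<Sum>\<kappa>\<in>?K. c \<kappa> ?\<mu> *s b \<kappa>)"
        unfolding L_b[OF \<mu>J] K using fin by (simp add: pivot[OF True])
      moreover have "\<alpha> (lev \<nu> - 1) *s z \<nu> =
          - (\<alpha> (lev ?\<mu>) *s z ?\<mu> + (\<Sum>\<kappa>\<in>?K. (\<alpha> (lev ?\<mu>) * c \<kappa> ?\<mu> * w \<kappa> ?\<mu>) *s z \<kappa>))"
        unfolding lev z_A[OF True]
        by (simp add: scale_right_distrib scale_sum_right mult.assoc del: minus_add_distrib)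
      moreover have "\<alpha> (lev ?\<mu>) *s z ?\<mu> = a (lev ?\<mu>) *s \<alpha> (lev ?\<mu> - 1) *s z ?\<mu>"
        by (simp add: \<alpha>_lev[OF \<mu>J] mult.commute)
      moreover have "(\<alpha> (lev ?\<mu>) * c \<kappa> ?\<mu> * w \<kappa> ?\<mu>) *s z \<kappa> =
          c \<kappa> ?\<mu> *s \<alpha> (lev \<kappa> - 1) *s z \<kappa>" if "\<kappa> \<in> ?K" for \<kappa>
        using \<alpha>_split[of ?\<mu> \<kappa>] that lev_\<phi>[OF True] by (simp add: mult_ac)
      ultimately have eq: "d \<nu> = L (b ?\<mu>) - (a (lev ?\<mu>) *s d ?\<mu> + (\<Sum>\<kappa>\<in>?K. c \<kappa> ?\<mu> *s d \<kappa>))"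
        by (simp add: d_def scale_right_diff_distrib sum_subtractf)
      have "d ?\<mu> \<in> L ` W"
        unfolding d_def using True \<mu>J less.IH R_I rank_\<phi> by blast
      moreover have "c \<kappa> ?\<mu> *s d \<kappa> \<in> L ` W" if "\<kappa> \<in> ?K" for \<kappa>
      proof (cases "c \<kappa> ?\<mu> = 0")
        case False
        then have "d \<kappa> \<in> L ` W"
          using above_pivot[OF True, of \<kappa>] that unfolding d_def by (intro less.IH R_I) auto
        then show ?thesis unfolding LW by (rule span_scale)
      qed (simp add: LW span_zero)
      moreover have "L (b ?\<mu>) \<in> L ` W"
        unfolding LW using True by (intro span_base) auto
      ultimately show ?thesis
        unfolding LW d_def[symmetric] eq
        by (intro span_diff span_add span_sum) (auto intro: span_scale)
    qed
  qed
  have "\<exists>x\<in>W. L (b \<mu> - x) = \<alpha> (lev \<mu>) *s p \<mu>" if "\<mu> \<in> J" "\<mu> \<notin> \<phi> ` A" for \<mu>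
  proof -
    let ?K = "{\<kappa> \<in> J. lev \<mu> < lev \<kappa>}"
    have "\<alpha> (lev \<mu>) *s p \<mu> = a (lev \<mu>) *s \<alpha> (lev \<mu> - 1) *s z \<mu> +
        (\<Sum>\<kappa>\<in>?K. (\<alpha> (lev \<mu>) * c \<kappa> \<mu> * w \<kappa> \<mu>) *s z \<kappa>)"
      using that by (simp add: p_def scale_right_distrib scale_sum_right mult_ac \<alpha>_lev)
    moreover have "(\<alpha> (lev \<mu>) * c \<kappa> \<mu> * w \<kappa> \<mu>) *s z \<kappa> = c \<kappa> \<mu> *s \<alpha> (lev \<kappa> - 1) *s z \<kappa>"
      if "\<kappa> \<in> ?K" for \<kappa>
      using \<alpha>_split[of \<mu> \<kappa>] that by (simp add: mult_ac)
    ultimately have "L (b \<mu>) - \<alpha> (lev \<mu>) *s p \<mu> = a (lev \<mu>) *s (b \<mu> - \<alpha> (lev \<mu> - 1) *s z \<mu>) +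
        (\<Sum>\<kappa>\<in>?K. c \<kappa> \<mu> *s (b \<kappa> - \<alpha> (lev \<kappa> - 1) *s z \<kappa>))"
      using that by (simp add: L_b scale_right_diff_distrib sum_subtractf)
    also have "\<dots> \<in> L ` W"
      using b_z that unfolding LW by (intro span_add span_scale span_sum) auto
    finally obtain x where "x \<in> W" "L (b \<mu>) - \<alpha> (lev \<mu>) *s p \<mu> = L x" by blast
    then show ?thesis by (intro bexI[of _ x]) (auto simp: L.diff algebra_simps)
  qed
  then obtain x where x: "\<And>\<mu>. \<mu> \<in> J \<Longrightarrow> \<mu> \<notin> \<phi> ` A \<Longrightarrow> x \<mu> \<in> W \<and> L (b \<mu> - x \<mu>) = \<alpha> (lev \<mu>) *s p \<mu>"
    by metis
  define q where "q \<mu> = (if \<mu> \<in> \<phi> ` A then b \<mu> else b \<mu> - x \<mu>)" for \<mu>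
  show thesis
  proof
    show "L (q \<mu>) = (if \<mu> \<in> \<phi> ` A then 1 else \<Prod>i = 1..lev \<mu>. a i) *s p \<mu>" if "\<mu> \<in> J" for \<mu>
      using x[OF that] by (auto simp: q_def p_def \<alpha>_def)
    have W_q: "W \<subseteq> span (q ` J)"
      unfolding W_def using \<phi>_in by (intro span_minimal) (auto intro!: span_base simp: q_def image_iff)
    show "b ` J \<subseteq> span (q ` J)"
    proof (rule image_subsetI)
      fix \<mu> assume 1: "\<mu> \<in> J"
      show "b \<mu> \<in> span (q ` J)"
      proof (cases "\<mu> \<in> \<phi> ` A")
        case True
        then have "b \<mu> \<in> W" unfolding W_def by (intro span_base) auto
        then show ?thesis using W_q by auto
      next
        case False
        then have "b \<mu> = q \<mu> + x \<mu>" by (simp add: q_def)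
        then show ?thesis using x[OF 1 False] W_q 1 by (auto intro: span_add span_base)
      qed
    qed
    define h where "h = Max (lev ` J)"
    \<comment> \<open>Descending induction on the level: \<open>p \<mu>\<close>, or zero if \<open>\<mu>\<close> is a pivot, has leading term \<open>z \<mu>\<close>.\<close>
    have z_p: "z \<mu> \<in> span (p ` J)" if "\<mu> \<in> J" for \<mu>
      using that
    proof (induction "h - lev \<mu>" arbitrary: \<mu> rule: less_induct)
      case less
      have IH: "z \<kappa> \<in> span (p ` J)" if "\<kappa> \<in> J" "lev \<mu> < lev \<kappa>" for \<kappa>
      proof -
        have "lev \<kappa> \<le> h" using that fin by (simp add: h_def)
        then show ?thesis using less.hyps[of \<kappa>] that by simp
      qed
      show ?case
      proof (cases "\<mu> \<in> \<phi> ` A")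
        case True
        then obtain \<nu> where \<nu>: "\<nu> \<in> A" "\<mu> = \<phi> \<nu>" by blast
        have "z \<mu> = - (z \<nu> + (\<Sum>\<kappa> | \<kappa> \<in> J \<and> lev \<nu> \<le> lev \<kappa> \<and> \<kappa> \<noteq> \<nu>.
            (c \<kappa> (\<phi> \<nu>) * w \<kappa> (\<phi> \<nu>)) *s z \<kappa>))"
          by (simp add: z_A[OF \<nu>(1)] \<nu>(2))
        also have "\<dots> \<in> span (p ` J)"
          using \<nu> lev_\<phi>[OF \<nu>(1)] by (intro span_neg span_add span_sum span_scale IH) (auto simp: A_def)
        finally show ?thesis .
      next
        case False
        have "z \<mu> = p \<mu> - (\<Sum>\<kappa> | \<kappa> \<in> J \<and> lev \<mu> < lev \<kappa>. (c \<kappa> \<mu> * w \<kappa> \<mu>) *s z \<kappa>)"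
          using False by (simp add: p_def)
        also have "\<dots> \<in> span (p ` J)"
          using less.prems by (intro span_diff span_sum span_scale IH) (auto intro: span_base)
        finally show ?thesis .
      qed
    qed
    have W_p: "L ` W \<subseteq> span (p ` J)"
      unfolding LW using \<phi>_in by (intro span_minimal) (auto intro!: span_base simp: p_def image_iff)
    show "b ` J \<subseteq> span (p ` J)"
    proof (rule image_subsetI)
      fix \<mu> assume 1: "\<mu> \<in> J"
      have "b \<mu> = (b \<mu> - \<alpha> (lev \<mu> - 1) *s z \<mu>) + \<alpha> (lev \<mu> - 1) *s z \<mu>" by simp
      then show "b \<mu> \<in> span (p ` J)" using 1 b_z z_p W_p by (metis span_add span_scale subset_iff)
    qed
  qed
qed

end

section \<open>The up and down operators of the Young lattice\<close>

definition fscale :: "'a::comm_ring_1 \<Rightarrow> ('x \<Rightarrow> 'a) \<Rightarrow> 'x \<Rightarrow> 'a" where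
  "fscale c f = (\<lambda>x. c * f x)"

lemma fscale_apply [simp]: "fscale c f x = c * f x"
  by (simp add: fscale_def)

text \<open>
  The free module with the shapes as its basis is realised inside the module of all functions on
  shapes; every shape has finitely many neighbours, so \<open>U\<close> and \<open>D\<close> are defined on all functions.
\<close>
interpretation fm: Modules.module fscale
  by unfold_locales (simp_all add: fun_eq_iff algebra_simps)

lemma sum_fun_apply: "(\<Sum>i\<in>S. f i) x = (\<Sum>i\<in>S. f i x)" for f :: "'i \<Rightarrow> 'x \<Rightarrow> 'a::comm_monoid_add"
  by (induction S rule: infinite_finite_induct) auto

lemma fm_span_image_obtain:
  assumes "finite T" "v \<in> fm.span (b ` T)"
  obtains c where "v = (\<Sum>\<kappa>\<in>T. fscale (c \<kappa>) (b \<kappa>))"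
proof -
  let ?S = "{v. \<exists>c. v = (\<Sum>\<kappa>\<in>T. fscale (c \<kappa>) (b \<kappa>))}"
  have "fm.subspace ?S"
    unfolding fm.subspace_def
  proof (intro conjI ballI allI)
    show "0 \<in> ?S" by (auto intro!: exI[of _ "\<lambda>_. 0"])
    show "x + y \<in> ?S" if "x \<in> ?S" "y \<in> ?S" for x y
    proof -
      from that obtain c d where "x = (\<Sum>\<kappa>\<in>T. fscale (c \<kappa>) (b \<kappa>))" "y = (\<Sum>\<kappa>\<in>T. fscale (d \<kappa>) (b \<kappa>))"
        by blast
      then have "x + y = (\<Sum>\<kappa>\<in>T. fscale (c \<kappa> + d \<kappa>) (b \<kappa>))"
        by (simp add: fm.scale_left_distrib sum.distrib)
      then show ?thesis by (intro CollectI exI)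
    qed
    show "fscale r x \<in> ?S" if "x \<in> ?S" for r x
    proof -
      from that obtain c where "x = (\<Sum>\<kappa>\<in>T. fscale (c \<kappa>) (b \<kappa>))" by blast
      then have "fscale r x = (\<Sum>\<kappa>\<in>T. fscale (r * c \<kappa>) (b \<kappa>))"
        by (simp add: fm.scale_sum_right)
      then show ?thesis by (intro CollectI exI)
    qed
  qed
  moreover have "b ` T \<subseteq> ?S"
  proof (rule image_subsetI)
    fix t assume t: "t \<in> T"
    have "b t = (\<Sum>\<kappa>\<in>T. if \<kappa> = t then b \<kappa> else 0)" using assms(1) t by simp
    also have "\<dots> = (\<Sum>\<kappa>\<in>T. fscale (if \<kappa> = t then 1 else 0) (b \<kappa>))" by (intro sum.cong) auto
    finally show "b t \<in> ?S" by (intro CollectI exI)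
  qed
  ultimately have "fm.span (b ` T) \<subseteq> ?S" by (intro fm.span_minimal)
  then show ?thesis using assms(2) that by blast
qed

definition Up :: "((nat \<Rightarrow> nat) \<Rightarrow> 'a::comm_ring_1) \<Rightarrow> (nat \<Rightarrow> nat) \<Rightarrow> 'a" where
  "Up f \<nu> = (if \<nu> \<in> shapes then \<Sum>\<kappa>\<in>remove_box \<nu>. f \<kappa> else 0)"

definition Down :: "((nat \<Rightarrow> nat) \<Rightarrow> 'a::comm_ring_1) \<Rightarrow> (nat \<Rightarrow> nat) \<Rightarrow> 'a" where
  "Down f \<nu> = (if \<nu> \<in> shapes then \<Sum>\<kappa>\<in>add_box \<nu>. f \<kappa> else 0)"

definition delta :: "(nat \<Rightarrow> nat) \<Rightarrow> (nat \<Rightarrow> nat) \<Rightarrow> int poly" where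
  "delta \<mu> \<nu> = (if \<nu> = \<mu> then 1 else 0)"

lemma module_hom_Up: "Modules.module_hom fscale fscale Up"
  by unfold_locales (auto simp: Up_def fun_eq_iff sum.distrib sum_distrib_left)

lemma module_hom_Down: "Modules.module_hom fscale fscale Down"
  by unfold_locales (auto simp: Down_def fun_eq_iff sum.distrib sum_distrib_left)

interpretation Up: Modules.module_hom fscale fscale Up by (rule module_hom_Up)
interpretation Down: Modules.module_hom fscale fscale Down by (rule module_hom_Down)

lemma sum_delta: "finite S \<Longrightarrow> (\<Sum>\<kappa>\<in>S. delta \<kappa> \<nu>) = (if \<nu> \<in> S then 1 else 0)"
  by (simp add: delta_def)

lemma sum_delta': "finite S \<Longrightarrow> (\<Sum>\<kappa>\<in>S. delta \<mu> \<kappa>) = (if \<mu> \<in> S then 1 else 0)"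
  by (simp add: delta_def)

lemma remove_box_iff: "\<mu> \<in> remove_box \<nu> \<longleftrightarrow> \<mu> \<in> shapes \<and> \<nu> \<in> add_box \<mu>"
  by (simp add: remove_box_def)

lemma Up_delta:
  assumes "\<mu> \<in> shapes" shows "Up (delta \<mu>) = (\<Sum>\<nu>\<in>add_box \<mu>. delta \<nu>)"
proof
  fix \<nu>
  show "Up (delta \<mu>) \<nu> = (\<Sum>\<nu>\<in>add_box \<mu>. delta \<nu>) \<nu>"
    using finite_remove_box[of \<nu>] assms add_box_in_shapes[of \<nu> \<mu>]
    by (auto simp: sum_fun_apply sum_delta sum_delta' finite_add_box[OF assms] Up_def remove_box_iff)
qed

lemma Down_delta:
  assumes "\<mu> \<in> shapes" shows "Down (delta \<mu>) = (\<Sum>\<nu>\<in>remove_box \<mu>. delta \<nu>)"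
proof
  fix \<nu>
  show "Down (delta \<mu>) \<nu> = (\<Sum>\<nu>\<in>remove_box \<mu>. delta \<nu>) \<nu>"
    using finite_add_box[of \<nu>] assms
    by (auto simp: sum_fun_apply sum_delta sum_delta' finite_remove_box[OF assms] Down_def remove_box_iff)
qed

lemma Down_Up_eq_sum:
  assumes "\<nu> \<in> shapes_of n"
  shows "Down (Up f) \<nu> = (\<Sum>\<rho>\<in>shapes_of n. of_nat (card (add_box \<nu> \<inter> add_box \<rho>)) * f \<rho>)"
proof -
  have \<nu>: "\<nu> \<in> shapes" "shape_size \<nu> = n" using assms by (auto simp: shapes_of_def)
  have "Down (Up f) \<nu> = (\<Sum>\<kappa>\<in>add_box \<nu>. \<Sum>\<rho>\<in>shapes_of n. if \<kappa> \<in> add_box \<rho> then f \<rho> else 0)"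
  proof -
    have "Up f \<kappa> = (\<Sum>\<rho>\<in>shapes_of n. if \<kappa> \<in> add_box \<rho> then f \<rho> else 0)" if \<kappa>: "\<kappa> \<in> add_box \<nu>" for \<kappa>
    proof -
      have "shape_size \<rho> = n" if "\<rho> \<in> remove_box \<kappa>" for \<rho>
        using shape_size_add_box[OF \<nu>(1) \<kappa>] shape_size_add_box[of \<rho> \<kappa>] that \<nu>(2) by (simp add: remove_box_def)
      then have "remove_box \<kappa> = {\<rho> \<in> shapes_of n. \<kappa> \<in> add_box \<rho>}" by (auto simp: remove_box_def shapes_of_def)
      then show ?thesis using add_box_in_shapes[OF \<kappa>] by (simp add: Up_def sum.inter_filter finite_shapes_of)
    qed
    then show ?thesis using \<nu> by (simp add: Down_def)
  qed
  also have "\<dots> = (\<Sum>\<rho>\<in>shapes_of n. of_nat (card (add_box \<nu> \<inter> add_box \<rho>)) * f \<rho>)"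
    by (subst sum.swap, intro sum.cong)
       (auto simp: finite_add_box[OF \<nu>(1)] sum.inter_filter[symmetric] Int_def)
  finally show ?thesis .
qed

lemma Up_Down_eq_sum:
  assumes "\<nu> \<in> shapes_of n"
  shows "Up (Down f) \<nu> = (\<Sum>\<rho>\<in>shapes_of n. of_nat (card (remove_box \<nu> \<inter> remove_box \<rho>)) * f \<rho>)"
proof -
  have \<nu>: "\<nu> \<in> shapes" "shape_size \<nu> = n" using assms by (auto simp: shapes_of_def)
  have "Up (Down f) \<nu> = (\<Sum>\<kappa>\<in>remove_box \<nu>. \<Sum>\<rho>\<in>shapes_of n. if \<kappa> \<in> remove_box \<rho> then f \<rho> else 0)"
  proof -
    have "Down f \<kappa> = (\<Sum>\<rho>\<in>shapes_of n. if \<kappa> \<in> remove_box \<rho> then f \<rho> else 0)" if \<kappa>: "\<kappa> \<in> remove_box \<nu>" for \<kappa>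
    proof -
      have \<kappa>': "\<kappa> \<in> shapes" "\<nu> \<in> add_box \<kappa>" using \<kappa> by (auto simp: remove_box_def)
      have "shape_size \<rho> = n" if "\<rho> \<in> add_box \<kappa>" for \<rho>
        using shape_size_add_box[OF \<kappa>'] shape_size_add_box[OF \<kappa>'(1) that] \<nu>(2) by simp
      then have "add_box \<kappa> = {\<rho> \<in> shapes_of n. \<kappa> \<in> remove_box \<rho>}" using \<kappa>' add_box_in_shapes by (auto simp: remove_box_def shapes_of_def)
      then show ?thesis using \<kappa>' by (simp add: Down_def sum.inter_filter finite_shapes_of)
    qed
    then show ?thesis using \<nu> by (simp add: Up_def)
  qed
  also have "\<dots> = (\<Sum>\<rho>\<in>shapes_of n. of_nat (card (remove_box \<nu> \<inter> remove_box \<rho>)) * f \<rho>)"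
    by (subst sum.swap, intro sum.cong)
       (auto simp: finite_remove_box[OF \<nu>(1)] sum.inter_filter[symmetric] Int_def)
  finally show ?thesis .
qed

lemma Down_Up_commute:
  assumes "\<And>\<nu>. \<nu> \<notin> shapes \<Longrightarrow> f \<nu> = 0"
  shows "Down (Up f) = Up (Down f) + f"
proof
  fix \<nu>
  show "Down (Up f) \<nu> = (Up (Down f) + f) \<nu>"
  proof (cases "\<nu> \<in> shapes")
    case False
    then show ?thesis using assms[of \<nu>] by (simp add: Down_def Up_def)
  next
    case True
    then have \<nu>: "\<nu> \<in> shapes_of (shape_size \<nu>)" by (simp add: shapes_of_def)
    have "Down (Up f) \<nu> = (\<Sum>\<rho>\<in>shapes_of (shape_size \<nu>).
        of_nat (card (remove_box \<nu> \<inter> remove_box \<rho>)) * f \<rho> + (if \<nu> = \<rho> then f \<rho> else 0))"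
      unfolding Down_Up_eq_sum[OF \<nu>]
    proof (rule sum.cong[OF refl])
      fix \<rho> assume "\<rho> \<in> shapes_of (shape_size \<nu>)"
      then have "card (add_box \<nu> \<inter> add_box \<rho>) = card (remove_box \<nu> \<inter> remove_box \<rho>) + (if \<nu> = \<rho> then 1 else 0)"
        using card_add_box_remove_box_exchange[of \<nu> \<rho>] True by (simp add: shapes_of_def)
      then show "of_nat (card (add_box \<nu> \<inter> add_box \<rho>)) * f \<rho> =
          of_nat (card (remove_box \<nu> \<inter> remove_box \<rho>)) * f \<rho> + (if \<nu> = \<rho> then f \<rho> else 0)"
        by (simp add: algebra_simps)
    qed
    also have "\<dots> = Up (Down f) \<nu> + f \<nu>"
      unfolding Up_Down_eq_sum[OF \<nu>] using \<nu> by (simp add: sum.distrib finite_shapes_of)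
    finally show ?thesis by simp
  qed
qed

lemma Up_pow_outside:
  assumes "\<And>\<nu>. \<nu> \<notin> shapes \<Longrightarrow> f \<nu> = 0" "\<nu> \<notin> shapes"
  shows "(Up ^^ a) f \<nu> = 0"
  using assms by (cases a) (simp_all add: Up_def)

lemma Down_Up_pow:
  assumes "\<And>\<nu>. \<nu> \<notin> shapes \<Longrightarrow> f \<nu> = 0"
  shows "Down ((Up ^^ Suc a) f) = (Up ^^ Suc a) (Down f) + fscale (of_nat (Suc a)) ((Up ^^ a) f)"
proof (induction a)
  case 0
  then show ?case using Down_Up_commute[OF assms] by (simp add: fun_eq_iff)
next
  case (Suc a)
  have "Down ((Up ^^ Suc (Suc a)) f) = Up (Down ((Up ^^ Suc a) f)) + (Up ^^ Suc a) f"
    unfolding funpow.simps(2)[of "Suc a"] o_apply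
    by (rule Down_Up_commute) (rule Up_pow_outside[OF assms])
  also have "\<dots> = (Up ^^ Suc (Suc a)) (Down f) + (fscale (of_nat (Suc a)) ((Up ^^ Suc a) f) + (Up ^^ Suc a) f)"
    unfolding Suc.IH by (simp add: Up.add Up.scale add.assoc)
  also have "fscale (of_nat (Suc a)) ((Up ^^ Suc a) f) + (Up ^^ Suc a) f =
      fscale (of_nat (Suc (Suc a))) ((Up ^^ Suc a) f)"
    by (simp add: fun_eq_iff algebra_simps)
  finally show ?case .
qed

section \<open>Shapes whose two largest parts agree\<close>

definition twin :: "nat \<Rightarrow> (nat \<Rightarrow> nat) set" where
  "twin m = {\<mu> \<in> shapes_of m. \<mu> 0 = \<mu> 1}"

text \<open>
  The pair of \<open>a\<close> and \<open>\<mu>\<close> stands for the vector \<open>U\<^sup>a \<mu>\<close>.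
\<close>
definition twin_index :: "nat \<Rightarrow> (nat \<times> (nat \<Rightarrow> nat)) set" where
  "twin_index n = (SIGMA a:{..n}. twin (n - a))"

definition twin_vec :: "nat \<times> (nat \<Rightarrow> nat) \<Rightarrow> (nat \<Rightarrow> nat) \<Rightarrow> int poly" where
  "twin_vec = (\<lambda>(a, \<mu>). (Up ^^ a) (delta \<mu>))"

lemma finite_twin_index: "finite (twin_index n)"
  by (simp add: twin_index_def twin_def finite_shapes_of)

lemma twin_shapesD: "\<mu> \<in> twin m \<Longrightarrow> \<mu> \<in> shapes" "\<mu> \<in> twin m \<Longrightarrow> shape_size \<mu> = m"
  "\<mu> \<in> twin m \<Longrightarrow> \<mu> 1 = \<mu> 0"
  by (auto simp: twin_def shapes_of_def)

lemma twin_index_iff: "(a, \<mu>) \<in> twin_index n \<longleftrightarrow> a \<le> n \<and> \<mu> \<in> twin (n - a)"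
  by (auto simp: twin_index_def)

lemma twin_0: "twin 0 = {\<lambda>_. 0}"
  by (auto simp: twin_def shapes_of_0)

lemma twin_1: "twin 1 = {}"
proof -
  have False if "\<mu> \<in> twin 1" for \<mu>
  proof -
    have \<mu>: "\<mu> \<in> shapes_of 1" "\<mu> 0 = \<mu> 1" using that by (auto simp: twin_def)
    then have "\<mu> i = 0" for i using shapes_of_zero_beyond[OF \<mu>(1), of i] shapes_of_zero_beyond[OF \<mu>(1), of 1] by (cases i) auto
    then have "\<mu> = (\<lambda>_. 0)" by auto
    then show False using \<mu>(1) by (simp add: shapes_of_def)
  qed
  then show ?thesis by blast
qed

text \<open>
  This is why the differences \<open>p(m) - p(m-1)\<close> occur: they count the twins of size \<open>m\<close>.
\<close>
lemma first_row_box: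
  "bij_betw (\<lambda>\<kappa>. \<kappa>(0 := Suc (\<kappa> 0))) (shapes_of m) (shapes_of (Suc m) - twin (Suc m))"
proof (rule bij_betwI[where g = "\<lambda>\<nu>. \<nu>(0 := \<nu> 0 - 1)"])
  show "(\<lambda>\<kappa>. \<kappa>(0 := Suc (\<kappa> 0))) \<in> shapes_of m \<rightarrow> shapes_of (Suc m) - twin (Suc m)"
  proof
    fix \<kappa> assume "\<kappa> \<in> shapes_of m"
    then have \<kappa>: "\<kappa> \<in> shapes" "shape_size \<kappa> = m" by (auto simp: shapes_of_def)
    obtain b where "\<And>i. b \<le> i \<Longrightarrow> \<kappa> i = 0" using shapes_bound[OF \<kappa>(1)] by blast
    then have "\<kappa>(0 := Suc (\<kappa> 0)) \<in> shapes"
      using shapes_antimono[OF \<kappa>(1)] by (intro shapesI[of _ "Suc b"]) (auto intro: le_SucI)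
    then show "\<kappa>(0 := Suc (\<kappa> 0)) \<in> shapes_of (Suc m) - twin (Suc m)"
      using shape_size_upd[OF \<kappa>(1), of 0] \<kappa> shapes_antimono[OF \<kappa>(1), of 0 1] by (auto simp: shapes_of_def twin_def)
  qed
  show "(\<lambda>\<nu>. \<nu>(0 := \<nu> 0 - 1)) \<in> shapes_of (Suc m) - twin (Suc m) \<rightarrow> shapes_of m"
  proof
    fix \<nu> assume "\<nu> \<in> shapes_of (Suc m) - twin (Suc m)"
    then have \<nu>: "\<nu> \<in> shapes" "shape_size \<nu> = Suc m" "\<nu> 0 \<noteq> \<nu> 1" by (auto simp: shapes_of_def twin_def)
    have lt: "\<nu> 1 < \<nu> 0" using \<nu>(3) shapes_antimono[OF \<nu>(1), of 0 1] by simp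
    obtain b where b: "\<And>i. b \<le> i \<Longrightarrow> \<nu> i = 0" using shapes_bound[OF \<nu>(1)] by blast
    have shapes: "\<nu>(0 := \<nu> 0 - 1) \<in> shapes"
    proof (rule shapesI[of _ b])
      show "(\<nu>(0 := \<nu> 0 - 1)) (Suc i) \<le> (\<nu>(0 := \<nu> 0 - 1)) i" for i
        using lt shapes_antimono[OF \<nu>(1), of i "Suc i"] by (cases i) auto
    qed (use b in auto)
    have "\<nu> = (\<nu>(0 := \<nu> 0 - 1))(0 := Suc ((\<nu>(0 := \<nu> 0 - 1)) 0))" using lt by auto
    then have "Suc (shape_size (\<nu>(0 := \<nu> 0 - 1))) = Suc m" using shape_size_upd[OF shapes, of 0] \<nu>(2) by simp
    then show "\<nu>(0 := \<nu> 0 - 1) \<in> shapes_of m" using shapes by (simp add: shapes_of_def)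
  qed
next
  fix \<nu> assume "\<nu> \<in> shapes_of (Suc m) - twin (Suc m)"
  then have \<nu>: "\<nu> \<in> shapes" "\<nu> 0 \<noteq> \<nu> 1" by (auto simp: shapes_of_def twin_def)
  have "\<nu> 1 < \<nu> 0" using \<nu>(2) shapes_antimono[OF \<nu>(1), of 0 1] by simp
  then show "(\<nu>(0 := \<nu> 0 - 1))(0 := Suc ((\<nu>(0 := \<nu> 0 - 1)) 0)) = \<nu>" by auto
qed auto

lemma card_twin: "card (twin (Suc m)) + card (shapes_of m) = card (shapes_of (Suc m))"
proof -
  have "card (shapes_of m) = card (shapes_of (Suc m)) - card (twin (Suc m))"
    using bij_betw_same_card[OF first_row_box[of m]]
    by (simp add: card_Diff_subset twin_def finite_shapes_of)
  moreover have "card (twin (Suc m)) \<le> card (shapes_of (Suc m))"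
    by (rule card_mono) (auto simp: twin_def finite_shapes_of)
  ultimately show ?thesis by simp
qed

text \<open>
  A shape that is not a twin arises from a smaller shape \<open>\<kappa>\<close> by adding a box to the first row, and
  \<open>U \<kappa>\<close> differs from it by shapes with a shorter first row.
\<close>
lemma delta_in_span_twin_vec:
  assumes "\<nu> \<in> shapes_of n"
  shows "delta \<nu> \<in> fm.span (twin_vec ` twin_index n)"
  using assms
proof (induction n arbitrary: \<nu>)
  case 0
  then have "delta \<nu> = twin_vec (0, \<nu>)" "(0, \<nu>) \<in> twin_index 0"
    by (auto simp: twin_vec_def twin_index_iff twin_0 shapes_of_0)
  then show ?case by (metis fm.span_base imageI)
next
  case (Suc n)
  have Up_span: "Up v \<in> fm.span (twin_vec ` twin_index (Suc n))"
    if "v \<in> fm.span (twin_vec ` twin_index n)" for v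
  proof -
    have "Up (twin_vec i) \<in> twin_vec ` twin_index (Suc n)" if "i \<in> twin_index n" for i
      using that by (cases i) (auto simp: twin_vec_def twin_index_iff intro!: image_eqI[of _ _ "(Suc (fst i), snd i)"])
    then have "Up ` twin_vec ` twin_index n \<subseteq> twin_vec ` twin_index (Suc n)" by blast
    then show ?thesis using that Up.span_image[of "twin_vec ` twin_index n"] fm.span_mono by blast
  qed
  from Suc.prems show ?case
  proof (induction "\<nu> 0" arbitrary: \<nu> rule: less_induct)
    case less
    show ?case
    proof (cases "\<nu> \<in> twin (Suc n)")
      case True
      then have "delta \<nu> = twin_vec (0, \<nu>)" "(0, \<nu>) \<in> twin_index (Suc n)"
        by (auto simp: twin_vec_def twin_index_iff)
      then show ?thesis by (metis fm.span_base imageI)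
    next
      case False
      then have "\<nu> \<in> (\<lambda>\<kappa>. \<kappa>(0 := Suc (\<kappa> 0))) ` shapes_of n"
        using less.prems bij_betw_imp_surj_on[OF first_row_box[of n]] by blast
      then obtain \<kappa> where \<kappa>: "\<kappa> \<in> shapes_of n" "\<nu> = \<kappa>(0 := Suc (\<kappa> 0))" by blast
      have \<kappa>_par: "\<kappa> \<in> shapes" and \<nu>_par: "\<nu> \<in> shapes" using \<kappa> less.prems by (auto simp: shapes_of_def)
      have \<nu>_add_box: "\<nu> \<in> add_box \<kappa>" using \<nu>_par \<kappa>(2) by (auto simp: add_box_def)
      have "Up (delta \<kappa>) = delta \<nu> + (\<Sum>\<tau>\<in>add_box \<kappa> - {\<nu>}. delta \<tau>)"
        unfolding Up_delta[OF \<kappa>_par] by (rule sum.remove[OF finite_add_box[OF \<kappa>_par] \<nu>_add_box])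
      then have eq: "delta \<nu> = Up (delta \<kappa>) - (\<Sum>\<tau>\<in>add_box \<kappa> - {\<nu>}. delta \<tau>)" by simp
      have "delta \<tau> \<in> fm.span (twin_vec ` twin_index (Suc n))" if \<tau>: "\<tau> \<in> add_box \<kappa> - {\<nu>}" for \<tau>
      proof (rule less.hyps)
        obtain i where i: "\<tau> = \<kappa>(i := Suc (\<kappa> i))" using \<tau> by (auto simp: add_box_def)
        then have "i \<noteq> 0" using \<tau> \<kappa>(2) by auto
        then show "\<tau> 0 < \<nu> 0" by (simp add: i \<kappa>(2))
        show "\<tau> \<in> shapes_of (Suc n)" using \<tau> add_box_in_shapes shape_size_add_box[OF \<kappa>_par, of \<tau>] \<kappa>(1) by (auto simp: shapes_of_def)
      qed
      then show ?thesis
        unfolding eq using Up_span[OF Suc.IH[OF \<kappa>(1)]] by (intro fm.span_diff fm.span_sum) auto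
    qed
  qed
qed

definition num_parts :: "(nat \<Rightarrow> nat) \<Rightarrow> nat" where
  "num_parts \<mu> = card {i. \<mu> i \<noteq> 0}"

lemma num_parts_iff:
  assumes "\<mu> \<in> shapes" shows "\<mu> i \<noteq> 0 \<longleftrightarrow> i < num_parts \<mu>"
proof -
  define m where "m = (LEAST i. \<mu> i = 0)"
  obtain b where "\<And>i. b \<le> i \<Longrightarrow> \<mu> i = 0" using shapes_bound[OF assms] by blast
  then have "\<mu> b = 0" by simp
  then have "\<mu> m = 0" unfolding m_def by (rule LeastI)
  then have "\<mu> i = 0" if "m \<le> i" for i using shapes_antimono[OF assms that] by simp
  moreover have "\<mu> i \<noteq> 0" if "i < m" for i
    using not_less_Least[of i "\<lambda>i. \<mu> i = 0"] that by (simp add: m_def)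
  ultimately have "\<mu> i \<noteq> 0 \<longleftrightarrow> i < m" for i by (metis not_less)
  then show ?thesis by (simp add: num_parts_def)
qed

lemma num_parts_mono:
  assumes "\<kappa> \<in> shapes" "\<And>i. \<mu> i \<noteq> 0 \<Longrightarrow> \<kappa> i \<noteq> 0"
  shows "num_parts \<mu> \<le> num_parts \<kappa>"
  unfolding num_parts_def using assms by (intro card_mono) (auto simp: shapes_def)

definition two_ones :: "nat \<Rightarrow> nat" where
  "two_ones = (\<lambda>i. if i < 2 then 1 else 0)"

text \<open>
  Removing a box from a twin \<open>\<mu>\<close> yields a twin, unless it is the box in the second row.  In that
  case let \<open>\<rho>\<close> be \<open>\<mu>\<close> with a box removed from each of the first two rows.  The shape in question is
  \<open>\<rho>\<close> with a box added to the first row, so it differs from \<open>U \<rho>\<close> by twins.  These terms have at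
  least as many parts as \<open>\<mu>\<close>; the only exception would be \<open>\<mu> = (1,1)\<close>, where \<open>\<rho>\<close> is empty.
\<close>
lemma Down_delta_twin:
  fixes m \<mu>
  defines "S1 \<equiv> {\<kappa> \<in> twin (m - 1). num_parts \<mu> \<le> num_parts \<kappa> \<and> 2 \<le> m}"
    and "S2 \<equiv> {\<kappa> \<in> twin (m - 2). num_parts \<mu> \<le> num_parts \<kappa> \<and> 2 \<le> m}"
  assumes \<mu>: "\<mu> \<in> twin m" and ne: "\<mu> \<noteq> two_ones"
  shows "Down (delta \<mu>) - (\<Sum>\<kappa>\<in>remove_box \<mu> \<inter> twin (m - 1). delta \<kappa>) \<in>
    fm.span (delta ` S1 \<union> Up ` delta ` S2)"
proof -
  note \<mu>_par = twin_shapesD(1)[OF \<mu>] and size = twin_shapesD(2)[OF \<mu>] and eq01 = twin_shapesD(3)[OF \<mu>]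
  have "Down (delta \<mu>) = (\<Sum>\<kappa>\<in>remove_box \<mu> \<inter> twin (m - 1). delta \<kappa>) + (\<Sum>\<kappa>\<in>remove_box \<mu> - twin (m - 1). delta \<kappa>)"
    unfolding Down_delta[OF \<mu>_par] by (rule sum.Int_Diff[OF finite_remove_box[OF \<mu>_par]])
  then have diff: "Down (delta \<mu>) - (\<Sum>\<kappa>\<in>remove_box \<mu> \<inter> twin (m - 1). delta \<kappa>) = (\<Sum>\<kappa>\<in>remove_box \<mu> - twin (m - 1). delta \<kappa>)"
    by simp
  \<comment> \<open>Removing a box from the first row would break the order, and below the second row it leaves a twin.\<close>
  have only: "\<kappa> = \<mu>(1 := \<mu> 1 - 1) \<and> \<mu> 1 = Suc (\<kappa> 1)" if \<kappa>: "\<kappa> \<in> remove_box \<mu> - twin (m - 1)" for \<kappa>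
  proof -
    obtain i where i: "\<mu> = \<kappa>(i := Suc (\<kappa> i))" and \<kappa>_par: "\<kappa> \<in> shapes" using \<kappa> by (auto simp: remove_box_def add_box_def)
    have \<kappa>_size: "shape_size \<kappa> = m - 1" using shape_size_upd[OF \<kappa>_par, of i] i size by simp
    have "i \<noteq> 0"
    proof
      assume "i = 0"
      then show False using shapes_antimono[OF \<kappa>_par, of 0 1] eq01 by (simp add: i)
    qed
    moreover have "\<not> 2 \<le> i"
    proof
      assume "2 \<le> i"
      then have "\<kappa> 0 = \<kappa> 1" using eq01 by (auto simp: i)
      then show False using \<kappa> \<kappa>_par \<kappa>_size by (auto simp: twin_def shapes_of_def)
    qed
    ultimately have "i = 1" by simp
    then show ?thesis by (auto simp: i)
  qed
  have "delta \<kappa> \<in> fm.span (delta ` S1 \<union> Up ` delta ` S2)" if \<kappa>: "\<kappa> \<in> remove_box \<mu> - twin (m - 1)" for \<kappa>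
  proof -
    have \<kappa>_par: "\<kappa> \<in> shapes" using \<kappa> by (auto simp: remove_box_def)
    have \<kappa>_size: "Suc (shape_size \<kappa>) = m" using \<kappa> shape_size_add_box[of \<kappa> \<mu>] size by (auto simp: remove_box_def)
    from only[OF \<kappa>] have \<kappa>_\<mu>: "\<kappa> = \<mu>(1 := \<mu> 1 - 1)" and "\<mu> 1 = Suc (\<kappa> 1)" by blast+
    then have \<kappa>1: "\<mu> 0 = Suc (\<kappa> 1)" using eq01 by simp
    have \<kappa>2: "\<kappa> i = \<mu> i" if "i \<noteq> 1" for i by (subst \<kappa>_\<mu>) (use that in simp)
    have \<kappa>0: "\<kappa> 0 = Suc (\<kappa> 1)" using \<kappa>1 \<kappa>2[of 0] by simp
    define \<rho> where "\<rho> = \<kappa>(0 := \<kappa> 1)"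
    obtain b where b: "\<And>i. b \<le> i \<Longrightarrow> \<kappa> i = 0" using shapes_bound[OF \<kappa>_par] by blast
    have \<rho>_par: "\<rho> \<in> shapes"
    proof (rule shapesI[of _ "Suc b"])
      show "\<rho> (Suc i) \<le> \<rho> i" for i
        using shapes_antimono[OF \<kappa>_par, of i "Suc i"] by (cases i) (auto simp: \<rho>_def)
    qed (use b in \<open>auto simp: \<rho>_def\<close>)
    have \<kappa>_\<rho>: "\<kappa> = \<rho>(0 := Suc (\<rho> 0))" using \<kappa>0 by (auto simp: \<rho>_def)
    then have \<kappa>_add_box: "\<kappa> \<in> add_box \<rho>" using \<kappa>_par by (auto simp: add_box_def)
    have \<rho>_size: "Suc (shape_size \<rho>) = shape_size \<kappa>" using shape_size_add_box[OF \<rho>_par \<kappa>_add_box] by simp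
    have \<rho>_twin: "\<rho> \<in> twin (m - 2)" using \<rho>_par \<rho>_size \<kappa>_size by (auto simp: twin_def shapes_of_def \<rho>_def)
    have m2: "2 \<le> m" using \<rho>_size \<kappa>_size by simp
    have "\<kappa> 1 \<noteq> 0"
    proof
      assume "\<kappa> 1 = 0"
      then have "\<mu> 0 = 1" "\<mu> 1 = 1" using \<kappa>1 eq01 by simp_all
      moreover have "\<mu> i = 0" if "2 \<le> i" for i
        using shapes_antimono[OF \<kappa>_par, of 1 i] \<kappa>2[of i] \<open>\<kappa> 1 = 0\<close> that by simp
      ultimately have "\<mu> i = two_ones i" for i
        by (cases "i = 0"; cases "i = 1") (auto simp: two_ones_def)
      then show False using ne by blast
    qed
    have sup: "\<rho> i \<noteq> 0" if "\<mu> i \<noteq> 0" for i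
    proof (cases "2 \<le> i")
      case True then show ?thesis using that \<kappa>2[of i] by (simp add: \<rho>_def)
    next
      case False
      then have "i = 0 \<or> i = 1" by auto
      then show ?thesis using \<open>\<kappa> 1 \<noteq> 0\<close> by (auto simp: \<rho>_def)
    qed
    have len_\<rho>: "num_parts \<mu> \<le> num_parts \<rho>" by (rule num_parts_mono[OF \<rho>_par sup])
    have others: "\<tau> \<in> S1" if \<tau>: "\<tau> \<in> add_box \<rho> - {\<kappa>}" for \<tau>
    proof -
      obtain i where i: "\<tau> = \<rho>(i := Suc (\<rho> i))" and \<tau>_par: "\<tau> \<in> shapes" using \<tau> by (auto simp: add_box_def)
      have "i \<noteq> 0" using \<tau> \<kappa>_\<rho> i by auto
      moreover have "i \<noteq> 1" using shapes_antimono[OF \<tau>_par, of 0 1] by (auto simp: i \<rho>_def)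
      ultimately have "\<tau> 0 = \<tau> 1" by (auto simp: i \<rho>_def)
      moreover have "shape_size \<tau> = m - 1" using shape_size_add_box[OF \<rho>_par, of \<tau>] \<tau> \<rho>_size \<kappa>_size by auto
      moreover have "num_parts \<mu> \<le> num_parts \<tau>"
        by (rule num_parts_mono[OF \<tau>_par]) (use sup in \<open>auto simp: i\<close>)
      ultimately show ?thesis using \<tau>_par m2 by (auto simp: S1_def twin_def shapes_of_def)
    qed
    have "Up (delta \<rho>) = delta \<kappa> + (\<Sum>\<tau>\<in>add_box \<rho> - {\<kappa>}. delta \<tau>)"
      unfolding Up_delta[OF \<rho>_par] by (rule sum.remove[OF finite_add_box[OF \<rho>_par] \<kappa>_add_box])
    then have eq: "delta \<kappa> = Up (delta \<rho>) - (\<Sum>\<tau>\<in>add_box \<rho> - {\<kappa>}. delta \<tau>)" by simp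
    show ?thesis
      unfolding eq
    proof (intro fm.span_diff fm.span_sum)
      show "Up (delta \<rho>) \<in> fm.span (delta ` S1 \<union> Up ` delta ` S2)"
        using \<rho>_twin len_\<rho> m2 by (intro fm.span_base) (simp add: S2_def)
      show "delta \<tau> \<in> fm.span (delta ` S1 \<union> Up ` delta ` S2)" if "\<tau> \<in> add_box \<rho> - {\<kappa>}" for \<tau>
        using others[OF that] by (intro fm.span_base) blast
    qed
  qed
  then show ?thesis unfolding diff by (intro fm.span_sum) blast
qed

section \<open>Levels and pivots\<close>

text \<open>
  For \<open>a \<le> n - 2\<close> this is \<open>a + 1\<close>; the minimum matters for \<open>a = n\<close>, where it closes the gap left by
  \<open>a = n - 1\<close>.
\<close>
definition level :: "nat \<Rightarrow> nat \<times> (nat \<Rightarrow> nat) \<Rightarrow> nat" where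
  "level n = (\<lambda>(a, \<mu>). min (Suc a) n)"

definition upper_index :: "nat \<Rightarrow> (nat \<times> (nat \<Rightarrow> nat)) set" where
  "upper_index n = {i \<in> twin_index n. 2 \<le> level n i}"

text \<open>
  The vector of the preceding level whose image contains the given one with coefficient one.  In
  general a last part of size one is added.  The empty shape would become the shape \<open>(1)\<close>,
  which is not a twin; its place is taken by \<open>(1,1)\<close>.
\<close>
definition pivot :: "nat \<times> (nat \<Rightarrow> nat) \<Rightarrow> nat \<times> (nat \<Rightarrow> nat)" where
  "pivot = (\<lambda>(a, \<kappa>). if \<kappa> = (\<lambda>_. 0) then (a - 2, two_ones) else (a - 1, \<kappa>(num_parts \<kappa> := 1)))"

lemma two_ones_twin: "two_ones \<in> twin 2"
proof -
  have "two_ones \<in> shapes" by (rule shapesI[of _ 2]) (auto simp: two_ones_def)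
  moreover have "shape_size two_ones = 2"
    by (subst shape_size_eq_sum[of 2]) (auto simp: two_ones_def lessThan_Suc numeral_2_eq_2)
  ultimately show ?thesis by (simp add: twin_def shapes_of_def two_ones_def)
qed

lemma num_parts_two_ones: "num_parts two_ones = 2"
proof -
  have "{i. two_ones i \<noteq> 0} = {..<2}" by (auto simp: two_ones_def)
  then show ?thesis by (simp add: num_parts_def)
qed

lemma twin_index_cases:
  assumes "(a, \<mu>) \<in> twin_index n"
  obtains "a = n" "\<mu> = (\<lambda>_. 0)" | "a + 2 \<le> n" "\<mu> \<in> twin (n - a)" "\<mu> \<noteq> (\<lambda>_. 0)" "2 \<le> num_parts \<mu>"
proof -
  from assms have a: "a \<le> n" and \<mu>: "\<mu> \<in> twin (n - a)" by (auto simp: twin_index_iff)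
  show ?thesis
  proof (cases "a = n")
    case True
    then show ?thesis using \<mu> that(1) by (simp add: twin_0)
  next
    case False
    have "n - a \<noteq> 1" using \<mu> twin_1 by auto
    then have "a + 2 \<le> n" using a False by simp
    moreover have nz: "\<mu> \<noteq> (\<lambda>_. 0)" using twin_shapesD(2)[OF \<mu>] \<open>a + 2 \<le> n\<close> by auto
    moreover have "2 \<le> num_parts \<mu>"
    proof -
      obtain i where "\<mu> i \<noteq> 0" using nz by auto
      then have "\<mu> 0 \<noteq> 0" using shapes_antimono[OF twin_shapesD(1)[OF \<mu>], of 0 i] by simp
      then have "\<mu> 1 \<noteq> 0" using twin_shapesD(3)[OF \<mu>] by simp
      then show ?thesis using num_parts_iff[OF twin_shapesD(1)[OF \<mu>], of 1] by simp
    qed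
    ultimately show ?thesis using \<mu> that(2) by blast
  qed
qed

lemma level_simps:
  "a + 2 \<le> n \<Longrightarrow> level n (a, \<mu>) = Suc a" "level n (n, \<mu>) = n"
  by (auto simp: level_def)

text \<open>
  Among the shapes obtained from \<open>\<mu>\<close> by removing a box, \<open>\<kappa>\<close> is the only one that loses a part.
\<close>
lemma add_last_part:
  assumes "\<kappa> \<in> twin m" "2 \<le> num_parts \<kappa>"
  defines "\<mu> \<equiv> \<kappa>(num_parts \<kappa> := 1)"
  shows "\<mu> \<in> twin (Suc m)" "\<kappa> \<in> remove_box \<mu>" "num_parts \<mu> = Suc (num_parts \<kappa>)"
    "\<tau> \<in> remove_box \<mu> \<Longrightarrow> \<tau> \<noteq> \<kappa> \<Longrightarrow> num_parts \<kappa> < num_parts \<tau>"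
proof -
  note \<kappa> = twin_shapesD[OF assms(1)]
  let ?l = "num_parts \<kappa>"
  have \<kappa>_l: "\<kappa> ?l = 0" using num_parts_iff[OF \<kappa>(1), of ?l] by simp
  have \<mu>_upd: "\<mu> = \<kappa>(?l := Suc (\<kappa> ?l))" by (simp add: \<mu>_def \<kappa>_l)
  obtain b where b: "\<And>i. b \<le> i \<Longrightarrow> \<kappa> i = 0" using shapes_bound[OF \<kappa>(1)] by blast
  have shapes: "\<mu> \<in> shapes"
  proof (rule shapesI[of _ "max b (Suc ?l)"])
    show "\<mu> (Suc i) \<le> \<mu> i" for i
    proof (cases "Suc i = ?l")
      case True
      then have "\<kappa> i \<noteq> 0" using num_parts_iff[OF \<kappa>(1), of i] by simp
      then show ?thesis using True by (auto simp: \<mu>_def)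
    next
      case False
      then show ?thesis using shapes_antimono[OF \<kappa>(1), of i "Suc i"] \<kappa>_l
          shapes_antimono[OF \<kappa>(1), of "?l" "Suc i"] by (auto simp: \<mu>_def)
    qed
  qed (use b in \<open>auto simp: \<mu>_def\<close>)
  have size: "shape_size \<mu> = Suc m" using shape_size_upd[OF \<kappa>(1), of ?l] \<kappa>(2) by (simp add: \<mu>_upd)
  show "\<mu> \<in> twin (Suc m)" using shapes size \<kappa>(3) assms(2) by (simp add: twin_def shapes_of_def \<mu>_def)
  show "\<kappa> \<in> remove_box \<mu>" using shapes \<kappa>(1) by (auto simp: remove_box_def add_box_def \<mu>_upd)
  have \<mu>_iff: "\<mu> i \<noteq> 0 \<longleftrightarrow> i < Suc ?l" for i
    using num_parts_iff[OF \<kappa>(1), of i] by (auto simp: \<mu>_def)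
  have "{i. \<mu> i \<noteq> 0} = {..<Suc ?l}" using \<mu>_iff by blast
  then show num: "num_parts \<mu> = Suc ?l" by (simp add: num_parts_def)
  assume \<tau>: "\<tau> \<in> remove_box \<mu>" "\<tau> \<noteq> \<kappa>"
  then obtain i where i: "\<mu> = \<tau>(i := Suc (\<tau> i))" and \<tau>_par: "\<tau> \<in> shapes" by (auto simp: remove_box_def add_box_def)
  have "i \<noteq> ?l"
  proof
    assume "i = ?l"
    then have "\<tau> j = \<kappa> j" for j
      using fun_cong[OF i, of j] \<kappa>_l by (cases "j = ?l") (auto simp: \<mu>_def)
    then show False using \<tau>(2) by blast
  qed
  then have "\<tau> ?l = 1" using fun_cong[OF i, of ?l] by (simp add: \<mu>_def)
  then show "?l < num_parts \<tau>" using num_parts_iff[OF \<tau>_par, of ?l] by simp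
qed

lemma pivot:
  assumes "i \<in> upper_index n"
  shows "pivot i \<in> twin_index n" "Suc (level n (pivot i)) = level n i"
    "num_parts (snd i) < num_parts (snd (pivot i))"
proof -
  obtain a \<kappa> where i: "i = (a, \<kappa>)" by (cases i)
  have J: "(a, \<kappa>) \<in> twin_index n" and lev: "2 \<le> level n (a, \<kappa>)" using assms by (auto simp: upper_index_def i)
  from J have "pivot i \<in> twin_index n \<and> Suc (level n (pivot i)) = level n i \<and>
    num_parts (snd i) < num_parts (snd (pivot i))"
  proof (cases rule: twin_index_cases)
    case 1
    then have n: "2 \<le> n" using lev by (simp add: level_simps)
    have "pivot i = (n - 2, two_ones)" using 1 by (simp add: i pivot_def)
    moreover have "num_parts (\<lambda>_. 0) = 0" by (simp add: num_parts_def)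
    ultimately show ?thesis
      using n two_ones_twin 1 by (simp add: twin_index_iff i num_parts_two_ones level_simps level_def)
  next
    case 2
    then have a: "1 \<le> a" using lev by (simp add: level_simps)
    have "pivot i = (a - 1, \<kappa>(num_parts \<kappa> := 1))" using 2 by (simp add: i pivot_def)
    moreover have "n - (a - 1) = Suc (n - a)" using a 2(1) by simp
    moreover have "level n (a - 1, \<kappa>(num_parts \<kappa> := 1)) = a" using a 2(1) by (simp add: level_def)
    ultimately show ?thesis
      using add_last_part[OF 2(2,4)] a 2(1) by (simp add: twin_index_iff i level_simps)
  qed
  then show "pivot i \<in> twin_index n" "Suc (level n (pivot i)) = level n i"
    "num_parts (snd i) < num_parts (snd (pivot i))" by auto
qed

lemma inj_on_pivot: "inj_on pivot (upper_index n)"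
proof (rule inj_onI)
  fix i j assume ij: "i \<in> upper_index n" "j \<in> upper_index n" "pivot i = pivot j"
  obtain a \<kappa> b \<tau> where i: "i = (a, \<kappa>)" and j: "j = (b, \<tau>)" by (cases i; cases j)
  have J: "(a, \<kappa>) \<in> twin_index n" "(b, \<tau>) \<in> twin_index n" and lev: "2 \<le> level n (a, \<kappa>)" "2 \<le> level n (b, \<tau>)"
    using ij by (auto simp: upper_index_def i j)
  have long: "num_parts (snd (pivot (a, \<kappa>))) = Suc (num_parts \<kappa>)" "pivot (a, \<kappa>) = (a - 1, \<kappa>(num_parts \<kappa> := 1))" "1 \<le> a"
    if "a + 2 \<le> n" "\<kappa> \<in> twin (n - a)" "\<kappa> \<noteq> (\<lambda>_. 0)" "2 \<le> num_parts \<kappa>" "2 \<le> level n (a, \<kappa>)" for a \<kappa>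
  proof -
    show "pivot (a, \<kappa>) = (a - 1, \<kappa>(num_parts \<kappa> := 1))" using that by (simp add: pivot_def)
    then show "num_parts (snd (pivot (a, \<kappa>))) = Suc (num_parts \<kappa>)" using add_last_part(3)[OF that(2,4)] by simp
    show "1 \<le> a" using that by (simp add: level_simps)
  qed
  have short: "num_parts (snd (pivot (n, \<lambda>_. 0))) = 2" by (simp add: pivot_def num_parts_two_ones)
  from J(1) show "i = j"
  proof (cases rule: twin_index_cases)
    case 1
    from J(2) show ?thesis
    proof (cases rule: twin_index_cases)
      case 1
      then show ?thesis using \<open>a = n\<close> \<open>\<kappa> = (\<lambda>_. 0)\<close> by (simp add: i j)
    next
      case 2
      then show ?thesis using long[OF 2 lev(2)] short 1 ij(3) by (simp add: i j)
    qed
  next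
    case 2
    note l = long[OF 2 lev(1)]
    from J(2) show ?thesis
    proof (cases rule: twin_index_cases)
      case 1
      then have "num_parts (snd (pivot (a, \<kappa>))) = num_parts (snd (pivot (n, \<lambda>_. 0)))"
        using ij(3) by (simp only: i j)
      then show ?thesis using l(1) short 2(4) by linarith
    next
      case b: 2
      note l' = long[OF b lev(2)]
      have num: "num_parts \<kappa> = num_parts \<tau>" using l(1) l'(1) ij(3) by (simp add: i j)
      have upd: "\<kappa>(num_parts \<tau> := 1) = \<tau>(num_parts \<tau> := 1)" and "a - 1 = b - 1"
        using l(2) l'(2) ij(3) by (simp_all add: i j num)
      then have "a = b" using l(3) l'(3) by simp
      have "\<kappa> x = \<tau> x" for x
      proof (cases "x = num_parts \<tau>")
        case True
        then show ?thesis
          using num_parts_iff[OF twin_shapesD(1)[OF 2(2)], of x] num_parts_iff[OF twin_shapesD(1)[OF b(2)], of x] num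
          by simp
      next
        case False
        then show ?thesis using fun_cong[OF upd, of x] by simp
      qed
      then show ?thesis using \<open>a = b\<close> by (auto simp: i j)
    qed
  qed
qed

lemma module_hom_Up_pow: "Modules.module_hom fscale fscale (Up ^^ k)"
proof (induction k)
  case 0
  show ?case unfolding funpow.simps(1) id_def by (rule fm.module_hom_ident)
next
  case (Suc k)
  then show ?case using module_hom_compose[OF Suc.IH module_hom_Up] by (simp only: funpow.simps)
qed

lemma Up_pow_span:
  assumes "v \<in> fm.span S" shows "(Up ^^ k) v \<in> fm.span ((Up ^^ k) ` S)"
proof -
  interpret U: Modules.module_hom fscale fscale "Up ^^ k" by (rule module_hom_Up_pow)
  show ?thesis using assms by (simp add: U.span_image)
qed

text \<open>
  Both sides are the shape with a single box.  This link between \<open>U\<^sup>n\<^sup>-\<^sup>2 (1,1)\<close> and \<open>U\<^sup>n\<close> of the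
  empty shape skips the power \<open>n - 1\<close> and is the reason why \<open>a\<^sub>n(x)\<close> is \<open>n + 1 + x\<close> instead of
  \<open>n + x\<close>.
\<close>
lemma Down_delta_two_ones: "Down (delta two_ones) = Up (delta (\<lambda>_. 0))"
proof -
  define one :: "nat \<Rightarrow> nat" where "one = (\<lambda>_. 0)(0 := 1)"
  have one_par: "one \<in> shapes" by (rule shapesI[of _ 1]) (auto simp: one_def)
  have to_par: "two_ones \<in> shapes" using two_ones_twin by (rule twin_shapesD)
  have two: "two_ones = one(1 := Suc (one 1))" by (auto simp: two_ones_def one_def)
  have "remove_box two_ones = {one}"
  proof (intro equalityI subsetI)
    fix \<kappa> assume "\<kappa> \<in> remove_box two_ones"
    then obtain i where i: "two_ones = \<kappa>(i := Suc (\<kappa> i))" and \<kappa>: "\<kappa> \<in> shapes" by (auto simp: remove_box_def add_box_def)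
    have val: "two_ones j = (if j = i then Suc (\<kappa> i) else \<kappa> j)" for j by (subst i) simp
    have "i < 2" using val[of i] by (simp add: two_ones_def split: if_splits)
    moreover have "i \<noteq> 0"
    proof
      assume "i = 0"
      then show False using val[of 0] val[of 1] shapes_antimono[OF \<kappa>, of 0 1] by (simp add: two_ones_def)
    qed
    ultimately have "i = 1" by simp
    then have "\<kappa> j = one j" for j using val[of j] by (cases "j = 0"; cases "j = 1") (simp_all add: two_ones_def one_def)
    then show "\<kappa> \<in> {one}" by auto
  next
    fix \<kappa> assume "\<kappa> \<in> {one}"
    then have \<kappa>: "\<kappa> = one" by simp
    have "two_ones \<in> add_box one" unfolding add_box_def using two to_par by blast
    then show "\<kappa> \<in> remove_box two_ones" using one_par \<kappa> by (simp add: remove_box_def)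
  qed
  moreover have "add_box (\<lambda>_. 0) = {one}"
  proof (intro equalityI subsetI)
    fix \<nu> assume "\<nu> \<in> add_box (\<lambda>_. 0)"
    then obtain i where i: "\<nu> = (\<lambda>_. 0)(i := 1)" and \<nu>: "\<nu> \<in> shapes" by (auto simp: add_box_def)
    have "i = 0" using shapes_antimono[OF \<nu>, of 0 i] by (simp add: i split: if_splits)
    then show "\<nu> \<in> {one}" by (simp add: i one_def)
  next
    fix \<nu> assume "\<nu> \<in> {one}"
    then show "\<nu> \<in> add_box (\<lambda>_. 0)" using one_par by (auto simp: add_box_def one_def)
  qed
  ultimately show ?thesis by (simp add: Down_delta[OF to_par] Up_delta)
qed

lemma twin_vec_Up_pow: "(Up ^^ k) (delta \<kappa>) = twin_vec (k, \<kappa>)"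
  "(Up ^^ k) (Up (delta \<kappa>)) = twin_vec (Suc k, \<kappa>)"
  by (simp_all add: twin_vec_def funpow_swap1)

lemma Up_pow_Down_twin:
  assumes J: "(a, \<mu>) \<in> twin_index n" and ne: "\<mu> \<noteq> two_ones"
  shows "(Up ^^ Suc a) (Down (delta \<mu>)) - (\<Sum>\<kappa>\<in>remove_box \<mu> \<inter> twin (n - Suc a). twin_vec (Suc a, \<kappa>)) \<in>
    fm.span (twin_vec ` {\<kappa> \<in> twin_index n. level n (a, \<mu>) < level n \<kappa> \<and> num_parts \<mu> \<le> num_parts (snd \<kappa>)})"
proof -
  interpret U: Modules.module_hom fscale fscale "Up ^^ Suc a" by (rule module_hom_Up_pow)
  let ?m = "n - a"
  let ?S1 = "{\<kappa> \<in> twin (?m - 1). num_parts \<mu> \<le> num_parts \<kappa> \<and> 2 \<le> ?m}"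
  let ?S2 = "{\<kappa> \<in> twin (?m - 2). num_parts \<mu> \<le> num_parts \<kappa> \<and> 2 \<le> ?m}"
  let ?T = "{\<kappa> \<in> twin_index n. level n (a, \<mu>) < level n \<kappa> \<and> num_parts \<mu> \<le> num_parts (snd \<kappa>)}"
  have \<mu>: "\<mu> \<in> twin ?m" using J by (simp add: twin_index_iff)
  have "(Up ^^ Suc a) (Down (delta \<mu>) - (\<Sum>\<kappa>\<in>remove_box \<mu> \<inter> twin (?m - 1). delta \<kappa>)) \<in>
      fm.span ((Up ^^ Suc a) ` (delta ` ?S1 \<union> Up ` delta ` ?S2))"
    using Down_delta_twin[OF \<mu> ne] by (rule Up_pow_span)
  also have "\<dots> \<subseteq> fm.span (twin_vec ` ?T)"
  proof (rule fm.span_mono, rule subsetI)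
    fix v assume "v \<in> (Up ^^ Suc a) ` (delta ` ?S1 \<union> Up ` delta ` ?S2)"
    then consider \<kappa> where "\<kappa> \<in> ?S1" "v = (Up ^^ Suc a) (delta \<kappa>)"
      | \<kappa> where "\<kappa> \<in> ?S2" "v = (Up ^^ Suc a) (Up (delta \<kappa>))" by blast
    then show "v \<in> twin_vec ` ?T"
    proof cases
      case 1
      then have "2 \<le> n - a" by blast
      then have "a + 2 \<le> n" by linarith
      then have "(Suc a, \<kappa>) \<in> ?T" using 1 by (simp add: twin_index_iff level_def diff_diff_eq)
      then show ?thesis unfolding 1(2) twin_vec_Up_pow by (rule imageI)
    next
      case 2
      then have "2 \<le> n - a" by blast
      then have "a + 2 \<le> n" by linarith
      then have "(Suc (Suc a), \<kappa>) \<in> ?T" using 2 by (simp add: twin_index_iff level_def diff_diff_eq)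
      then show ?thesis unfolding 2(2) twin_vec_Up_pow by (rule imageI)
    qed
  qed
  finally have "(Up ^^ Suc a) (Down (delta \<mu>) - (\<Sum>\<kappa>\<in>remove_box \<mu> \<inter> twin (?m - 1). delta \<kappa>)) \<in> fm.span (twin_vec ` ?T)" .
  moreover have "n - Suc a = ?m - 1" by simp
  ultimately show ?thesis by (simp only: U.diff U.sum twin_vec_Up_pow)
qed

text \<open>
  The operator \<open>T\<^sub>1 + x\<close> in the basis of Schur functions.
\<close>
definition shifted_T :: "((nat \<Rightarrow> nat) \<Rightarrow> int poly) \<Rightarrow> (nat \<Rightarrow> nat) \<Rightarrow> int poly" where
  "shifted_T f = Down (Up f) + fscale [:0, 1:] f"

lemma module_hom_shifted_T: "Modules.module_hom fscale fscale shifted_T"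
  by unfold_locales (auto simp: shifted_T_def Up.add Down.add Up.scale Down.scale fun_eq_iff algebra_simps)

lemma shifted_T_twin_vec:
  assumes "(a, \<mu>) \<in> twin_index n"
  shows "shifted_T (twin_vec (a, \<mu>)) =
    fscale (a_poly n (level n (a, \<mu>))) (twin_vec (a, \<mu>)) + (Up ^^ Suc a) (Down (delta \<mu>))"
proof -
  have "\<mu> \<in> shapes" using assms twin_shapesD(1) by (auto simp: twin_index_iff)
  then have outside: "delta \<mu> \<nu> = 0" if "\<nu> \<notin> shapes" for \<nu> using that by (auto simp: delta_def)
  have poly: "a_poly n (level n (a, \<mu>)) = of_nat (Suc a) + [:0, 1:]"
    using assms by (cases rule: twin_index_cases) (auto simp: level_simps a_poly_def of_nat_poly)
  have "Down (Up (twin_vec (a, \<mu>))) = (Up ^^ Suc a) (Down (delta \<mu>)) + fscale (of_nat (Suc a)) (twin_vec (a, \<mu>))"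
    using Down_Up_pow[of "delta \<mu>" a] outside by (simp add: twin_vec_def)
  then show ?thesis unfolding shifted_T_def poly fm.scale_left_distrib by simp
qed

text \<open>
  The hypotheses of \<open>smith_of_chained_levels\<close> on the images of the spanning vectors.
\<close>
lemma shifted_T_coefficients:
  assumes J: "i \<in> twin_index n"
  shows "\<exists>c. shifted_T (twin_vec i) = fscale (a_poly n (level n i)) (twin_vec i) +
      (\<Sum>\<kappa> | \<kappa> \<in> twin_index n \<and> level n i < level n \<kappa>. fscale (c \<kappa>) (twin_vec \<kappa>)) \<and>
    (\<forall>\<tau>\<in>upper_index n. i = pivot \<tau> \<longrightarrow> c \<tau> = 1 \<and>
      (\<forall>\<kappa>\<in>twin_index n. \<kappa> \<noteq> \<tau> \<longrightarrow> c \<kappa> \<noteq> 0 \<longrightarrow> num_parts (snd \<tau>) < num_parts (snd \<kappa>)))"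
proof (cases "i \<in> pivot ` upper_index n")
  case False
  obtain a \<mu> where i: "i = (a, \<mu>)" by (cases i)
  let ?T = "{\<kappa> \<in> twin_index n. level n i < level n \<kappa>}"
  have ne: "\<mu> \<noteq> two_ones"
  proof
    assume \<mu>: "\<mu> = two_ones"
    then have a: "n = a + 2"
      using J twin_shapesD(2)[OF two_ones_twin] twin_shapesD(2)[of \<mu> "n - a"] by (auto simp: i twin_index_iff)
    have "(n, \<lambda>_. 0) \<in> upper_index n" using a by (simp add: upper_index_def twin_index_iff twin_0 level_simps)
    moreover have "pivot (n, \<lambda>_. 0) = i" by (simp add: pivot_def i \<mu> a)
    ultimately show False using False by blast
  qed
  have "(Up ^^ Suc a) (Down (delta \<mu>)) - (\<Sum>\<kappa>\<in>remove_box \<mu> \<inter> twin (n - Suc a). twin_vec (Suc a, \<kappa>)) \<in> fm.span (twin_vec ` ?T)"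
    using Up_pow_Down_twin[of a \<mu> n] J ne fm.span_mono[of "twin_vec ` {\<kappa> \<in> twin_index n.
      level n (a, \<mu>) < level n \<kappa> \<and> num_parts \<mu> \<le> num_parts (snd \<kappa>)}" "twin_vec ` ?T"] i by blast
  moreover have "(\<Sum>\<kappa>\<in>remove_box \<mu> \<inter> twin (n - Suc a). twin_vec (Suc a, \<kappa>)) \<in> fm.span (twin_vec ` ?T)"
  proof (rule fm.span_sum)
    fix \<kappa> assume \<kappa>: "\<kappa> \<in> remove_box \<mu> \<inter> twin (n - Suc a)"
    have "a + 2 \<le> n"
      using J unfolding i
    proof (cases rule: twin_index_cases)
      case 1
      then show ?thesis using \<kappa> shape_size_add_box[of \<kappa> \<mu>] by (simp add: remove_box_def)
    qed
    then have "(Suc a, \<kappa>) \<in> ?T" using \<kappa> by (simp add: twin_index_iff i level_def)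
    then show "twin_vec (Suc a, \<kappa>) \<in> fm.span (twin_vec ` ?T)" by (intro fm.span_base imageI)
  qed
  ultimately have "(Up ^^ Suc a) (Down (delta \<mu>)) \<in> fm.span (twin_vec ` ?T)"
    using fm.span_add by fastforce
  then obtain c where "(Up ^^ Suc a) (Down (delta \<mu>)) = (\<Sum>\<kappa>\<in>?T. fscale (c \<kappa>) (twin_vec \<kappa>))"
    using fm_span_image_obtain[of ?T] finite_twin_index[of n] by auto
  then show ?thesis using shifted_T_twin_vec[of a \<mu> n] J False by (auto simp: i)
next
  case True
  then obtain \<tau> where \<tau>: "\<tau> \<in> upper_index n" "i = pivot \<tau>" by blast
  let ?T = "{\<kappa> \<in> twin_index n. level n i < level n \<kappa> \<and> num_parts (snd \<tau>) < num_parts (snd \<kappa>)}"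
  obtain a \<mu> where i: "i = (a, \<mu>)" by (cases i)
  obtain b \<kappa> where \<tau>_eq: "\<tau> = (b, \<kappa>)" by (cases \<tau>)
  have \<tau>J: "(b, \<kappa>) \<in> twin_index n" and lev: "2 \<le> level n (b, \<kappa>)"
    using \<tau>(1) by (auto simp: upper_index_def \<tau>_eq)
  have "(Up ^^ Suc a) (Down (delta \<mu>)) - twin_vec \<tau> \<in> fm.span (twin_vec ` ?T)"
    using \<tau>J
  proof (cases rule: twin_index_cases)
    case 1
    then have "2 \<le> n" using lev by (simp add: level_simps)
    then have "\<mu> = two_ones" "n = Suc (Suc a)" using \<tau>(2) 1 by (auto simp: \<tau>_eq i pivot_def)
    then have "(Up ^^ Suc a) (Down (delta \<mu>)) = twin_vec \<tau>"
      unfolding \<open>\<mu> = two_ones\<close> Down_delta_two_ones twin_vec_Up_pow using 1 by (simp add: \<tau>_eq)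
    then show ?thesis by (simp add: fm.span_zero)
  next
    case 2
    then have b: "1 \<le> b" using lev by (simp add: level_simps)
    have a\<mu>: "a = b - 1" "\<mu> = \<kappa>(num_parts \<kappa> := 1)" using \<tau>(2) 2 by (auto simp: \<tau>_eq i pivot_def)
    then have b_eq: "b = Suc a" using b by simp
    note last = add_last_part[OF 2(2,4), folded a\<mu>(2)]
    have "\<mu> \<noteq> two_ones" using last(3) 2(4) num_parts_two_ones by auto
    then have *: "(Up ^^ Suc a) (Down (delta \<mu>)) - (\<Sum>\<kappa>\<in>remove_box \<mu> \<inter> twin (n - Suc a). twin_vec (Suc a, \<kappa>)) \<in>
        fm.span (twin_vec ` {\<kappa> \<in> twin_index n. level n (a, \<mu>) < level n \<kappa> \<and> num_parts \<mu> \<le> num_parts (snd \<kappa>)})"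
      using J by (intro Up_pow_Down_twin) (simp_all add: i)
    have "twin_vec ` {\<kappa> \<in> twin_index n. level n (a, \<mu>) < level n \<kappa> \<and> num_parts \<mu> \<le> num_parts (snd \<kappa>)} \<subseteq> twin_vec ` ?T"
      using last(3) by (intro image_mono) (auto simp: i \<tau>_eq)
    then have rest: "(Up ^^ Suc a) (Down (delta \<mu>)) - (\<Sum>\<kappa>\<in>remove_box \<mu> \<inter> twin (n - Suc a). twin_vec (Suc a, \<kappa>)) \<in>
        fm.span (twin_vec ` ?T)" using * fm.span_mono by blast
    have \<mu>_par: "\<mu> \<in> shapes" using last(1) by (rule twin_shapesD)
    have fin: "finite (remove_box \<mu> \<inter> twin (n - Suc a))" using finite_remove_box[OF \<mu>_par] by simp
    have mem: "\<kappa> \<in> remove_box \<mu> \<inter> twin (n - Suc a)" using last(2) 2(2) b_eq by simp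
    have "(\<Sum>\<sigma>\<in>remove_box \<mu> \<inter> twin (n - Suc a) - {\<kappa>}. twin_vec (Suc a, \<sigma>)) \<in> fm.span (twin_vec ` ?T)"
    proof (rule fm.span_sum)
      fix \<sigma> assume \<sigma>: "\<sigma> \<in> remove_box \<mu> \<inter> twin (n - Suc a) - {\<kappa>}"
      then have "(Suc a, \<sigma>) \<in> ?T"
        using last(4)[of \<sigma>] 2(1) b_eq by (simp add: twin_index_iff i \<tau>_eq level_def)
      then show "twin_vec (Suc a, \<sigma>) \<in> fm.span (twin_vec ` ?T)" by (intro fm.span_base imageI)
    qed
    from fm.span_add[OF rest this] show ?thesis
      unfolding sum.remove[OF fin mem] by (simp add: \<tau>_eq b_eq)
  qed
  then obtain c where c: "(Up ^^ Suc a) (Down (delta \<mu>)) - twin_vec \<tau> = (\<Sum>\<kappa>\<in>?T. fscale (c \<kappa>) (twin_vec \<kappa>))"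
    using fm_span_image_obtain[of ?T] finite_twin_index[of n] by auto
  define d where "d \<kappa> = (if \<kappa> = \<tau> then 1 else if \<kappa> \<in> ?T then c \<kappa> else 0)" for \<kappa>
  let ?U = "{\<kappa> \<in> twin_index n. level n i < level n \<kappa>}"
  have \<tau>U: "\<tau> \<in> ?U" using \<tau>J pivot(2)[OF \<tau>(1)] \<tau>(2) by (simp add: \<tau>_eq)
  have "(\<Sum>\<kappa>\<in>?U. fscale (d \<kappa>) (twin_vec \<kappa>)) =
      fscale (d \<tau>) (twin_vec \<tau>) + (\<Sum>\<kappa>\<in>?U - {\<tau>}. fscale (d \<kappa>) (twin_vec \<kappa>))"
    using \<tau>U finite_twin_index[of n] by (intro sum.remove) auto
  also have "(\<Sum>\<kappa>\<in>?U - {\<tau>}. fscale (d \<kappa>) (twin_vec \<kappa>)) = (\<Sum>\<kappa>\<in>?T. fscale (c \<kappa>) (twin_vec \<kappa>))"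
    using finite_twin_index[of n] by (intro sum.mono_neutral_cong_right) (auto simp: d_def)
  also have "fscale (d \<tau>) (twin_vec \<tau>) + \<dots> = (Up ^^ Suc a) (Down (delta \<mu>))"
    unfolding c[symmetric] by (simp add: d_def)
  finally have "(\<Sum>\<kappa>\<in>?U. fscale (d \<kappa>) (twin_vec \<kappa>)) = (Up ^^ Suc a) (Down (delta \<mu>))" .
  then have "shifted_T (twin_vec i) = fscale (a_poly n (level n i)) (twin_vec i) +
      (\<Sum>\<kappa>\<in>?U. fscale (d \<kappa>) (twin_vec \<kappa>))"
    using shifted_T_twin_vec[of a \<mu> n] J by (simp add: i)
  moreover have "d \<tau>' = 1 \<and> (\<forall>\<kappa>\<in>twin_index n. \<kappa> \<noteq> \<tau>' \<longrightarrow> d \<kappa> \<noteq> 0 \<longrightarrow> num_parts (snd \<tau>') < num_parts (snd \<kappa>))"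
    if "\<tau>' \<in> upper_index n" "i = pivot \<tau>'" for \<tau>'
  proof -
    have "\<tau>' = \<tau>" using inj_on_pivot[of n] that \<tau> by (metis inj_onD)
    then show ?thesis by (auto simp: d_def)
  qed
  ultimately show ?thesis by blast
qed

definition smith_entry :: "nat \<Rightarrow> nat \<times> (nat \<Rightarrow> nat) \<Rightarrow> int poly" where
  "smith_entry n i = (if i \<in> pivot ` upper_index n then 1 else alpha n (level n i))"

theorem shifted_T_smith_bases:
  assumes n: "n \<ge> 1"
  obtains p q where
    "\<And>i. i \<in> twin_index n \<Longrightarrow> shifted_T (q i) = fscale (smith_entry n i) (p i)"
    "\<And>\<nu>. \<nu> \<in> shapes_of n \<Longrightarrow> delta \<nu> \<in> fm.span (p ` twin_index n)"
    "\<And>\<nu>. \<nu> \<in> shapes_of n \<Longrightarrow> delta \<nu> \<in> fm.span (q ` twin_index n)"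
proof -
  obtain c where c: "\<And>i. i \<in> twin_index n \<Longrightarrow>
      shifted_T (twin_vec i) = fscale (a_poly n (level n i)) (twin_vec i) +
        (\<Sum>\<kappa> | \<kappa> \<in> twin_index n \<and> level n i < level n \<kappa>. fscale (c \<kappa> i) (twin_vec \<kappa>)) \<and>
      (\<forall>\<tau>\<in>upper_index n. i = pivot \<tau> \<longrightarrow> c \<tau> i = 1 \<and>
        (\<forall>\<kappa>\<in>twin_index n. \<kappa> \<noteq> \<tau> \<longrightarrow> c \<kappa> i \<noteq> 0 \<longrightarrow> num_parts (snd \<tau>) < num_parts (snd \<kappa>)))"
  proof -
    from shifted_T_coefficients have "\<exists>c. \<forall>i\<in>twin_index n.
      shifted_T (twin_vec i) = fscale (a_poly n (level n i)) (twin_vec i) +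
        (\<Sum>\<kappa> | \<kappa> \<in> twin_index n \<and> level n i < level n \<kappa>. fscale (c i \<kappa>) (twin_vec \<kappa>)) \<and>
      (\<forall>\<tau>\<in>upper_index n. i = pivot \<tau> \<longrightarrow> c i \<tau> = 1 \<and>
        (\<forall>\<kappa>\<in>twin_index n. \<kappa> \<noteq> \<tau> \<longrightarrow> c i \<kappa> \<noteq> 0 \<longrightarrow> num_parts (snd \<tau>) < num_parts (snd \<kappa>)))"
      by (intro bchoice) blast
    then obtain c where "\<forall>i\<in>twin_index n.
      shifted_T (twin_vec i) = fscale (a_poly n (level n i)) (twin_vec i) +
        (\<Sum>\<kappa> | \<kappa> \<in> twin_index n \<and> level n i < level n \<kappa>. fscale (c i \<kappa>) (twin_vec \<kappa>)) \<and>
      (\<forall>\<tau>\<in>upper_index n. i = pivot \<tau> \<longrightarrow> c i \<tau> = 1 \<and>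
        (\<forall>\<kappa>\<in>twin_index n. \<kappa> \<noteq> \<tau> \<longrightarrow> c i \<kappa> \<noteq> 0 \<longrightarrow> num_parts (snd \<tau>) < num_parts (snd \<kappa>)))" ..
    then show ?thesis by (intro that[of "\<lambda>\<kappa> i. c i \<kappa>"]) blast
  qed
  have span: "delta \<nu> \<in> fm.span S" if "twin_vec ` twin_index n \<subseteq> fm.span S" "\<nu> \<in> shapes_of n" for S \<nu>
    using delta_in_span_twin_vec[OF that(2)] fm.span_minimal[OF that(1) fm.subspace_span] by blast
  show ?thesis
  proof (rule fm.smith_of_chained_levels[where J = "twin_index n" and lev = "level n" and b = twin_vec and
      L = shifted_T and \<phi> = pivot and rank = "\<lambda>i. num_parts (snd i)" and a = "a_poly n" and c = c,
      folded upper_index_def])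
    show "Modules.module_hom fscale fscale shifted_T" by (rule module_hom_shifted_T)
    show "finite (twin_index n)" by (rule finite_twin_index)
    show "1 \<le> level n i" for i using n by (simp add: level_def split: prod.split)
    show "shifted_T (twin_vec i) = fscale (a_poly n (level n i)) (twin_vec i) +
        (\<Sum>\<kappa> | \<kappa> \<in> twin_index n \<and> level n i < level n \<kappa>. fscale (c \<kappa> i) (twin_vec \<kappa>))"
      if "i \<in> twin_index n" for i using c[OF that] by blast
    show "c \<tau> (pivot \<tau>) = 1" if "\<tau> \<in> upper_index n" for \<tau>
      using c[OF pivot(1)[OF that]] that by blast
    show "num_parts (snd \<tau>) < num_parts (snd \<kappa>)"
      if "\<tau> \<in> upper_index n" "\<kappa> \<in> twin_index n" "\<kappa> \<noteq> \<tau>" "c \<kappa> (pivot \<tau>) \<noteq> 0" for \<tau> \<kappa>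
      using c[OF pivot(1)[OF that(1)]] that by blast
    fix p q
    assume "\<And>i. i \<in> twin_index n \<Longrightarrow> shifted_T (q i) =
        fscale (if i \<in> pivot ` upper_index n then 1 else \<Prod>i = 1..level n i. a_poly n i) (p i)"
      and "twin_vec ` twin_index n \<subseteq> fm.span (p ` twin_index n)"
      and "twin_vec ` twin_index n \<subseteq> fm.span (q ` twin_index n)"
    then show ?thesis using span by (intro that[of q p]) (auto simp: smith_entry_def alpha_def)
  qed (use pivot in auto)
qed

lemma card_shapes_of: "card (shapes_of n) = num_partitions n"
  using bij_betw_same_card[OF bij_betw_shape_fun[of n]] by (simp add: num_partitions_def)

lemma card_level:
  assumes "1 \<le> i" "i \<le> n"
  shows "card {\<kappa> \<in> twin_index n. level n \<kappa> = i} =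
    (if i = n then 1 else num_partitions (Suc n - i) - num_partitions (n - i))"
proof (cases "i = n")
  case True
  have "{\<kappa> \<in> twin_index n. level n \<kappa> = i} = {(n, \<lambda>_. 0)}"
  proof (intro equalityI subsetI)
    fix \<kappa> assume "\<kappa> \<in> {\<kappa> \<in> twin_index n. level n \<kappa> = i}"
    moreover obtain a \<mu> where \<kappa>: "\<kappa> = (a, \<mu>)" by (cases \<kappa>)
    ultimately have J: "(a, \<mu>) \<in> twin_index n" and lev: "level n (a, \<mu>) = n" using True by auto
    from J show "\<kappa> \<in> {(n, \<lambda>_. 0)}"
      by (cases rule: twin_index_cases) (use lev \<kappa> in \<open>auto simp: level_simps\<close>)
  qed (use True in \<open>auto simp: twin_index_iff twin_0 level_simps\<close>)
  then show ?thesis using True by simp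
next
  case False
  have "{\<kappa> \<in> twin_index n. level n \<kappa> = i} = Pair (i - 1) ` twin (Suc n - i)"
  proof (intro equalityI subsetI)
    fix \<kappa> assume "\<kappa> \<in> {\<kappa> \<in> twin_index n. level n \<kappa> = i}"
    moreover obtain a \<mu> where \<kappa>: "\<kappa> = (a, \<mu>)" by (cases \<kappa>)
    ultimately have J: "(a, \<mu>) \<in> twin_index n" and lev: "level n (a, \<mu>) = i" by auto
    from J show "\<kappa> \<in> Pair (i - 1) ` twin (Suc n - i)"
    proof (cases rule: twin_index_cases)
      case 1
      then show ?thesis using lev False by (simp add: level_simps)
    next
      case 2
      then have "i = Suc a" using lev by (simp add: level_simps)
      then show ?thesis using 2(2) \<kappa> by simp
    qed
  next
    fix \<kappa> assume "\<kappa> \<in> Pair (i - 1) ` twin (Suc n - i)"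
    moreover have "n - (i - 1) = Suc n - i" using assms by simp
    ultimately show "\<kappa> \<in> {\<kappa> \<in> twin_index n. level n \<kappa> = i}"
      using assms False by (auto simp: twin_index_iff level_def)
  qed
  then have "card {\<kappa> \<in> twin_index n. level n \<kappa> = i} = card (twin (Suc n - i))"
    by (simp add: card_image inj_on_def)
  moreover have "Suc n - i = Suc (n - i)" using assms by simp
  moreover have "card (twin (Suc (n - i))) = num_partitions (Suc (n - i)) - num_partitions (n - i)"
    using card_twin[of "n - i"] by (simp add: card_shapes_of)
  ultimately show ?thesis using False by (simp only: if_False)
qed

section \<open>Counting the diagonal entries\<close>

lemma filter_map_upt_card:
  "length (filter P (map L [m..<n])) = card {k. m \<le> k \<and> k < n \<and> P (L k)}"
proof -
  have "length (filter P (map L [m..<n])) = length (filter (\<lambda>k. P (L k)) [m..<n])"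
    by (simp add: filter_map o_def)
  also have "\<dots> = card (set (filter (\<lambda>k. P (L k)) [m..<n]))"
    by (rule distinct_card[symmetric]) simp
  also have "set (filter (\<lambda>k. P (L k)) [m..<n]) = {k. m \<le> k \<and> k < n \<and> P (L k)}" by auto
  finally show ?thesis .
qed

text \<open>
  A part equal to \<open>k\<close> of the conjugate is a column of length \<open>k\<close>, and these columns are counted by the
  difference of the rows \<open>k\<close> and \<open>k + 1\<close>.
\<close>
lemma count_conjugate_partition:
  fixes L :: "nat \<Rightarrow> nat"
  assumes anti: "\<And>k l. 1 \<le> k \<Longrightarrow> k \<le> l \<Longrightarrow> L l \<le> L k" and zero: "\<And>k. n < k \<Longrightarrow> L k = 0"
    and n: "1 \<le> n"
  shows "largest_part (map L [1..<Suc n]) = L 1"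
    and "count (mset (conjugate_partition (map L [1..<Suc n]))) k = (if k = 0 then 0 else L k - L (Suc k))"
proof -
  show largest: "largest_part (map L [1..<Suc n]) = L 1"
    unfolding largest_part_def
  proof (rule Max_eqI)
    show "L 1 \<in> insert 0 (set (map L [1..<Suc n]))" using n by (auto simp del: upt_Suc)
    show "y \<le> L 1" if "y \<in> insert 0 (set (map L [1..<Suc n]))" for y
      using that anti[of 1] by auto
  qed simp
  define h where "h i = card {k. 1 \<le> k \<and> k < Suc n \<and> i \<le> L k}" for i
  have conj: "conjugate_partition (map L [1..<Suc n]) = map h [1..<Suc (L 1)]"
    unfolding conjugate_partition_def largest h_def by (simp only: filter_map_upt_card)
  \<comment> \<open>The indices \<open>k\<close> with \<open>i \<le> L k\<close> form an initial segment, and \<open>h i\<close> is its last element.\<close>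
  have h_iff: "h i = k \<longleftrightarrow> i \<le> L k \<and> L (Suc k) < i" if i: "1 \<le> i" "i \<le> L 1" and k: "1 \<le> k" for i k
  proof -
    define K where "K = {k. 1 \<le> k \<and> k < Suc n \<and> i \<le> L k}"
    have fin: "finite K" by (rule finite_subset[of _ "{..n}"]) (auto simp: K_def)
    have "1 \<in> K" using i n by (simp add: K_def)
    define M where "M = Max K"
    have "M \<in> K" unfolding M_def using fin \<open>1 \<in> K\<close> by (intro Max_in) auto
    have "K = {1..M}"
    proof (intro equalityI subsetI)
      fix x assume "x \<in> K"
      then show "x \<in> {1..M}" using Max_ge[OF fin, of x] by (simp add: M_def K_def)
    next
      fix x assume "x \<in> {1..M}"
      then show "x \<in> K" using \<open>M \<in> K\<close> anti[of x M] by (simp add: K_def)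
    qed
    then have h: "h i = M" by (simp add: h_def K_def)
    have K_iff: "x \<in> K \<longleftrightarrow> i \<le> L x" if "1 \<le> x" for x
      using that zero[of x] i by (cases "n < x") (auto simp: K_def)
    have "h i = k \<longleftrightarrow> k \<in> K \<and> Suc k \<notin> K"
      using \<open>K = {1..M}\<close> k \<open>M \<in> K\<close> h by auto
    then show ?thesis using K_iff[of k] K_iff[of "Suc k"] k by auto
  qed
  have "count (mset (conjugate_partition (map L [1..<Suc n]))) k =
      card {i. 1 \<le> i \<and> i < Suc (L 1) \<and> h i = k}"
    unfolding conj count_mset count_list_eq_length_filter by (simp only: filter_map_upt_card eq_commute)
  also have "\<dots> = (if k = 0 then 0 else L k - L (Suc k))"
  proof (cases "k = 0")
    case True
    have "h i \<noteq> 0" if "1 \<le> i" "i < Suc (L 1)" for i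
    proof -
      have "1 \<in> {k. 1 \<le> k \<and> k < Suc n \<and> i \<le> L k}" using that n by simp
      moreover have "finite {k. 1 \<le> k \<and> k < Suc n \<and> i \<le> L k}" by simp
      ultimately show ?thesis unfolding h_def by (metis card_0_eq empty_iff)
    qed
    then have "{i. 1 \<le> i \<and> i < Suc (L 1) \<and> h i = k} = {}" using True by auto
    then show ?thesis using True by simp
  next
    case False
    have "1 \<le> i \<and> i < Suc (L 1) \<and> h i = k \<longleftrightarrow> i \<in> {Suc (L (Suc k))..L k}" for i
    proof
      assume "1 \<le> i \<and> i < Suc (L 1) \<and> h i = k"
      then show "i \<in> {Suc (L (Suc k))..L k}" using h_iff[of i k] False by simp
    next
      assume i: "i \<in> {Suc (L (Suc k))..L k}"
      then have "1 \<le> i" "i \<le> L 1" using anti[of 1 k] False by auto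
      then show "1 \<le> i \<and> i < Suc (L 1) \<and> h i = k" using h_iff[of i k] i False by simp
    qed
    then have "{i. 1 \<le> i \<and> i < Suc (L 1) \<and> h i = k} = {Suc (L (Suc k))..L k}" by blast
    then show ?thesis using False by simp
  qed
  finally show "count (mset (conjugate_partition (map L [1..<Suc n]))) k = (if k = 0 then 0 else L k - L (Suc k))" .
qed

definition level_size :: "nat \<Rightarrow> nat \<Rightarrow> nat" where
  "level_size n k = card {i \<in> twin_index n. level n i = k}"

lemma level_le: "i \<in> twin_index n \<Longrightarrow> level n i \<le> n"
  by (auto simp: level_def split: prod.split)

lemma finite_upper: "finite (upper_index n)"
  using finite_twin_index[of n] by (simp add: upper_index_def)

text \<open>
  Every vector of level \<open>k + 1\<close> has its own pivot, of level \<open>k\<close>.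
\<close>
lemma card_pivot_level:
  assumes "1 \<le> k"
  shows "card {i \<in> pivot ` upper_index n. level n i = k} = level_size n (Suc k)"
proof -
  have "{i \<in> pivot ` upper_index n. level n i = k} = pivot ` {i \<in> twin_index n. level n i = Suc k}"
    using pivot(2) assms by (force simp: upper_index_def)
  moreover have "inj_on pivot {i \<in> twin_index n. level n i = Suc k}"
    using inj_on_pivot[of n] by (rule inj_on_subset) (use assms in \<open>auto simp: upper_index_def\<close>)
  ultimately show ?thesis by (simp add: card_image level_size_def)
qed

lemma level_size_Suc_le:
  assumes "1 \<le> k" shows "level_size n (Suc k) \<le> level_size n k"
  unfolding card_pivot_level[OF assms, symmetric] unfolding level_size_def
  using finite_twin_index[of n] pivot(1) by (intro card_mono) auto

lemma card_nonpivot_level: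
  assumes "1 \<le> k"
  shows "card {i \<in> twin_index n - pivot ` upper_index n. level n i = k} = level_size n k - level_size n (Suc k)"
proof -
  have "{i \<in> twin_index n - pivot ` upper_index n. level n i = k} =
      {i \<in> twin_index n. level n i = k} - {i \<in> pivot ` upper_index n. level n i = k}" by blast
  moreover have "{i \<in> pivot ` upper_index n. level n i = k} \<subseteq> {i \<in> twin_index n. level n i = k}"
    using pivot(1) by blast
  ultimately show ?thesis
    using finite_upper[of n] by (simp add: card_Diff_subset card_pivot_level[OF assms] level_size_def)
qed

lemma diff_partition_eq:
  assumes "1 \<le> n" shows "diff_partition n = map (level_size n) [1..<Suc n]"
proof -
  have p1: "num_partitions 1 = 1" 
  proof -
    have "card (twin (Suc 0)) + card (shapes_of 0) = card (shapes_of (Suc 0))" by (rule card_twin)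
    then show ?thesis using twin_1 by (simp add: card_shapes_of[symmetric] shapes_of_0)
  qed
  show ?thesis
  proof (rule nth_equalityI)
    show len: "length (diff_partition n) = length (map (level_size n) [1..<Suc n])"
      using assms by (simp add: diff_partition_def del: upt_Suc)
    fix i assume "i < length (diff_partition n)"
    then have i: "i < n" using len by (simp del: upt_Suc)
    have "map (level_size n) [1..<Suc n] ! i = level_size n (Suc i)" using i by (simp del: upt_Suc)
    also have "\<dots> = (if Suc i = n then 1 else num_partitions (Suc n - Suc i) - num_partitions (n - Suc i))"
      unfolding level_size_def using i by (intro card_level) auto
    also have "\<dots> = diff_partition n ! i"
    proof (cases "Suc i = n")
      case True
      then show ?thesis using p1 by (auto simp: diff_partition_def nth_append simp del: upt_Suc)
    next
      case False
      then have lt: "i < length (rev [2..<Suc n])" using i by simp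
      then have "rev [2..<Suc n] ! i = n - i" by (subst rev_nth) (simp_all del: upt_Suc)
      then show ?thesis using False lt by (simp add: diff_partition_def nth_append del: upt_Suc)
    qed
    finally show "diff_partition n ! i = map (level_size n) [1..<Suc n] ! i" by simp
  qed
qed

lemma card_twin_index: "card (twin_index n) = num_partitions n"
proof -
  have "card (twin_index n) = (\<Sum>a\<le>n. card (twin (n - a)))"
    by (simp add: twin_index_def twin_def finite_shapes_of)
  also have "\<dots> = (\<Sum>m\<le>n. card (twin m))"
    using sum.nat_diff_reindex[of "\<lambda>m. card (twin m)" "Suc n"] by (simp add: lessThan_Suc_atMost)
  also have "\<dots> = card (shapes_of n)"
  proof (induction n)
    case 0
    show ?case by (simp add: twin_0 shapes_of_0)
  next
    case (Suc n)
    then show ?case using card_twin[of n] by simp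
  qed
  finally show ?thesis by (simp add: card_shapes_of)
qed

lemma mset_conjugate_diff_partition:
  assumes n: "1 \<le> n"
  shows "mset (conjugate_partition (diff_partition n)) =
      image_mset (level n) (mset_set (twin_index n - pivot ` upper_index n))"
    and "largest_part (diff_partition n) = level_size n 1"
proof -
  have anti: "level_size n l \<le> level_size n k" if "1 \<le> k" "k \<le> l" for k l
    using that(2)
  proof (induction l rule: dec_induct)
    case (step m)
    then show ?case using level_size_Suc_le[of m n] that(1) by simp
  qed simp
  have zero: "level_size n k = 0" if "n < k" for k
  proof -
    have "level n i \<noteq> k" if "i \<in> twin_index n" for i using level_le[OF that] \<open>n < k\<close> by simp
    then have empty: "{i \<in> twin_index n. level n i = k} = {}" by blast
    show ?thesis unfolding level_size_def empty by simp
  qed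
  note conj = count_conjugate_partition[of "level_size n", OF anti zero n, folded diff_partition_eq[OF n]]
  show "largest_part (diff_partition n) = level_size n 1" by (rule conj(1))
  show "mset (conjugate_partition (diff_partition n)) =
      image_mset (level n) (mset_set (twin_index n - pivot ` upper_index n))"
  proof (rule multiset_eqI)
    fix k
    have fin: "finite (twin_index n - pivot ` upper_index n)" using finite_twin_index by simp
    have "count (image_mset (level n) (mset_set (twin_index n - pivot ` upper_index n))) k =
        card {i \<in> twin_index n - pivot ` upper_index n. level n i = k}"
      using fin by (simp add: count_image_mset Int_def vimage_def conj_commute)
    also have "\<dots> = (if k = 0 then 0 else level_size n k - level_size n (Suc k))"
    proof (cases "k = 0")
      case True
      have "level n i \<noteq> 0" for i using n by (auto simp: level_def split: prod.split)
      then have empty: "{i \<in> twin_index n - pivot ` upper_index n. level n i = k} = {}" using True by blast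
      show ?thesis unfolding empty using True by simp
    next
      case False
      then show ?thesis using card_nonpivot_level[of k n] by simp
    qed
    finally show "count (mset (conjugate_partition (diff_partition n))) k =
        count (image_mset (level n) (mset_set (twin_index n - pivot ` upper_index n))) k"
      by (simp add: conj(2))
  qed
qed

lemma mset_smith_diagonal:
  assumes n: "1 \<le> n"
  shows "mset (smith_diagonal n) = image_mset (smith_entry n) (mset_set (twin_index n))"
proof -
  let ?P = "pivot ` upper_index n"
  have sub: "?P \<subseteq> twin_index n" using pivot(1) by blast
  have finP: "finite ?P" using finite_upper by simp
  have "twin_index n = {i \<in> twin_index n. level n i = 1} \<union> upper_index n"
    "{i \<in> twin_index n. level n i = 1} \<inter> upper_index n = {}"
    using n by (auto simp: upper_index_def level_def split: prod.splits)
  then have "card (twin_index n) = level_size n 1 + card (upper_index n)"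
    using card_Un_disjoint[of "{i \<in> twin_index n. level n i = 1}" "upper_index n"]
      finite_twin_index[of n] finite_upper[of n] by (simp add: level_size_def)
  then have card_P: "card ?P = num_partitions n - level_size n 1"
    by (simp add: card_image[OF inj_on_pivot] card_twin_index)
  have "mset_set (twin_index n) = mset_set ?P + mset_set (twin_index n - ?P)"
    using mset_set_Union[of ?P "twin_index n - ?P"] finP finite_twin_index[of n] sub
    by (simp add: Un_absorb1)
  then have "image_mset (smith_entry n) (mset_set (twin_index n)) =
      image_mset (smith_entry n) (mset_set ?P) + image_mset (smith_entry n) (mset_set (twin_index n - ?P))"
    by simp
  also have "image_mset (smith_entry n) (mset_set ?P) = image_mset (\<lambda>_. 1) (mset_set ?P)"
    using finP by (intro image_mset_cong) (simp add: smith_entry_def)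
  also have "image_mset (smith_entry n) (mset_set (twin_index n - ?P)) =
      image_mset (\<lambda>i. alpha n (level n i)) (mset_set (twin_index n - ?P))"
    using finite_twin_index[of n] by (intro image_mset_cong) (simp add: smith_entry_def)
  also have "\<dots> = image_mset (alpha n) (mset (conjugate_partition (diff_partition n)))"
    by (simp add: mset_conjugate_diff_partition(1)[OF n] image_mset.compositionality o_def)
  finally show ?thesis
    by (simp add: smith_diagonal_def mset_conjugate_diff_partition(2)[OF n] card_P image_mset_const_eq)
qed

lemma list_with_image_mset:
  "image_mset f M = mset ys \<Longrightarrow> \<exists>xs. mset xs = M \<and> map f xs = ys"
proof (induction ys arbitrary: M)
  case (Cons y ys)
  then obtain x where x: "x \<in># M" "f x = y"
    by (metis imageE list.set_intros(1) set_image_mset set_mset_mset)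
  then have "image_mset f (M - {#x#}) = mset ys"
    using Cons.prems by (simp add: image_mset_Diff)
  then obtain xs where "mset xs = M - {#x#}" "map f xs = ys" using Cons.IH by blast
  then show ?case using x by (intro exI[of _ "x # xs"]) simp
qed simp

lemma smith_enumeration:
  assumes n: "1 \<le> n"
  obtains g where "bij_betw g {..<num_partitions n} (twin_index n)"
    "\<And>k. k < num_partitions n \<Longrightarrow> smith_diagonal n ! k = smith_entry n (g k)"
proof -
  obtain xs where xs: "mset xs = mset_set (twin_index n)" "map (smith_entry n) xs = smith_diagonal n"
    using list_with_image_mset[OF mset_smith_diagonal[OF n, symmetric]] by blast
  have set: "set xs = twin_index n" using arg_cong[OF xs(1), of set_mset] finite_twin_index by simp
  have len: "length xs = num_partitions n"
    using arg_cong[OF xs(1), of size] by (simp add: card_twin_index)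
  have "distinct xs" using set len by (metis card_distinct card_twin_index)
  then have "bij_betw (\<lambda>k. xs ! k) {..<num_partitions n} (twin_index n)"
    using set len by (intro bij_betw_nth) auto
  moreover have "smith_diagonal n ! k = smith_entry n (xs ! k)" if "k < num_partitions n" for k
    using that len by (simp add: xs(2)[symmetric])
  ultimately show ?thesis by (rule that)
qed

section \<open>From spanning families to unimodular matrices\<close>

definition column_matrix :: "nat \<Rightarrow> (nat \<Rightarrow> (nat \<Rightarrow> nat) \<Rightarrow> int poly) \<Rightarrow> int poly mat" where
  "column_matrix n v = mat (num_partitions n) (num_partitions n) (\<lambda>(r, k). v k (part_fun n r))"

text \<open>
  Expressing the unit vectors in a spanning family of the right cardinality gives the inverse matrix.
\<close>
lemma column_matrix_right_inverse:
  assumes g: "bij_betw g {..<num_partitions n} J"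
    and span: "\<And>\<nu>. \<nu> \<in> shapes_of n \<Longrightarrow> delta \<nu> \<in> fm.span (p ` J)"
  obtains C where "C \<in> carrier_mat (num_partitions n) (num_partitions n)"
    "column_matrix n (\<lambda>k. p (g k)) * C = 1\<^sub>m (num_partitions n)"
proof -
  let ?N = "num_partitions n"
  have finJ: "finite J" using g bij_betw_finite by blast
  have "\<exists>c. delta (part_fun n s) = (\<Sum>i\<in>J. fscale (c i) (p i))" if "s < ?N" for s
    using fm_span_image_obtain[OF finJ span] bij_betwE[OF bij_betw_part_fun[of n]] that by (metis lessThan_iff)
  then obtain c where c: "\<And>s. s < ?N \<Longrightarrow> delta (part_fun n s) = (\<Sum>i\<in>J. fscale (c s i) (p i))" by metis
  define C where "C = mat ?N ?N (\<lambda>(k, s). c s (g k))"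
  have "column_matrix n (\<lambda>k. p (g k)) * C = 1\<^sub>m ?N"
  proof (rule eq_matI)
    fix r s assume rs: "r < dim_row (1\<^sub>m ?N :: int poly mat)" "s < dim_col (1\<^sub>m ?N :: int poly mat)"
    then have "(column_matrix n (\<lambda>k. p (g k)) * C) $$ (r, s) = (\<Sum>k<?N. p (g k) (part_fun n r) * c s (g k))"
      by (simp add: column_matrix_def C_def scalar_prod_def atLeast0LessThan)
    also have "\<dots> = (\<Sum>i\<in>J. p i (part_fun n r) * c s i)"
      by (rule sum.reindex_bij_betw[OF g])
    also have "\<dots> = delta (part_fun n s) (part_fun n r)"
      using c[of s] rs by (simp add: sum_fun_apply mult.commute)
    also have "\<dots> = 1\<^sub>m ?N $$ (r, s)"
      using rs bij_betw_imp_inj_on[OF bij_betw_part_fun[of n]] by (auto simp: delta_def inj_on_def)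
    finally show "(column_matrix n (\<lambda>k. p (g k)) * C) $$ (r, s) = 1\<^sub>m ?N $$ (r, s)" .
  qed (simp_all add: column_matrix_def C_def)
  moreover have "C \<in> carrier_mat ?N ?N" by (simp add: C_def)
  ultimately show ?thesis using that by blast
qed

lemma mat_right_inverse_imp_left_inverse:
  fixes A B :: "'a::comm_ring_1 mat"
  assumes A: "A \<in> carrier_mat n n" and B: "B \<in> carrier_mat n n" and AB: "A * B = 1\<^sub>m n"
  shows "B * A = 1\<^sub>m n"
proof -
  have "det A * det B = 1" using det_mult[OF A B] AB by simp
  define E where "E = det B \<cdot>\<^sub>m adj_mat A"
  note adj = adj_mat[OF A]
  have E: "E \<in> carrier_mat n n" using adj by (simp add: E_def)
  have "E * A = det B \<cdot>\<^sub>m (adj_mat A * A)"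
    unfolding E_def using adj(1) A by (rule mult_smult_assoc_mat)
  also have "\<dots> = 1\<^sub>m n"
    unfolding adj(3) using \<open>det A * det B = 1\<close> by (intro eq_matI) (auto simp: mult.commute)
  finally have EA: "E * A = 1\<^sub>m n" .
  have "E = E * (A * B)" unfolding AB using E by simp
  also have "\<dots> = B" unfolding assoc_mult_mat[OF E A B, symmetric] EA using B by simp
  finally show ?thesis using EA by simp
qed

lemma monic_det_mat_diag:
  fixes f :: "nat \<Rightarrow> int poly"
  assumes "\<And>i. i < N \<Longrightarrow> lead_coeff (f i) = 1"
  shows "lead_coeff (det (mat_diag N f)) = 1"
proof -
  have "det (mat_diag N f) = prod_list (diag_mat (mat_diag N f))"
    by (rule det_upper_triangular[of _ N]) (auto simp: mat_diag_def)
  also have "diag_mat (mat_diag N f) = map f [0..<N]"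
    by (auto simp: diag_mat_def mat_diag_def)
  also have "prod_list (map f [0..<N]) = (\<Prod>i<N. f i)"
    using prod.distinct_set_conv_list[of "[0..<N]" f] by (simp add: atLeast0LessThan)
  finally show ?thesis using assms by (simp add: lead_coeff_prod)
qed

lemma lead_coeff_alpha: "lead_coeff (alpha n k) = 1"
  unfolding alpha_def lead_coeff_prod by (intro prod.neutral) (simp add: a_poly_def)

text \<open>
  Units of \<open>\<int>[x]\<close> are \<open>1\<close> and \<open>-1\<close>, and comparing leading coefficients shows that the two determinants
  agree.  If both are \<open>-1\<close>, change the sign of the first row of \<open>P\<close> and of the first column of \<open>Q\<close>;
  the diagonal matrix is not affected.
\<close>
lemma SL_of_equivalence:
  fixes A P Q :: "int poly mat"
  assumes A: "A \<in> carrier_mat N N" and P: "P \<in> carrier_mat N N" and Q: "Q \<in> carrier_mat N N"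
    and dvd: "det P dvd 1" "det Q dvd 1"
    and eq: "P * A * Q = mat_diag N f"
    and monic: "lead_coeff (det A) = 1" "\<And>i. i < N \<Longrightarrow> lead_coeff (f i) = 1"
    and N: "0 < N"
  shows "\<exists>P\<in>SL N. \<exists>Q\<in>SL N. P * A * Q = mat_diag N f"
proof -
  have unit: "u = 1 \<or> u = -1" if u: "u dvd 1" for u :: "int poly"
  proof -
    obtain c where "u = [:c:]" "c dvd 1" using u unfolding is_unit_poly_iff by blast
    then show ?thesis by (auto simp: one_pCons)
  qed
  have PA: "P * A \<in> carrier_mat N N" using P A by simp
  have "det P * det A * det Q = det (mat_diag N f)"
    using arg_cong[OF eq, of det] by (simp add: det_mult[OF PA Q] det_mult[OF P A])
  then have "lead_coeff (det P) * lead_coeff (det Q) = 1"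
    using monic_det_mat_diag[of N f] monic by (metis lead_coeff_mult mult.right_neutral)
  then consider "det P = 1" "det Q = 1" | "det P = -1" "det Q = -1"
    using unit[OF dvd(1)] unit[OF dvd(2)] by auto
  then show ?thesis
  proof cases
    case 1
    then show ?thesis using P Q eq by (auto simp: SL_def)
  next
    case 2
    define S :: "int poly mat" where "S = mat_diag N (\<lambda>i. if i = 0 then -1 else 1)"
    have S: "S \<in> carrier_mat N N" by (simp add: S_def)
    have "det S = prod_list (diag_mat S)"
      by (rule det_upper_triangular[of _ N]) (auto simp: S_def mat_diag_def)
    also have "diag_mat S = map (\<lambda>i. if i = 0 then -1 else 1) [0..<N]"
      by (auto simp: S_def diag_mat_def mat_diag_def)
    also have "prod_list \<dots> = (\<Prod>i<N. if i = 0 then -1 else 1 :: int poly)"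
      using prod.distinct_set_conv_list[of "[0..<N]" "\<lambda>i. if i = 0 then -1 else 1 :: int poly"]
      by (simp add: atLeast0LessThan)
    also have "\<dots> = -1" using N by (simp add: prod.delta)
    finally have det_S: "det S = -1" .
    have "S * P * A * (Q * S) = S * (P * A * Q) * S"
      using S P A Q by (simp add: assoc_mult_mat[of _ N N _ N _ N])
    also have "\<dots> = mat_diag N f" unfolding eq S_def by (auto intro!: arg_cong[where f = "mat_diag N"])
    finally have "S * P * A * (Q * S) = mat_diag N f" .
    moreover have "S * P \<in> SL N" "Q * S \<in> SL N"
      using S P Q 2 det_S by (auto simp: SL_def det_mult)
    ultimately show ?thesis by blast
  qed
qed

theorem theorem1p2:
  fixes n :: nat
  assumes "n \<ge> 1"
  shows "\<exists>P \<in> SL (num_partitions n). \<exists>Q \<in> SL (num_partitions n).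
    P * (map_mat (\<lambda>c. [:c:]) (M1 n) + [:0, 1:] \<cdot>\<^sub>m 1\<^sub>m (num_partitions n)) * Q =
      mat_diag (num_partitions n) (\<lambda>i. smith_diagonal n ! i)"
proof -
  let ?N = "num_partitions n"
  define A :: "int poly mat" where "A = map_mat (\<lambda>c. [:c:]) (M1 n) + [:0, 1:] \<cdot>\<^sub>m 1\<^sub>m ?N"
  have M1: "M1 n \<in> carrier_mat ?N ?N" by (simp add: M1_eq)
  have A: "A \<in> carrier_mat ?N ?N" using M1 by (simp add: A_def)
  obtain p q where pq: "\<And>i. i \<in> twin_index n \<Longrightarrow> shifted_T (q i) = fscale (smith_entry n i) (p i)"
    "\<And>\<nu>. \<nu> \<in> shapes_of n \<Longrightarrow> delta \<nu> \<in> fm.span (p ` twin_index n)"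
    "\<And>\<nu>. \<nu> \<in> shapes_of n \<Longrightarrow> delta \<nu> \<in> fm.span (q ` twin_index n)"
    by (rule shifted_T_smith_bases[OF assms]) (rule that; assumption)
  obtain g where g: "bij_betw g {..<?N} (twin_index n)"
    "\<And>k. k < ?N \<Longrightarrow> smith_diagonal n ! k = smith_entry n (g k)"
    using smith_enumeration[OF assms] by blast
  define B where "B = column_matrix n (\<lambda>k. p (g k))"
  define Q where "Q = column_matrix n (\<lambda>k. q (g k))"
  let ?D = "mat_diag ?N (\<lambda>i. smith_diagonal n ! i)"
  have carrier: "B \<in> carrier_mat ?N ?N" "Q \<in> carrier_mat ?N ?N"
    by (simp_all add: B_def Q_def column_matrix_def)
  have part: "part_fun n r \<in> shapes_of n" if "r < ?N" for r
    using bij_betwE[OF bij_betw_part_fun[of n]] that by auto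
  have AQ: "A * Q = B * ?D"
  proof (rule eq_matI)
    fix r k assume "r < dim_row (B * ?D)" "k < dim_col (B * ?D)"
    then have rk: "r < ?N" "k < ?N" using carrier by (auto simp: mat_diag_def)
    have gk: "g k \<in> twin_index n" using bij_betwE[OF g(1)] rk by auto
    let ?f = "part_fun n"
    have A_entry: "A $$ (r, s) = of_nat (card (add_box (?f r) \<inter> add_box (?f s))) + (if r = s then [:0, 1:] else 0)"
      if "s < ?N" for s using rk that by (simp add: A_def M1_eq of_nat_poly)
    have "(A * Q) $$ (r, k) = (\<Sum>s<?N. A $$ (r, s) * Q $$ (s, k))"
      using rk A carrier by (simp add: scalar_prod_def atLeast0LessThan)
    also have "\<dots> = (\<Sum>s<?N. (of_nat (card (add_box (?f r) \<inter> add_box (?f s))) + (if r = s then [:0, 1:] else 0)) * q (g k) (?f s))"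
      using rk by (intro sum.cong) (auto simp: A_entry Q_def column_matrix_def)
    also have "\<dots> = (\<Sum>s<?N. of_nat (card (add_box (?f r) \<inter> add_box (?f s))) * q (g k) (?f s)) + [:0, 1:] * q (g k) (?f r)"
      using rk by (simp add: distrib_right sum.distrib if_distrib[of "\<lambda>x. x * _"] cong: if_cong)
    also have "(\<Sum>s<?N. of_nat (card (add_box (?f r) \<inter> add_box (?f s))) * q (g k) (?f s)) = Down (Up (q (g k))) (?f r)"
      unfolding Down_Up_eq_sum[OF part[OF rk(1)]] by (rule sum.reindex_bij_betw[OF bij_betw_part_fun])
    also have "\<dots> + [:0, 1:] * q (g k) (?f r) = shifted_T (q (g k)) (?f r)"
      by (simp add: shifted_T_def)
    also have "\<dots> = smith_diagonal n ! k * p (g k) (?f r)"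
      by (simp add: pq(1)[OF gk] g(2)[OF rk(2)])
    also have "\<dots> = (B * ?D) $$ (r, k)"
      unfolding mat_diag_mult_right[OF carrier(1)] using rk by (simp add: B_def column_matrix_def mult.commute)
    finally show "(A * Q) $$ (r, k) = (B * ?D) $$ (r, k)" .
  qed (use A carrier in \<open>auto simp: mat_diag_def\<close>)
  obtain P where P: "P \<in> carrier_mat ?N ?N" "B * P = 1\<^sub>m ?N"
    using column_matrix_right_inverse[OF g(1) pq(2)] unfolding B_def by blast
  obtain Q' where Q': "Q' \<in> carrier_mat ?N ?N" "Q * Q' = 1\<^sub>m ?N"
    using column_matrix_right_inverse[OF g(1) pq(3)] unfolding Q_def by blast
  have PB: "P * B = 1\<^sub>m ?N" by (rule mat_right_inverse_imp_left_inverse[OF carrier(1) P])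
  have "P * A * Q = P * B * ?D"
    using P A carrier AQ by (simp add: assoc_mult_mat[of _ ?N ?N _ ?N _ ?N])
  also have "\<dots> = ?D" unfolding PB by (rule left_mult_one_mat[OF mat_diag_dim])
  finally have eq: "P * A * Q = ?D" .
  have "det P dvd 1" using det_mult[OF carrier(1) P(1)] P(2) by (metis det_one dvd_triv_right)
  moreover have "det Q dvd 1" using det_mult[OF carrier(2) Q'(1)] Q'(2) by (metis det_one dvd_triv_left)
  moreover have "lead_coeff (det A) = 1"
  proof -
    have "A = char_poly_matrix (- M1 n)"
      using M1 by (intro eq_matI) (auto simp: A_def char_poly_matrix_def)
    then have "det A = char_poly (- M1 n)" by (simp add: char_poly_def)
    then show ?thesis using degree_monic_char_poly[of "- M1 n" ?N] M1 by simp
  qed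
  moreover have "lead_coeff (smith_diagonal n ! i) = 1" if "i < ?N" for i
    using g(2)[OF that] lead_coeff_alpha by (simp add: smith_entry_def)
  moreover have "0 < ?N"
  proof -
    have "(n, \<lambda>_. 0) \<in> twin_index n" by (simp add: twin_index_iff twin_0)
    then show ?thesis using card_twin_index[of n] finite_twin_index[of n] by (metis card_gt_0_iff empty_iff)
  qed
  ultimately show ?thesis
    using SL_of_equivalence[OF A P(1) carrier(2) _ _ eq] unfolding A_def by blast
qed

end
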